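(* Let $p$ be a prime. Let $\mathcal{B}_p$ be the set of balls $\bar B_p(\alpha,\delta)$ with $(\alpha,\delta)$ an admissible pair in $\mathbb{C}_p^{\mathrm{br}}\times(\mathbb{Q}\cup\{\infty\})$, on which $G_p$ acts by $\sigma(\bar B_p(\alpha,\delta))=\bar B_p(\sigma(\alpha),\delta)$, and let $\mathcal{B}_p/G_p$ be the set of orbits. Let $\mathcal{W}_p$ be the set of DVRs $W$ with quotient field $\mathbb{Q}(X)$ and $W\cap\mathbb{Q}=\mathbb{Z}_{(p)}$. Then the map $\Theta_p:\mathcal{B}_p/G_p\to\mathcal{W}_p$, $[\bar B_p(\alpha,\delta)]\mapsto\mathbb{Z}_{(p),\alpha,\delta}$, is well defined and bijective.
   Context: Fix a prime $p$. $\overline{\mathbb{Q}_p}$ is an algebraic closure of $\mathbb{Q}_p$, $v_p$ the unique extension of the $p$-adic valuation, $\mathbb{C}_p$ the completion of $\overline{\mathbb{Q}_p}$. $G_p=\mathrm{Gal}(\overline{\mathbb{Q}_p}/\mathbb{Q}_p)$, identified with the group of continuous $\mathbb{Q}_p$-automorphisms of $\mathbb{C}_p$. $\mathbb{C}_p^{\mathrm{br}}$ is the set of $\alpha\in\mathbb{C}_p$ such that the ramification index of $\mathbb{Q}_p(\alpha)/\mathbb{Q}_p$ (index of $\mathbb{Z}$ in $v_p(\mathbb{Q}_p(\alpha)^* )$) is finite. A pair $(\alpha,\delta)\in\mathbb{C}_p\times(\mathbb{Q}\cup\{\infty\})$ is admissible if: when $\delta\in\mathbb{Q}$, $\alpha\in\overline{\mathbb{Q}_p}$;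 when $\delta=\infty$, $\alpha$ is transcendental over $\mathbb{Q}$. For $\delta\in\mathbb{Q}$, $v_{p,\alpha,\delta}$ is the monomial valuation on $\mathbb{C}_p(X)$ given on polynomials by $v_{p,\alpha,\delta}(\sum_i a_i(X-\alpha)^i)=\min_i\{v_p(a_i)+i\delta\}$; for $\delta=\infty$, $v_{p,\alpha,\infty}(\varphi)=v_p(\varphi(\alpha))$ for $\varphi\in\mathbb{Q}(X)$. $\mathbb{Z}_{(p),\alpha,\delta}=\{\varphi\in\mathbb{Q}(X):v_{p,\alpha,\delta}(\varphi)\ge0\}$. $\bar B_p(\alpha,\delta)=\{x\in\mathbb{C}_p:v_p(x-\alpha)\ge\delta\}$ (equal to $\{\alpha\}$ if $\delta=\infty$). *)

theory Defs
  imports "HOL-Computational_Algebra.Polynomial" "HOL-Computational_Algebra.Fraction_Field"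
    "HOL-Library.Extended_Real"
begin

text \<open>A field K of characteristic 0 with a valuation v : K -> R u {oo} which extends the
 p-adic valuation of Q (normalised by v(p)=1), is complete, algebraically closed and in which
 the algebraic numbers are dense. Any such (K,v) is isometrically isomorphic to (C_p, v_p).\<close>

definition is_Cp :: "nat \<Rightarrow> ('a::field_char_0 \<Rightarrow> ereal) \<Rightarrow> bool" where
  "is_Cp p v \<longleftrightarrow>
     (\<forall>x. v x = \<infinity> \<longleftrightarrow> x = 0) \<and>
     (\<forall>x. v x \<noteq> -\<infinity>) \<and>
     (\<forall>x y. v (x * y) = v x + v y) \<and>
     (\<forall>x y. v (x + y) \<ge> min (v x) (v y)) \<and>
     (\<forall>a b :: int. a \<noteq> 0 \<longrightarrow> b \<noteq> 0 \<longrightarrow>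
        v (of_int a / of_int b) = ereal (of_int (int (multiplicity (int p) a) - int (multiplicity (int p) b)))) \<and>
     (\<forall>X :: nat \<Rightarrow> 'a. (\<forall>M::real. \<exists>N. \<forall>m\<ge>N. \<forall>n\<ge>N. v (X m - X n) \<ge> ereal M) \<longrightarrow>
        (\<exists>L. \<forall>M::real. \<exists>N. \<forall>n\<ge>N. v (X n - L) \<ge> ereal M)) \<and>
     (\<forall>P :: 'a poly. degree P > 0 \<longrightarrow> (\<exists>x. poly P x = 0)) \<and>
     (\<forall>x. \<forall>M::real. \<exists>y. algebraic y \<and> v (x - y) \<ge> ereal M)"

definition Qp_in :: "('a::field_char_0 \<Rightarrow> ereal) \<Rightarrow> 'a set" where
  "Qp_in v = {x. \<forall>M::real. \<exists>q::rat. v (x - of_rat q) \<ge> ereal M}"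

definition alg_over :: "'a::field set \<Rightarrow> 'a \<Rightarrow> bool" where
  "alg_over S x \<longleftrightarrow> (\<exists>P. P \<noteq> 0 \<and> (\<forall>i. coeff P i \<in> S) \<and> poly P x = 0)"

definition Qp_adj :: "('a::field_char_0 \<Rightarrow> ereal) \<Rightarrow> 'a \<Rightarrow> 'a set" where
  "Qp_adj v \<alpha> = {y. \<exists>P Q. (\<forall>i. coeff P i \<in> Qp_in v) \<and> (\<forall>i. coeff Q i \<in> Qp_in v) \<and>
       poly Q \<alpha> \<noteq> 0 \<and> y = poly P \<alpha> / poly Q \<alpha>}"

text \<open>C_p^br: the value group of Q_p(alpha)^* contains Z with finite index e, i.e.
 e * v(Q_p(alpha)^* ) is contained in Z for some e > 0.\<close>
definition Cp_br :: "('a::field_char_0 \<Rightarrow> ereal) \<Rightarrow> 'a set" where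
  "Cp_br v = {\<alpha>. \<exists>e::nat. e > 0 \<and>
      (\<forall>y\<in>Qp_adj v \<alpha>. y \<noteq> 0 \<longrightarrow> (\<exists>k::int. ereal (real e) * v y = ereal (of_int k)))}"

definition ext_val :: "rat option \<Rightarrow> ereal" where
  "ext_val \<delta> = (case \<delta> of None \<Rightarrow> \<infinity> | Some d \<Rightarrow> ereal (of_rat d))"

definition admissible :: "('a::field_char_0 \<Rightarrow> ereal) \<Rightarrow> 'a \<Rightarrow> rat option \<Rightarrow> bool" where
  "admissible v \<alpha> \<delta> \<longleftrightarrow>
     (\<forall>d. \<delta> = Some d \<longrightarrow> alg_over (Qp_in v) \<alpha>) \<and> (\<delta> = None \<longrightarrow> \<not> algebraic \<alpha>)"

definition ball_p :: "('a::field_char_0 \<Rightarrow> ereal) \<Rightarrow> 'a \<Rightarrow> rat option \<Rightarrow> 'a set" where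
  "ball_p v \<alpha> \<delta> = {x. v (x - \<alpha>) \<ge> ext_val \<delta>}"

definition Gal_p :: "('a::field_char_0 \<Rightarrow> ereal) \<Rightarrow> ('a \<Rightarrow> 'a) set" where
  "Gal_p v = {\<sigma>. bij \<sigma> \<and> (\<forall>x y. \<sigma> (x + y) = \<sigma> x + \<sigma> y \<and> \<sigma> (x * y) = \<sigma> x * \<sigma> y) \<and>
      (\<forall>x\<in>Qp_in v. \<sigma> x = x) \<and>
      (\<forall>x. \<forall>M::real. \<exists>N::real. \<forall>y. v (y - x) \<ge> ereal N \<longrightarrow> v (\<sigma> y - \<sigma> x) \<ge> ereal M)}"

text \<open>On polynomials of Q[X]: for delta in Q, expand f = sum a_i (X - alpha)^i
 (the a_i are the coefficients of f(X + alpha)) and take min (v a_i + i delta);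
 for delta = oo, take v(f(alpha)).\<close>
definition vpoly :: "('a::field_char_0 \<Rightarrow> ereal) \<Rightarrow> 'a \<Rightarrow> rat option \<Rightarrow> rat poly \<Rightarrow> ereal" where
  "vpoly v \<alpha> \<delta> f = (case \<delta> of
      None \<Rightarrow> v (poly (map_poly of_rat f) \<alpha>)
    | Some d \<Rightarrow> (let g = pcompose (map_poly of_rat f) [:\<alpha>, 1:] in
                 Min ((\<lambda>i. v (coeff g i) + ereal (real i * of_rat d)) ` {..degree g})))"

text \<open>Q(X) is the fraction field of Q[X]. Z_(p),alpha,delta = {phi : v_{p,alpha,delta}(phi) >= 0},
 where v(f/g) = v(f) - v(g).\<close>
definition Zring :: "('a::field_char_0 \<Rightarrow> ereal) \<Rightarrow> 'a \<Rightarrow> rat option \<Rightarrow> rat poly fract set" where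
  "Zring v \<alpha> \<delta> = {\<phi>. \<exists>f g. g \<noteq> 0 \<and> \<phi> = Fract f g \<and> vpoly v \<alpha> \<delta> g \<le> vpoly v \<alpha> \<delta> f}"

definition const_fract :: "rat \<Rightarrow> rat poly fract" where
  "const_fract q = Fract [:q:] 1"

definition Z_loc :: "nat \<Rightarrow> rat set" where
  "Z_loc p = {q. \<exists>a b::int. b > 0 \<and> \<not> int p dvd b \<and> q = of_int a / of_int b}"

definition subring_of :: "'a::comm_ring_1 set \<Rightarrow> bool" where
  "subring_of W \<longleftrightarrow> 0 \<in> W \<and> 1 \<in> W \<and> (\<forall>x\<in>W. \<forall>y\<in>W. x + y \<in> W \<and> x - y \<in> W \<and> x * y \<in> W)"

definition ideal_of :: "'a::comm_ring_1 set \<Rightarrow> 'a set \<Rightarrow> bool" where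
  "ideal_of W I \<longleftrightarrow> I \<subseteq> W \<and> 0 \<in> I \<and> (\<forall>x\<in>I. \<forall>y\<in>I. x + y \<in> I) \<and> (\<forall>r\<in>W. \<forall>x\<in>I. r * x \<in> I)"

definition prime_ideal_of :: "'a::comm_ring_1 set \<Rightarrow> 'a set \<Rightarrow> bool" where
  "prime_ideal_of W I \<longleftrightarrow> ideal_of W I \<and> I \<noteq> W \<and> (\<forall>a\<in>W. \<forall>b\<in>W. a * b \<in> I \<longrightarrow> a \<in> I \<or> b \<in> I)"

definition DVR_with_quotient_field :: "'a::field set \<Rightarrow> bool" where
  "DVR_with_quotient_field W \<longleftrightarrow> subring_of W \<and>
     (\<forall>\<phi>. \<exists>a\<in>W. \<exists>b\<in>W. b \<noteq> 0 \<and> \<phi> = a / b) \<and>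
     (\<forall>I. ideal_of W I \<longrightarrow> (\<exists>a\<in>W. I = {a * r | r. r \<in> W})) \<and>
     (\<exists>!P. prime_ideal_of W P \<and> P \<noteq> {0})"

definition W_p :: "nat \<Rightarrow> rat poly fract set set" where
  "W_p p = {W. DVR_with_quotient_field W \<and> {q. const_fract q \<in> W} = Z_loc p}"

end

(* Idea. Both kinds of valuation v_{p,alpha,delta} are multiplicative, so they are determined by their values
   min(delta, v(alpha - r)) at the linear polynomials X - r, and comparisons of valuations reduce to comparisons of roots.

   Equal rings give equal valuations on Q[X]. For delta = oo the substitution alpha -> beta is then an isometry of Q(alpha)
   onto Q(beta), and a maximal isometric partial isomorphism is an automorphism of the whole field: its domain is closed, and
   over a complete subfield the valuation of an algebraic element is determined by its minimal polynomial (equivalence of norms),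
   so the domain contains the dense set of algebraic numbers. For delta rational one evaluates at the minimal polynomial of
   alpha over Q_p and finds a conjugate of alpha in the ball around beta.

   Conversely, let K be the large field and O_K its valuation ring. The valuation of a DVR W extends to a valuation u of
   K[X] that restricts to v on K: since K and Q(X) are linearly disjoint over Q, the maximal ideals of W and O_K generate a
   proper ideal of the ring W O_K. Let delta be the supremum of u(X - r) over r in K. If it is attained at alpha, then
   u = v_{p,alpha,delta}; if it is infinite, it is attained by completeness. A finite supremum that is not attained would
   make u immediate over K, and this contradicts the discreteness of W. *)

theory Submission
  imports Defs "HOL-Library.FuncSet"
begin

section \<open>Pseudo-valuations\<close>

text \<open>Three obstacles shape the proof. The valuation sending f to v(f(\<alpha>)) kills X -
  \<alpha> on K[X] and is injective only on Q[X], so \<open>pval\<close> allows the value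
  \<infinity> at non-zero elements, and fractions are formed only where the kernel is trivial. A
  valuation ring of K(X) obtained from Zorn's lemma can have rank greater than one; real values are
  regained by measuring elements against the scalars of K, and -\<infinity> is excluded on
  polynomials because X lies in Q(X), where the values are known. The contradiction for an immediate
  u is a count: p is a scalar of K, so at every precision e powers of a uniformizer suffice to
  approximate with coefficients in K, while e + 1 powers of X are available. The polynomials
  obtained have degree at most e and a coefficient of bounded value, but arbitrarily large u. Galois
  theory enters only as extension of isometries: conjugates over Q_p are elements with the same
  minimal relation.\<close>

locale pval =
  fixes v :: "'b::comm_ring_1 \<Rightarrow> ereal"
  assumes v_zero [simp]: "v 0 = \<infinity>"
    and v_one [simp]: "v 1 = 0"
    and v_not_MInf [simp]: "v x \<noteq> -\<infinity>"
    and v_mult: "v (x * y) = v x + v y"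
    and v_add: "min (v x) (v y) \<le> v (x + y)"
begin

lemma v_minus_one [simp]: "v (- 1) = 0"
proof -
  have "v (-1) + v (-1) = 0"
    using v_mult[of "-1" "-1"] by simp
  then show ?thesis
    by (cases "v (-1)") auto
qed

lemma v_minus [simp]: "v (- x) = v x"
  using v_mult[of "-1" x] by simp

lemma v_diff: "min (v x) (v y) \<le> v (x - y)"
  using v_add[of x "-y"] by simp

lemma v_diff_commute: "v (x - y) = v (y - x)"
  using v_minus[of "x - y"] by simp

lemma v_add_ge: "M \<le> v x \<Longrightarrow> M \<le> v y \<Longrightarrow> M \<le> v (x + y)"
  using v_add[of x y] by (auto simp: min_def split: if_splits)

lemma v_diff_ge: "M \<le> v x \<Longrightarrow> M \<le> v y \<Longrightarrow> M \<le> v (x - y)"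
  using v_diff[of x y] by (auto simp: min_def split: if_splits)

lemma v_add_gt: "M < v x \<Longrightarrow> M < v y \<Longrightarrow> M < v (x + y)"
  using v_add[of x y] by (auto simp: min_def split: if_splits)

lemma v_diff_gt: "M < v x \<Longrightarrow> M < v y \<Longrightarrow> M < v (x - y)"
  using v_diff[of x y] by (auto simp: min_def split: if_splits)

lemma v_add_eq: "v x < v y \<Longrightarrow> v (x + y) = v x"
  using v_add[of x y] v_diff[of "x + y" y] by (auto simp: min_def split: if_splits)

lemma v_eq_if_close: "v y < v (x - y) \<Longrightarrow> v x = v y"
  using v_add_eq[of y "x - y"] by simp

lemma v_sum_ge: "(\<And>i. i \<in> A \<Longrightarrow> M \<le> v (f i)) \<Longrightarrow> M \<le> v (sum f A)"
  by (induction A rule: infinite_finite_induct) (auto intro: v_add_ge)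

lemma v_sum_gt: "(\<And>i. i \<in> A \<Longrightarrow> M < v (f i)) \<Longrightarrow> M \<noteq> \<infinity> \<Longrightarrow> M < v (sum f A)"
  by (induction A rule: infinite_finite_induct) (auto intro: v_add_gt simp: less_ereal.simps)

lemma v_power: "v (x ^ n) = ereal (real n) * v x"
proof (induction n)
  case (Suc n)
  show ?case
  proof (cases "v x")
    case (real r)
    then show ?thesis using Suc by (simp add: v_mult algebra_simps)
  next
    case PInf
    then show ?thesis using Suc by (cases "n = 0") (auto simp: v_mult)
  qed simp
qed (simp add: zero_ereal_def[symmetric])

lemma v_of_nat: "0 \<le> v (of_nat n)"
  by (induction n) (auto intro: v_add_ge)

lemma v_of_int: "0 \<le> v (of_int n)"
  by (cases n) (auto simp: v_of_nat simp del: of_nat_Suc)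

end

locale fval = pval v for v :: "'b::field \<Rightarrow> ereal" +
  assumes v_infD: "v x = \<infinity> \<Longrightarrow> x = 0"
begin

lemma v_inf_iff [simp]: "v x = \<infinity> \<longleftrightarrow> x = 0"
  using v_infD by auto

lemma v_realE:
  assumes "x \<noteq> 0"
  obtains r where "v x = ereal r"
  using assms v_infD[of x] v_not_MInf[of x] by (cases "v x") auto

lemma v_inverse: "x \<noteq> 0 \<Longrightarrow> v (inverse x) = - v x"
proof -
  assume x: "x \<noteq> 0"
  have "v x + v (inverse x) = 0"
    using v_mult[of x "inverse x"] x by simp
  then show ?thesis
    by (cases "v x"; cases "v (inverse x)") auto
qed

lemma v_divide: "y \<noteq> 0 \<Longrightarrow> v (x / y) = v x - v y"
  by (simp add: divide_inverse v_mult v_inverse minus_ereal_def)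

end

section \<open>The field of p-adic complex numbers\<close>

locale Cp =
  fixes p :: nat and v :: "'a::field_char_0 \<Rightarrow> ereal"
  assumes prime_p: "prime p" and is_Cp: "is_Cp p v"
begin

lemma v_rat: "a \<noteq> 0 \<Longrightarrow> b \<noteq> 0 \<Longrightarrow> v (of_int a / of_int b) =
    ereal (of_int (int (multiplicity (int p) a) - int (multiplicity (int p) b)))"
  using is_Cp unfolding is_Cp_def by blast

lemma ex_root: "degree P > 0 \<Longrightarrow> \<exists>x. poly P x = 0" for P :: "'a poly"
  using is_Cp unfolding is_Cp_def by blast

lemma algebraic_dense: "\<exists>y. algebraic y \<and> ereal M \<le> v (x - y)"
  using is_Cp unfolding is_Cp_def by blast

sublocale fval v
proof
  show "v 1 = 0"
    using v_rat[of 1 1] by simp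
qed (use is_Cp in \<open>auto simp: is_Cp_def\<close>)

definition cauchy :: "(nat \<Rightarrow> 'a) \<Rightarrow> bool" where
  "cauchy X \<longleftrightarrow> (\<forall>M::real. \<exists>N. \<forall>m\<ge>N. \<forall>n\<ge>N. ereal M \<le> v (X m - X n))"

definition converges :: "(nat \<Rightarrow> 'a) \<Rightarrow> 'a \<Rightarrow> bool" where
  "converges X L \<longleftrightarrow> (\<forall>M::real. \<exists>N. \<forall>n\<ge>N. ereal M \<le> v (X n - L))"

lemma cauchy_converges: "cauchy X \<Longrightarrow> \<exists>L. converges X L"
  using is_Cp unfolding is_Cp_def cauchy_def converges_def by blast

lemma v_p [simp]: "v (of_nat p) = 1"
proof -
  have "prime (int p)" using prime_p by simp
  then have "multiplicity (int p) (int p) = 1"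
    by (meson multiplicity_prime prime_def)
  then show ?thesis using v_rat[of "int p" 1] prime_p prime_gt_0_nat
    by (simp add: one_ereal_def)
qed

lemma p_pos [simp]: "0 < p" "p \<noteq> 0"
  using prime_gt_0_nat[OF prime_p] by auto

lemma of_rat_quotient: "\<exists>a b. b > 0 \<and> r = of_int a / of_int b" for r :: rat
  by (metis Fract_of_int_quotient Rat_cases)

lemma v_of_rat_int:
  assumes "r \<noteq> 0"
  shows "\<exists>k::int. v (of_rat r) = ereal (of_int k)"
proof -
  obtain a b :: int where ab: "b > 0" "r = of_int a / of_int b" using of_rat_quotient by blast
  then have "a \<noteq> 0" using assms by auto
  then have "v (of_rat r) = ereal (of_int (int (multiplicity (int p) a) - int (multiplicity (int p) b)))"
    using v_rat[of a b] ab by (simp add: of_rat_divide)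
  then show ?thesis by blast
qed

lemma v_of_rat_ge0_iff: "0 \<le> v (of_rat r) \<longleftrightarrow> r \<in> Z_loc p"
proof
  assume "r \<in> Z_loc p"
  then obtain a b :: int where ab: "b > 0" "\<not> int p dvd b" "r = of_int a / of_int b"
    by (auto simp: Z_loc_def)
  show "0 \<le> v (of_rat r)"
  proof (cases "a = 0")
    case False
    then show ?thesis using ab v_rat[of a b] by (simp add: of_rat_divide not_dvd_imp_multiplicity_0)
  qed (use ab in simp)
next
  assume r: "0 \<le> v (of_rat r)"
  obtain a b where "quotient_of r = (a, b)" by (cases "quotient_of r")
  then have ab: "b > 0" "coprime a b" "r = of_int a / of_int b"
    by (simp_all add: quotient_of_denom_pos quotient_of_coprime quotient_of_div)
  have "\<not> int p dvd b"
  proof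
    assume pb: "int p dvd b"
    with ab prime_p have pa: "\<not> int p dvd a"
      by (meson coprime_common_divisor not_prime_unit prime_nat_int_transfer)
    then have "a \<noteq> 0" by auto
    have "multiplicity (int p) b > 0"
      using pb ab prime_p by (simp add: prime_multiplicity_gt_zero_iff)
    then show False using r ab v_rat[of a b] \<open>a \<noteq> 0\<close> pa
      by (simp add: of_rat_divide not_dvd_imp_multiplicity_0 zero_ereal_def)
  qed
  then show "r \<in> Z_loc p" using ab by (auto simp: Z_loc_def)
qed

end

section \<open>Newton slopes and the value group of the large field\<close>

context fval
begin

text \<open>If a single term had the least value, the sum would have that finite value, while 0 has
  value \<infinity>.\<close>

lemma sum_zero_two_min:
  assumes "finite A" "sum f A = 0" "i0 \<in> A" "f i0 \<noteq> 0"
  shows "\<exists>i\<in>A. \<exists>j\<in>A. i \<noteq> j \<and> f i \<noteq> 0 \<and> f j \<noteq> 0 \<and> v (f i) = v (f j)"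
proof -
  define m where "m = Min ((\<lambda>i. v (f i)) ` A)"
  have "m \<in> (\<lambda>i. v (f i)) ` A"
    unfolding m_def by (rule Min_in) (use assms in auto)
  then obtain i where i: "i \<in> A" "v (f i) = m" by auto
  have le: "m \<le> v (f j)" if "j \<in> A" for j
    unfolding m_def using assms that by auto
  have m: "m \<noteq> \<infinity>"
    using le[OF assms(3)] assms(4) v_infD[of "f i0"] by auto
  then have fi: "f i \<noteq> 0" using i by auto
  have "\<exists>j\<in>A. j \<noteq> i \<and> v (f j) = m"
  proof (rule ccontr)
    assume "\<not> ?thesis"
    then have "m < v (sum f (A - {i}))"
      using m le by (intro v_sum_gt) (auto simp: less_le)
    moreover have "sum f (A - {i}) = - f i"
      using sum.remove[OF assms(1) i(1), of f] assms(2) by (simp add: eq_neg_iff_add_eq_0 add.commute)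
    ultimately show False using i by simp
  qed
  then show ?thesis using i fi m by (metis v_inf_iff)
qed

text \<open>Two terms a_i z^i share the least value, so v z is a slope of the Newton polygon. What
  matters later is the denominator j - i of this slope, which is at most n.\<close>

lemma v_root_of_polynomial:
  assumes "(\<Sum>i\<le>n. a i * z ^ i) = 0" "k \<le> n" "a k \<noteq> 0" "z \<noteq> 0"
  shows "\<exists>i j. i < j \<and> j \<le> n \<and> a i \<noteq> 0 \<and> a j \<noteq> 0 \<and> v (a i) - v (a j) = ereal (real (j - i)) * v z"
proof -
  have "\<exists>i\<in>{..n}. \<exists>j\<in>{..n}. i \<noteq> j \<and> a i * z ^ i \<noteq> 0 \<and> a j * z ^ j \<noteq> 0 \<and> v (a i * z ^ i) = v (a j * z ^ j)"
    using assms by (intro sum_zero_two_min[where ?i0.0 = k]) auto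
  then obtain i j where "i \<noteq> j" "i \<le> n" "j \<le> n" "a i \<noteq> 0" "a j \<noteq> 0" "v (a i * z ^ i) = v (a j * z ^ j)"
    by auto
  then obtain i j where ij: "i < j" "j \<le> n" "a i \<noteq> 0" "a j \<noteq> 0" "v (a i * z ^ i) = v (a j * z ^ j)"
    by (metis linorder_neqE_nat)
  obtain x y r where "v (a i) = ereal x" "v (a j) = ereal y" "v z = ereal r"
    using ij assms v_realE by meson
  then show ?thesis using ij
    by (intro exI[of _ i] exI[of _ j]) (auto simp: v_mult v_power of_nat_diff algebra_simps)
qed

end

context Cp
begin

lemma v_of_nat_p_power [simp]: "v (of_nat p ^ n) = ereal (real n)"
  by (simp add: v_power)

lemma ex_v_of_int: "\<exists>c. c \<noteq> 0 \<and> v c = ereal (of_int k) \<and> (\<exists>r. c = of_rat r)"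
proof (cases "k \<ge> 0")
  case True
  then show ?thesis
    by (intro exI[of _ "of_nat p ^ nat k"])
      (auto intro!: exI[of _ "of_nat p ^ nat k"] simp: of_rat_power prime_gt_0_nat[OF prime_p])
next
  case False
  then show ?thesis
    by (intro exI[of _ "inverse (of_nat p ^ nat (-k))"])
      (auto intro!: exI[of _ "inverse (of_nat p ^ nat (-k))"]
        simp: v_inverse of_rat_power of_rat_inverse prime_gt_0_nat[OF prime_p])
qed

lemma ex_v_rational:
  assumes "b > 0"
  shows "\<exists>c. c \<noteq> 0 \<and> v c = ereal (of_int k / real b)"
proof -
  obtain d where d: "d \<noteq> 0" "v d = ereal (of_int k)" using ex_v_of_int by blast
  have "degree (monom 1 b + [:-d:]) = b"
    using assms by (subst degree_add_eq_left) (auto simp: degree_monom_eq)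
  then obtain c where c: "poly (monom 1 b + [:-d:]) c = 0"
    using ex_root[of "monom 1 b + [:-d:]"] assms by auto
  then have cb: "c ^ b = d" by (simp add: poly_monom)
  then have "c \<noteq> 0" using d assms by (auto simp: power_0_left)
  then obtain r where r: "v c = ereal r" by (rule v_realE)
  have "real b * r = of_int k" using d r cb v_power[of c b] by simp
  then have "r = of_int k / real b" using assms by (simp add: field_simps)
  then show ?thesis using r \<open>c \<noteq> 0\<close> by auto
qed

lemma ex_v_of_rat: "\<exists>c. c \<noteq> 0 \<and> v c = ereal (of_rat q)"
proof -
  obtain a b :: int where ab: "b > 0" "q = of_int a / of_int b" using of_rat_quotient by blast
  then have "(of_rat q :: real) = of_int a / real (nat b)" by (simp add: of_rat_divide)
  then show ?thesis using ex_v_rational[of "nat b" a] ab by auto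
qed

lemma ex_v_between:
  assumes "x < (y::real)"
  shows "\<exists>c. c \<noteq> 0 \<and> x < v c \<and> v c < y"
  using Rats_dense_in_real[OF assms] ex_v_of_rat by (metis Rats_cases ereal_less_eq(3) less_ereal.simps(1))

lemma algebraic_iff_rat_poly: "algebraic y \<longleftrightarrow> (\<exists>f::rat poly. f \<noteq> 0 \<and> poly (map_poly of_rat f) y = 0)"
  for y :: 'a
proof
  assume "algebraic y"
  then obtain f where f: "\<And>i. coeff f i \<in> \<int>" "f \<noteq> 0" "poly f y = 0"
    by (auto simp: algebraic_def)
  from f(1) have "\<forall>i. \<exists>k::int. coeff f i = of_int k" by (metis Ints_cases)
  then obtain k where k: "\<And>i. coeff f i = of_int (k i)" by metis
  \<comment> \<open>\<open>coeff_map_poly\<close> applies only to functions that send 0 to 0;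
    \<open>g0\<close> checks this for the choice operator.\<close>
  define g where "g = map_poly (\<lambda>c. of_int (SOME k. c = of_int k) :: rat) f"
  have g0: "(SOME k. (0::'a) = of_int k) = 0" by (rule some_equality) auto
  have "coeff g i = of_int (SOME k. coeff f i = of_int k)" for i
    unfolding g_def by (simp add: coeff_map_poly g0)
  moreover have "coeff f i = of_int (SOME k. coeff f i = of_int k)" for i
    using k[of i] by (metis (mono_tags, lifting) someI_ex)
  ultimately have "of_rat (coeff g i) = coeff f i" for i
    by (metis of_rat_of_int_eq)
  then have "map_poly of_rat g = f"
    by (intro poly_eqI) (simp add: coeff_map_poly)
  then show "\<exists>f::rat poly. f \<noteq> 0 \<and> poly (map_poly of_rat f) y = 0"
    using f by (intro exI[of _ g]) auto
next
  assume "\<exists>f::rat poly. f \<noteq> 0 \<and> poly (map_poly of_rat f) y = 0"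
  then obtain f :: "rat poly" where f: "f \<noteq> 0" "poly (map_poly of_rat f) y = 0" by blast
  have "coeff (map_poly of_rat f :: 'a poly) i \<in> \<rat>" for i by (simp add: coeff_map_poly)
  moreover have "(map_poly of_rat f :: 'a poly) \<noteq> 0" using f by (simp add: map_poly_eq_0_iff)
  ultimately show "algebraic y" using f unfolding algebraic_altdef by blast
qed

text \<open>By density v x is also the value of an algebraic y. The rational coefficients of an
  equation for y have integer values, so a Newton slope of y is a rational number.\<close>

lemma v_rational:
  assumes "x \<noteq> 0"
  shows "\<exists>k::int. \<exists>b::nat. b > 0 \<and> v x = ereal (of_int k / real b)"
proof -
  obtain r where r: "v x = ereal r" using assms by (rule v_realE)
  obtain y where y: "algebraic y" "ereal (r + 1) \<le> v (x - y)" using algebraic_dense by blast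
  have "ereal r < ereal (r + 1)" by simp
  then have "v x < v (y - x)" using y r v_diff_commute[of x y] by (metis less_le_trans)
  then have vy: "v y = ereal r" using v_eq_if_close[of x y] r by simp
  then have "y \<noteq> 0" by auto
  obtain f where f: "f \<noteq> 0" "poly (map_poly of_rat f) y = 0"
    using y by (auto simp: algebraic_iff_rat_poly)
  have "\<exists>i j. i < j \<and> j \<le> degree f \<and> (of_rat (coeff f i) :: 'a) \<noteq> 0 \<and> (of_rat (coeff f j) :: 'a) \<noteq> 0 \<and>
      v (of_rat (coeff f i)) - v (of_rat (coeff f j)) = ereal (real (j - i)) * v y"
  proof (rule v_root_of_polynomial[where k = "degree f"])
    show "(\<Sum>i\<le>degree f. of_rat (coeff f i) * y ^ i) = 0"
      using f(2) by (simp add: poly_altdef coeff_map_poly degree_map_poly)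
  qed (use f \<open>y \<noteq> 0\<close> in auto)
  then obtain i j where ij: "i < j" "coeff f i \<noteq> 0" "coeff f j \<noteq> 0"
      "v (of_rat (coeff f i)) - v (of_rat (coeff f j)) = ereal (real (j - i)) * v y" by auto
  obtain k l :: int where "v (of_rat (coeff f i)) = ereal k" "v (of_rat (coeff f j)) = ereal l"
    using ij v_of_rat_int by meson
  then have "of_int (k - l) = real (j - i) * r" using ij vy by simp
  then have "r = of_int (k - l) / real (j - i)" using ij by (simp add: field_simps)
  then show ?thesis using r ij by (intro exI[of _ "k - l"] exI[of _ "j - i"]) auto
qed

text \<open>This is factorisation over an algebraically closed field, packaged so that statements
  about multiplicative functions on K[X] reduce to constants and to X - r.\<close>

lemma linear_factor_induct [case_names const linear]:
  fixes f :: "'a poly"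
  assumes const: "\<And>c. P [:c:]"
    and linear: "\<And>r f. f \<noteq> 0 \<Longrightarrow> P f \<Longrightarrow> P ([:-r, 1:] * f)"
  shows "P f"
proof (induction "degree f" arbitrary: f rule: less_induct)
  case less
  show ?case
  proof (cases "degree f = 0")
    case True
    then show ?thesis using const by (metis degree_eq_zeroE)
  next
    case False
    then obtain r where "poly f r = 0" using ex_root by auto
    then obtain g where g: "f = [:-r, 1:] * g" by (metis dvdE poly_eq_0_iff_dvd)
    with False have "g \<noteq> 0" by auto
    then have "degree f = degree [:-r, 1:] + degree g"
      unfolding g by (intro degree_mult_eq) auto
    then have "P g" by (intro less) simp
    then show ?thesis unfolding g using \<open>g \<noteq> 0\<close> by (rule linear[rotated])
  qed
qed

text \<open>The comparison is asked only at roots of \<open>f\<close>, because in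
  \<open>nearest_conjugate\<close> one valuation is dominated by the other only there.\<close>

lemma poly_valuation_le:
  fixes u1 u2 :: "'a poly \<Rightarrow> ereal"
  assumes "\<And>f g. u1 (f * g) = u1 f + u1 g" "\<And>f g. u2 (f * g) = u2 f + u2 g"
    and "\<And>c. u1 [:c:] = v c" "\<And>c. u2 [:c:] = v c"
    and "\<And>r. poly f r = 0 \<Longrightarrow> u1 [:-r, 1:] \<le> u2 [:-r, 1:]"
  shows "u1 f \<le> u2 f"
  using assms(5)
proof (induction f rule: linear_factor_induct)
  case (linear r f)
  then have "u1 [:-r, 1:] \<le> u2 [:-r, 1:]" "u1 f \<le> u2 f" by (auto simp del: mult_pCons_left)
  then show ?case using add_mono by (fastforce simp only: assms(1,2))
qed (auto simp: assms)

lemma poly_valuation_eq: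
  fixes u1 u2 :: "'a poly \<Rightarrow> ereal"
  assumes "\<And>f g. u1 (f * g) = u1 f + u1 g" "\<And>f g. u2 (f * g) = u2 f + u2 g"
    and "\<And>c. u1 [:c:] = v c" "\<And>c. u2 [:c:] = v c"
    and "\<And>r. u1 [:-r, 1:] = u2 [:-r, 1:]"
  shows "u1 f = u2 f"
  by (rule antisym; rule poly_valuation_le) (use assms in auto)

text \<open>One strictly smaller linear factor decides, provided that the strict inequality is not
  swallowed by an infinite summand; this is what \<open>fin\<close> prevents.\<close>

lemma poly_valuation_less:
  fixes u1 u2 :: "'a poly \<Rightarrow> ereal"
  assumes "\<And>f g. u1 (f * g) = u1 f + u1 g" "\<And>f g. u2 (f * g) = u2 f + u2 g"
    and "\<And>c. u1 [:c:] = v c" "\<And>c. u2 [:c:] = v c"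
    and "\<And>r. poly f r = 0 \<Longrightarrow> u1 [:-r, 1:] \<le> u2 [:-r, 1:]"
    and s: "poly f s = 0" "u1 [:-s, 1:] < u2 [:-s, 1:]"
    and fin: "\<bar>u1 f\<bar> \<noteq> \<infinity>"
  shows "u1 f < u2 f"
proof -
  obtain g where g: "f = [:-s, 1:] * g" using s by (metis dvdE poly_eq_0_iff_dvd)
  have "u1 g \<le> u2 g"
  proof (rule poly_valuation_le[OF assms(1-4)])
    show "u1 [:-r, 1:] \<le> u2 [:-r, 1:]" if "poly g r = 0" for r
      by (rule assms(5)) (simp add: g that del: mult_pCons_left)
  qed
  moreover have "u1 f = u1 [:-s, 1:] + u1 g" "u2 f = u2 [:-s, 1:] + u2 g" by (auto simp only: g assms)
  ultimately show ?thesis using fin s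
    by (cases "u1 [:-s, 1:]"; cases "u1 g"; cases "u2 [:-s, 1:]"; cases "u2 g") auto
qed

end

section \<open>Monomial valuations\<close>

text \<open>The Gauss valuation centred at 0 with X of value \<open>d\<close>. Other centres are
  reached by substituting X + \<alpha>.\<close>

definition gauss :: "('a::field \<Rightarrow> ereal) \<Rightarrow> real \<Rightarrow> 'a poly \<Rightarrow> ereal" where
  "gauss v d f = Min ((\<lambda>i. v (coeff f i) + ereal (real i * d)) ` {..degree f})"

context fval
begin

lemma gauss_le: "gauss v d f \<le> v (coeff f i) + ereal (real i * d)"
proof (cases "i \<le> degree f")
  case True
  then show ?thesis unfolding gauss_def by (intro Min_le) auto
qed (simp add: coeff_eq_0)

lemma gauss_attained: "\<exists>i. gauss v d f = v (coeff f i) + ereal (real i * d)"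
proof -
  have "gauss v d f \<in> (\<lambda>i. v (coeff f i) + ereal (real i * d)) ` {..degree f}"
    unfolding gauss_def by (rule Min_in) auto
  then show ?thesis by auto
qed

lemma gauss_ge: "(\<And>i. M \<le> v (coeff f i) + ereal (real i * d)) \<Longrightarrow> M \<le> gauss v d f"
  using gauss_attained[of d f] by metis

lemma gauss_not_MInf: "gauss v d f \<noteq> -\<infinity>"
  using gauss_attained[of d f] by auto

lemma gauss_finite: "f \<noteq> 0 \<Longrightarrow> gauss v d f \<noteq> \<infinity>"
  using gauss_le[of d f "degree f"] by (cases "v (lead_coeff f)") auto

text \<open>Gauss's lemma: let i and j be the least indices at which the two minima are attained.
  Exactly one summand of the coefficient of X^(i+j) then has the least value, so it cannot
  cancel.\<close>

lemma gauss_mult: "gauss v d (f * g) = gauss v d f + gauss v d g"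
proof (cases "f = 0 \<or> g = 0")
  case True
  then show ?thesis using gauss_not_MInf[of d f] gauss_not_MInf[of d g]
    by (auto simp: gauss_def)
next
  case False
  then obtain A B where AB: "gauss v d f = ereal A" "gauss v d g = ereal B"
    using gauss_not_MInf gauss_finite by (metis ereal_cases)
  define F where "F i = v (coeff f i) + ereal (real i * d)" for i
  define G where "G i = v (coeff g i) + ereal (real i * d)" for i
  have F_ge: "ereal A \<le> F i" and G_ge: "ereal B \<le> G i" for i
    using gauss_le[of d f i] gauss_le[of d g i] AB by (auto simp: F_def G_def)
  have trm: "v (coeff f i * coeff g (n - i)) + ereal (real n * d) = F i + G (n - i)" if "i \<le> n" for i n
    using that v_not_MInf[of "coeff f i"] v_not_MInf[of "coeff g (n - i)"] unfolding F_def G_def v_mult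
    by (cases "v (coeff f i)"; cases "v (coeff g (n - i))") (auto simp: algebra_simps of_nat_diff)
  define i where "i = (LEAST i. F i = ereal A)"
  define j where "j = (LEAST j. G j = ereal B)"
  have i: "F i = ereal A" and j: "G j = ereal B"
    unfolding i_def j_def using gauss_attained[of d f] gauss_attained[of d g] AB
      LeastI_ex[of "\<lambda>i. F i = ereal A"] LeastI_ex[of "\<lambda>j. G j = ereal B"]
    by (simp_all add: F_def G_def) metis+
  have i_less: "ereal A < F k" if "k < i" for k
    using not_less_Least[of k "\<lambda>i. F i = ereal A"] that F_ge[of k] by (auto simp: i_def less_le)
  have j_less: "ereal B < G k" if "k < j" for k
    using not_less_Least[of k "\<lambda>i. G i = ereal B"] that G_ge[of k] by (auto simp: j_def less_le)
  show ?thesis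
  proof (rule antisym)
    define T where "T = (\<lambda>k. coeff f k * coeff g (i + j - k))"
    have vT: "v (T k) + ereal (real (i + j) * d) = F k + G (i + j - k)" if "k \<le> i + j" for k
      using trm[OF that] by (simp add: T_def)
    have "ereal (A + B - real (i + j) * d) < v (sum T ({..i + j} - {i}))"
    proof (rule v_sum_gt)
      fix k assume k: "k \<in> {..i + j} - {i}"
      \<comment> \<open>For k < i the first factor exceeds its minimum; for k > i the index i + j -
        k lies below j and the second one does.\<close>
      have "ereal (A + B) < F k + G (i + j - k)"
      proof (cases "k < i")
        case True
        then show ?thesis using i_less[of k] G_ge[of "i + j - k"]
          by (cases "F k"; cases "G (i + j - k)") auto
      next
        case False
        then have "i + j - k < j" using k by auto
        then show ?thesis using j_less[of "i + j - k"] F_ge[of k]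
          by (cases "F k"; cases "G (i + j - k)") auto
      qed
      then have "ereal (A + B) < v (T k) + ereal (real (i + j) * d)"
        using vT[of k] k by simp
      then show "ereal (A + B - real (i + j) * d) < v (T k)"
        by (cases "v (T k)") (auto simp: algebra_simps)
    qed simp
    moreover have "v (T i) = ereal (A + B - real (i + j) * d)"
      using vT[of i] i j by (cases "v (T i)") (auto simp: algebra_simps)
    moreover have "coeff (f * g) (i + j) = T i + sum T ({..i + j} - {i})"
      unfolding coeff_mult T_def by (rule sum.remove) auto
    ultimately have "v (coeff (f * g) (i + j)) = ereal (A + B - real (i + j) * d)"
      using v_add_eq[of "T i"] by simp
    then show "gauss v d (f * g) \<le> gauss v d f + gauss v d g"
      using gauss_le[of d "f * g" "i + j"] AB by simp
  next
    show "gauss v d f + gauss v d g \<le> gauss v d (f * g)"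
    proof (rule gauss_ge)
      fix n
      have "ereal (A + B - real n * d) \<le> v (coeff (f * g) n)"
        unfolding coeff_mult
      proof (rule v_sum_ge)
        fix k assume "k \<in> {..n}"
        then have "v (coeff f k * coeff g (n - k)) + ereal (real n * d) = F k + G (n - k)"
          using trm by simp
        then show "ereal (A + B - real n * d) \<le> v (coeff f k * coeff g (n - k))"
          using add_mono[OF F_ge[of k] G_ge[of "n - k"]]
          by (cases "v (coeff f k * coeff g (n - k))") (auto simp: algebra_simps dest: sym)
      qed
      then show "gauss v d f + gauss v d g \<le> v (coeff (f * g) n) + ereal (real n * d)"
        using AB by (cases "v (coeff (f * g) n)") (auto simp: algebra_simps)
    qed
  qed
qed

lemma pval_gauss: "pval (gauss v d)"
proof
  show "gauss v d 0 = \<infinity>" "gauss v d 1 = 0" by (auto simp: gauss_def zero_ereal_def[symmetric])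
  show "gauss v d f \<noteq> -\<infinity>" for f by (rule gauss_not_MInf)
  show "gauss v d (f * g) = gauss v d f + gauss v d g" for f g by (rule gauss_mult)
  show "min (gauss v d f) (gauss v d g) \<le> gauss v d (f + g)" for f g
  proof (rule gauss_ge)
    fix i
    have "min (v (coeff f i)) (v (coeff g i)) \<le> v (coeff (f + g) i)" using v_add by simp
    then have "min (v (coeff f i)) (v (coeff g i)) + ereal (real i * d) \<le> v (coeff (f + g) i) + ereal (real i * d)"
      by (rule add_right_mono)
    then show "min (gauss v d f) (gauss v d g) \<le> v (coeff (f + g) i) + ereal (real i * d)"
      using gauss_le[of d f i] gauss_le[of d g i] by (auto simp: min_def split: if_splits intro: order_trans)
  qed
qed

lemma gauss_const: "gauss v d [:c:] = v c"
  by (simp add: gauss_def zero_ereal_def[symmetric])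

lemma gauss_linear: "gauss v d [:c, 1:] = min (ereal d) (v c)"
  by (simp add: gauss_def atMost_Suc zero_ereal_def[symmetric])

end

text \<open>The paper's \<open>v\<^bsub>p,\<alpha>,\<delta>\<^esub>\<close> on all polynomials over the large field; \<open>vpoly\<close> is its restriction.\<close>

definition vK :: "('a::field \<Rightarrow> ereal) \<Rightarrow> 'a \<Rightarrow> rat option \<Rightarrow> 'a poly \<Rightarrow> ereal" where
  "vK v \<alpha> \<delta> f = (case \<delta> of None \<Rightarrow> v (poly f \<alpha>) | Some d \<Rightarrow> gauss v (of_rat d) (pcompose f [:\<alpha>, 1:]))"

lemma vpoly_eq_vK: "vpoly v \<alpha> \<delta> f = vK v \<alpha> \<delta> (map_poly of_rat f)"
  by (simp add: vpoly_def vK_def gauss_def Let_def split: option.split)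

context fval
begin

lemma pval_vK: "pval (vK v \<alpha> \<delta>)"
proof (cases \<delta>)
  case None
  then show ?thesis by unfold_locales (auto simp: vK_def v_mult v_add)
next
  case (Some d)
  interpret g: pval "gauss v (of_rat d)" by (rule pval_gauss)
  show ?thesis using Some
    by unfold_locales (auto simp: vK_def pcompose_1 pcompose_mult g.v_mult pcompose_add g.v_add)
qed

lemma vK_const [simp]: "vK v \<alpha> \<delta> [:c:] = v c"
  by (auto simp: vK_def gauss_const split: option.split)

text \<open>By \<open>poly_valuation_eq\<close> these values determine the whole valuation. They
  depend only on the ball, which is why the ring does.\<close>

lemma vK_linear: "vK v \<alpha> \<delta> [:-r, 1:] = min (ext_val \<delta>) (v (\<alpha> - r))"
  by (auto simp: vK_def gauss_linear ext_val_def pcompose_pCons split: option.split)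

lemma vK_Some_finite: "f \<noteq> 0 \<Longrightarrow> vK v \<alpha> (Some d) f \<noteq> \<infinity>"
  by (auto simp: vK_def pcompose_eq_0 intro!: gauss_finite dest: pcompose_eq_0)

end

section \<open>Discrete valuations and discrete valuation rings\<close>

text \<open>Values lie in (1/e) times the integers rather than in the integers, so that the
  normalisation v(p) = 1 can be kept. The value group may be a proper subgroup.\<close>

locale dval = fval v for v :: "'b::field \<Rightarrow> ereal" +
  fixes e :: nat
  assumes e_pos: "e > 0"
    and discrete: "x \<noteq> 0 \<Longrightarrow> \<exists>k::int. v x = ereal (of_int k / real e)"
    and nontrivial: "\<exists>x. x \<noteq> 0 \<and> 0 < v x"
begin

lemma ge0_mult: "0 \<le> v x \<Longrightarrow> 0 \<le> v y \<Longrightarrow> 0 \<le> v (x * y)"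
  by (simp add: v_mult)

text \<open>A non-zero element of least value divides all others; the least value exists because the
  finite values on \<open>I\<close> are natural multiples of 1/e.\<close>

lemma principal:
  assumes "ideal_of {x. 0 \<le> v x} I"
  shows "\<exists>a\<in>{x. 0 \<le> v x}. I = {a * r |r. r \<in> {x. 0 \<le> v x}}"
proof (cases "I \<subseteq> {0}")
  case True
  then have "I = {0}" using assms by (auto simp: ideal_of_def)
  then show ?thesis by (intro bexI[of _ 0]) (auto intro: exI[of _ 0])
next
  case False
  then obtain x where x: "x \<in> I" "x \<noteq> 0" by auto
  have val: "\<exists>k::nat. v y = ereal (real k / real e)" if "y \<in> I" "y \<noteq> 0" for y
  proof -
    have "0 \<le> v y" using that assms by (auto simp: ideal_of_def)
    moreover obtain k :: int where "v y = ereal (of_int k / real e)" using discrete \<open>y \<noteq> 0\<close> by blast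
    ultimately show ?thesis using e_pos
      by (intro exI[of _ "nat k"]) (auto simp: zero_le_divide_iff)
  qed
  define k where "k = (LEAST k::nat. \<exists>y\<in>I. y \<noteq> 0 \<and> v y = ereal (real k / real e))"
  have "\<exists>k::nat. \<exists>y\<in>I. y \<noteq> 0 \<and> v y = ereal (real k / real e)" using val x by blast
  then have "\<exists>y\<in>I. y \<noteq> 0 \<and> v y = ereal (real k / real e)" unfolding k_def by (rule LeastI_ex)
  then obtain a where a: "a \<in> I" "a \<noteq> 0" "v a = ereal (real k / real e)" by blast
  have min: "v a \<le> v y" if y: "y \<in> I" for y
  proof (cases "y = 0")
    case False
    then obtain l :: nat where l: "v y = ereal (real l / real e)" using val y by blast
    then have "k \<le> l" unfolding k_def using y False by (intro Least_le) blast
    then show ?thesis using a l by (simp add: divide_right_mono)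
  qed simp
  have "y \<in> {a * r |r. r \<in> {x. 0 \<le> v x}}" if y: "y \<in> I" for y
  proof -
    have "0 \<le> v (y / a)" using min[OF y] a by (cases "v y") (auto simp: v_divide)
    then show ?thesis using a by (auto intro!: exI[of _ "y / a"])
  qed
  moreover have "a * r \<in> I" if "0 \<le> v r" for r
    using assms a that by (auto simp: ideal_of_def mult.commute)
  moreover have "0 \<le> v a" using a by simp
  ultimately show ?thesis by (intro bexI[of _ a]) auto
qed

text \<open>Fix a non-zero x in P. For y of positive value some y^n / x is integral by the
  Archimedean property, so y^n lies in P, and then y does.\<close>

lemma prime_unique:
  assumes P: "prime_ideal_of {x. 0 \<le> v x} P" "P \<noteq> {0}"
  shows "P = {x. 0 < v x}"
proof -
  let ?W = "{x. 0 \<le> v x}"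
  have P': "P \<subseteq> ?W" "0 \<in> P" "P \<noteq> ?W" "\<And>r x. r \<in> ?W \<Longrightarrow> x \<in> P \<Longrightarrow> r * x \<in> P"
    "\<And>a b. a \<in> ?W \<Longrightarrow> b \<in> ?W \<Longrightarrow> a * b \<in> P \<Longrightarrow> a \<in> P \<or> b \<in> P"
    using P(1) by (auto simp: prime_ideal_of_def ideal_of_def)
  have one: "1 \<notin> P" using P'(1,3) P'(4)[of _ 1] by auto
  have pos: "0 < v x" if "x \<in> P" for x
  proof (rule ccontr)
    assume "\<not> 0 < v x"
    then have "v x = 0" using that P' by auto
    moreover from this have "x \<noteq> 0" by auto
    ultimately have "x \<noteq> 0" "0 \<le> v (inverse x)" by (simp_all add: v_inverse)
    then show False using P'(4)[of "inverse x" x] that one by auto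
  qed
  obtain x where x: "x \<in> P" "x \<noteq> 0" using P' P(2) by auto
  obtain a where a: "v x = ereal a" using x by (auto elim: v_realE)
  have "y \<in> P" if y: "0 < v y" for y
  proof (cases "y = 0")
    case False
    then obtain b where b: "v y = ereal b" by (auto elim: v_realE)
    then obtain n where n: "a \<le> real n * b" using y reals_Archimedean3[of b] by (auto intro: less_imp_le)
    then have "0 \<le> v (y ^ n / x)" using a b x by (simp add: v_divide v_power)
    then have "y ^ n / x * x \<in> P" using P' x by blast
    then have "y ^ n \<in> P" using x by simp
    then show ?thesis
    proof (induction n)
      case (Suc n)
      have "0 \<le> v (y ^ n)" using y by (simp add: v_power b)
      then show ?case using P'(5)[of y "y ^ n"] Suc y by (auto simp: less_imp_le)
    qed (use one in auto)
  qed (use P' in auto)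
  then show ?thesis using pos by auto
qed

theorem DVR: "DVR_with_quotient_field {x. 0 \<le> v x}"
  unfolding DVR_with_quotient_field_def
proof (intro conjI allI impI)
  show "subring_of {x. 0 \<le> v x}"
    by (auto simp: subring_of_def intro: v_add_ge v_diff_ge ge0_mult)
next
  fix \<phi> :: 'b
  show "\<exists>a\<in>{x. 0 \<le> v x}. \<exists>b\<in>{x. 0 \<le> v x}. b \<noteq> 0 \<and> \<phi> = a / b"
  proof (cases "0 \<le> v \<phi>")
    case True
    then show ?thesis by (intro bexI[of _ \<phi>] bexI[of _ 1]) auto
  next
    case False
    then have "\<phi> \<noteq> 0" by auto
    then obtain r where "v \<phi> = ereal r" by (rule v_realE)
    with False \<open>\<phi> \<noteq> 0\<close> have "0 \<le> v (inverse \<phi>)" by (simp add: v_inverse)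
    then show ?thesis using \<open>\<phi> \<noteq> 0\<close>
      by (intro bexI[of _ 1] bexI[of _ "inverse \<phi>"]) (auto simp: field_simps)
  qed
next
  fix I assume "ideal_of {x. 0 \<le> v x} I"
  then show "\<exists>a\<in>{x. 0 \<le> v x}. I = {a * r |r. r \<in> {x. 0 \<le> v x}}" by (rule principal)
next
  show "\<exists>!P. prime_ideal_of {x. 0 \<le> v x} P \<and> P \<noteq> {0}"
  proof (rule ex1I[of _ "{x. 0 < v x}"])
    have "prime_ideal_of {x. 0 \<le> v x} {x. 0 < v x}"
      unfolding prime_ideal_of_def ideal_of_def
    proof (intro conjI ballI impI)
      show "{x. 0 < v x} \<noteq> {x. 0 \<le> v x}" by (auto simp: set_eq_iff intro: exI[of _ 1])
      fix a b assume "a \<in> {x. 0 \<le> v x}" "b \<in> {x. 0 \<le> v x}" "a * b \<in> {x. 0 < v x}"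
      then show "a \<in> {x. 0 < v x} \<or> b \<in> {x. 0 < v x}" by (auto simp: v_mult less_le)
    qed (auto intro: v_add_gt simp: v_mult add_nonneg_pos)
    then show "prime_ideal_of {x. 0 \<le> v x} {x. 0 < v x} \<and> {x. 0 < v x} \<noteq> {0}"
      using nontrivial by auto
  qed (use prime_unique in auto)
qed

end

section \<open>Uniformizers and the valuation of a discrete valuation ring\<close>

lemma ideal_ofD:
  assumes "ideal_of W I"
  shows "I \<subseteq> W" "0 \<in> I" "x \<in> I \<Longrightarrow> y \<in> I \<Longrightarrow> x + y \<in> I" "r \<in> W \<Longrightarrow> x \<in> I \<Longrightarrow> r * x \<in> I"
  using assms by (auto simp: ideal_of_def)

text \<open>The definition of a discrete valuation ring speaks only of its unique non-zero prime
  ideal. An ideal maximal among those containing \<open>a\<close> but not 1 is prime, so every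
  non-zero non-unit lies in that prime.\<close>

lemma ex_prime_ideal_containing:
  assumes W: "subring_of W" and a: "a \<in> W" "\<And>r. r \<in> W \<Longrightarrow> a * r \<noteq> 1"
  shows "\<exists>P. prime_ideal_of W P \<and> a \<in> P"
proof -
  define F where "F = {I. ideal_of W I \<and> a \<in> I \<and> 1 \<notin> I}"
  have W': "0 \<in> W" "1 \<in> W" "\<And>x y. x \<in> W \<Longrightarrow> y \<in> W \<Longrightarrow> x + y \<in> W" "\<And>x y. x \<in> W \<Longrightarrow> y \<in> W \<Longrightarrow> x * y \<in> W"
    using W by (auto simp: subring_of_def)
  have "{a * r |r. r \<in> W} \<in> F"
    unfolding F_def ideal_of_def
  proof (rule CollectI, intro conjI ballI)
    show "a \<in> {a * r |r. r \<in> W}" "0 \<in> {a * r |r. r \<in> W}" using W' by force+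
    show "1 \<notin> {a * r |r. r \<in> W}" "{a * r |r. r \<in> W} \<subseteq> W" using a W' by fastforce+
  next
    fix x y assume "x \<in> {a * r |r. r \<in> W}" "y \<in> {a * r |r. r \<in> W}"
    then show "x + y \<in> {a * r |r. r \<in> W}" using W' by (auto simp flip: distrib_left)
  next
    fix s x assume "s \<in> W" "x \<in> {a * r |r. r \<in> W}"
    then obtain r where "x = a * r" "r \<in> W" by auto
    then show "s * x \<in> {a * r |r. r \<in> W}" using W' \<open>s \<in> W\<close>
      by (intro CollectI exI[of _ "s * r"]) (auto simp: mult_ac)
  qed
  then have "F \<noteq> {}" by auto
  moreover have "\<Union>C \<in> F" if C: "C \<noteq> {}" "subset.chain F C" for C
  proof -
    have CF: "C \<subseteq> F" and tot: "\<And>X Y. X \<in> C \<Longrightarrow> Y \<in> C \<Longrightarrow> X \<subseteq> Y \<or> Y \<subseteq> X"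
      using C(2) by (auto simp: subset.chain_def)
    then have id: "ideal_of W X" "a \<in> X" "1 \<notin> X" if "X \<in> C" for X using that by (auto simp: F_def)
    have "x + y \<in> \<Union>C" if "x \<in> \<Union>C" "y \<in> \<Union>C" for x y
    proof -
      obtain X Y where "x \<in> X" "y \<in> Y" "X \<in> C" "Y \<in> C" using \<open>x \<in> \<Union>C\<close> \<open>y \<in> \<Union>C\<close> by auto
      then show ?thesis using tot[of X Y] ideal_ofD(3)[OF id(1)] by blast
    qed
    moreover have "\<Union>C \<subseteq> W" "0 \<in> \<Union>C" "a \<in> \<Union>C" "1 \<notin> \<Union>C"
      using C(1) id ideal_ofD(1,2)[OF id(1)] by blast+
    moreover have "r * x \<in> \<Union>C" if "r \<in> W" "x \<in> \<Union>C" for r x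
      using that ideal_ofD(4)[OF id(1)] by blast
    ultimately show ?thesis unfolding F_def ideal_of_def by blast
  qed
  ultimately obtain M where M: "M \<in> F" "\<And>X. X \<in> F \<Longrightarrow> M \<subseteq> X \<Longrightarrow> X = M"
    using subset_Zorn_nonempty[of F] by metis
  then have Mid: "ideal_of W M" "a \<in> M" "1 \<notin> M" by (auto simp: F_def)
  have "x \<in> M \<or> y \<in> M" if xy: "x \<in> W" "y \<in> W" "x * y \<in> M" for x y
  proof (rule ccontr)
    assume "\<not> ?thesis"
    then have nx: "x \<notin> M" and ny: "y \<notin> M" by auto
    \<comment> \<open>The ideal generated by \<open>M\<close> and \<open>x\<close>. Maximality
      forces 1 into it, and multiplying 1 = m + x r by \<open>y\<close> puts \<open>y\<close> into
      \<open>M\<close>.\<close>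
    define N where "N = {m + x * r |m r. m \<in> M \<and> r \<in> W}"
    have "M \<subseteq> N" unfolding N_def using W' by force
    have "x \<in> N" unfolding N_def using W' ideal_ofD(2)[OF Mid(1)] by force
    have "ideal_of W N"
      unfolding ideal_of_def
    proof (intro conjI ballI)
      show "N \<subseteq> W" unfolding N_def using W' ideal_ofD(1)[OF Mid(1)] xy by blast
      show "0 \<in> N" using \<open>M \<subseteq> N\<close> ideal_ofD(2)[OF Mid(1)] by auto
      fix s t assume "s \<in> N" "t \<in> N"
      then obtain m r m' r' where "s = m + x * r" "t = m' + x * r'" "m \<in> M" "m' \<in> M" "r \<in> W" "r' \<in> W"
        by (auto simp: N_def)
      then show "s + t \<in> N" unfolding N_def using W' ideal_ofD(3)[OF Mid(1)]
        by (intro CollectI exI[of _ "m + m'"] exI[of _ "r + r'"]) (auto simp: algebra_simps)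
    next
      fix s t assume "s \<in> W" "t \<in> N"
      then obtain m r where "t = m + x * r" "m \<in> M" "r \<in> W" by (auto simp: N_def)
      moreover from this have "s * t = s * m + x * (s * r)" by (simp add: algebra_simps)
      ultimately show "s * t \<in> N" unfolding N_def using W' ideal_ofD(4)[OF Mid(1)] \<open>s \<in> W\<close>
        by blast
    qed
    then have "1 \<in> N" using M(2)[of N] \<open>M \<subseteq> N\<close> \<open>x \<in> N\<close> nx Mid by (auto simp: F_def)
    then obtain m r where mr: "1 = m + x * r" "m \<in> M" "r \<in> W" by (auto simp: N_def)
    have "y = y * (m + x * r)" using mr(1) by simp
    then have "y = y * m + r * (x * y)" by (simp add: algebra_simps)
    moreover have "y * m + r * (x * y) \<in> M"
      by (rule ideal_ofD(3)[OF Mid(1) ideal_ofD(4)[OF Mid(1) xy(2) mr(2)] ideal_ofD(4)[OF Mid(1) mr(3) xy(3)]])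
    ultimately show False using ny by simp
  qed
  moreover have "M \<noteq> W" using Mid W' by auto
  ultimately show ?thesis using Mid by (intro exI[of _ M]) (simp add: prime_ideal_of_def)
qed

text \<open>\<pi> generates the non-zero prime, so it divides every non-zero non-unit. Dividing it
  out must end in a unit, since no non-zero element is divisible by all powers of \<pi>.\<close>

lemma DVR_uniformizer:
  fixes W :: "'b::field set"
  assumes "DVR_with_quotient_field W"
  shows "\<exists>\<pi>\<in>W. \<pi> \<noteq> 0 \<and> inverse \<pi> \<notin> W \<and>
    (\<forall>a\<in>W. a \<noteq> 0 \<longrightarrow> (\<exists>n::nat. a / \<pi> ^ n \<in> W \<and> \<pi> ^ n / a \<in> W))"
proof -
  have W: "subring_of W" and pid: "\<And>I. ideal_of W I \<Longrightarrow> \<exists>a\<in>W. I = {a * r |r. r \<in> W}"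
    and uniq: "\<exists>!P. prime_ideal_of W P \<and> P \<noteq> {0}"
    using assms by (auto simp: DVR_with_quotient_field_def)
  have W': "0 \<in> W" "1 \<in> W" "\<And>x y. x \<in> W \<Longrightarrow> y \<in> W \<Longrightarrow> x + y \<in> W" "\<And>x y. x \<in> W \<Longrightarrow> y \<in> W \<Longrightarrow> x * y \<in> W"
    using W by (auto simp: subring_of_def)
  obtain P where P: "prime_ideal_of W P" "P \<noteq> {0}" using uniq by blast
  then have Pid: "ideal_of W P" "P \<noteq> W" by (auto simp: prime_ideal_of_def)
  obtain \<pi> where \<pi>: "\<pi> \<in> W" "P = {\<pi> * r |r. r \<in> W}" using pid Pid by blast
  have \<pi>0: "\<pi> \<noteq> 0" using P \<pi> W' by auto
  have "\<pi> \<in> P" using \<pi> W' by force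
  have \<pi>inv: "inverse \<pi> \<notin> W"
  proof
    assume "inverse \<pi> \<in> W"
    then have "r \<in> P" if "r \<in> W" for r
      using \<pi> \<pi>0 W' that by (auto intro!: exI[of _ "inverse \<pi> * r"])
    then show False using Pid ideal_ofD(1)[OF Pid(1)] by auto
  qed
  have nonunit: "a / \<pi> \<in> W" if a: "a \<in> W" "a \<noteq> 0" "inverse a \<notin> W" for a
  proof -
    have "a * r \<noteq> 1" if "r \<in> W" for r using a that by (metis inverse_unique)
    then obtain Q where Q: "prime_ideal_of W Q" "a \<in> Q" using ex_prime_ideal_containing[OF W a(1)] by blast
    then have "Q = P" using uniq P a by blast
    then show ?thesis using Q \<pi> \<pi>0 by auto
  qed
  have "\<exists>n::nat. a / \<pi> ^ n \<in> W \<and> \<pi> ^ n / a \<in> W" if a: "a \<in> W" "a \<noteq> 0" for a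
  proof (rule ccontr)
    assume none: "\<not> ?thesis"
    have all: "a / \<pi> ^ n \<in> W" for n
    proof (induction n)
      case (Suc n)
      then have "inverse (a / \<pi> ^ n) \<notin> W" using none by auto
      then have "a / \<pi> ^ n / \<pi> \<in> W" using Suc a \<pi>0 by (intro nonunit) auto
      then show ?case by (simp add: mult.commute)
    qed (use a in auto)
    \<comment> \<open>The infinitely divisible elements form a principal ideal stable under division
      by \<pi>. Writing b / \<pi> = b r for its generator b would give an inverse of \<pi> in
      \<open>W\<close>.\<close>
    define I where "I = {x \<in> W. \<forall>n. x / \<pi> ^ n \<in> W}"
    have "ideal_of W I"
      unfolding ideal_of_def I_def using W' by (auto simp: add_divide_distrib simp flip: times_divide_eq_right)
    then obtain b where b: "b \<in> W" "I = {b * r |r. r \<in> W}" using pid by blast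
    have "a \<in> I" using all a by (auto simp: I_def)
    then have b0: "b \<noteq> 0" using b a by auto
    have "b \<in> I" using b W' by force
    then have bn: "b / \<pi> ^ Suc n \<in> W" for n unfolding I_def by blast
    have "b / \<pi> / \<pi> ^ n \<in> W" for n using bn[of n] by (simp add: mult.commute)
    moreover have "b / \<pi> \<in> W" using bn[of 0] by simp
    ultimately have "b / \<pi> \<in> I" by (auto simp: I_def)
    then obtain r where "b / \<pi> = b * r" "r \<in> W" using b by auto
    then have "inverse \<pi> \<in> W" using b0 by (simp add: divide_inverse)
    then show False using \<pi>inv by simp
  qed
  then show ?thesis using \<pi> \<pi>0 \<pi>inv by blast
qed

theorem DVR_imp_dval:
  fixes W :: "'b::field set"
  assumes DVR: "DVR_with_quotient_field W"
  shows "\<exists>w. dval w 1 \<and> W = {x. 0 \<le> w x}"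
proof -
  have W: "subring_of W" and quot: "\<And>x. \<exists>a\<in>W. \<exists>b\<in>W. b \<noteq> 0 \<and> x = a / b"
    using assms by (auto simp: DVR_with_quotient_field_def)
  have W': "0 \<in> W" "1 \<in> W" "\<And>x y. x \<in> W \<Longrightarrow> y \<in> W \<Longrightarrow> x + y \<in> W" "\<And>x y. x \<in> W \<Longrightarrow> y \<in> W \<Longrightarrow> x * y \<in> W"
    using W by (auto simp: subring_of_def)
  obtain \<pi> where \<pi>: "\<pi> \<in> W" "\<pi> \<noteq> 0" "inverse \<pi> \<notin> W"
    and dec: "\<And>a. a \<in> W \<Longrightarrow> a \<noteq> 0 \<Longrightarrow> \<exists>n::nat. a / \<pi> ^ n \<in> W \<and> \<pi> ^ n / a \<in> W"
    using DVR_uniformizer[OF DVR] by blast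
  define U where "U = {x \<in> W. x \<noteq> 0 \<and> inverse x \<in> W}"
  have U_mult: "x * y \<in> U" if "x \<in> U" "y \<in> U" for x y using that W' by (auto simp: U_def)
  have U_inv: "inverse x \<in> U" if "x \<in> U" for x using that by (auto simp: U_def)
  have \<pi>pow: "\<pi> ^ n \<in> W" for n by (induction n) (use \<pi> W' in auto)
  have pow0: "k = 0" if "\<pi> powi k \<in> U" for k
  proof -
    have neg: False if "inverse (\<pi> ^ Suc n) \<in> W" for n
    proof -
      have "\<pi> ^ n * inverse (\<pi> ^ Suc n) \<in> W" using that \<pi>pow W' by blast
      then show False using \<pi> by (simp add: field_simps)
    qed
    have "\<pi> powi k \<in> W" "inverse (\<pi> powi k) \<in> W" using that by (auto simp: U_def)
    then show ?thesis using neg[of "nat (\<bar>k\<bar> - 1)"] \<pi>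
      by (cases k rule: linorder_cases[of _ 0]) (auto simp: power_int_def power_inverse nat_diff_distrib' simp del: power_Suc)
  qed
  have ex: "\<exists>k. x / \<pi> powi k \<in> U" if x: "x \<noteq> 0" for x
  proof -
    obtain a b where ab: "a \<in> W" "b \<in> W" "b \<noteq> 0" "x = a / b" using quot by blast
    then have "a \<noteq> 0" using x by auto
    obtain m n where mn: "a / \<pi> ^ m \<in> W" "\<pi> ^ m / a \<in> W" "b / \<pi> ^ n \<in> W" "\<pi> ^ n / b \<in> W"
      using dec ab \<open>a \<noteq> 0\<close> by meson
    then have "a / \<pi> ^ m \<in> U" "b / \<pi> ^ n \<in> U" using \<pi> ab \<open>a \<noteq> 0\<close> by (auto simp: U_def)
    then have "a / \<pi> ^ m * inverse (b / \<pi> ^ n) \<in> U" using U_mult U_inv by blast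
    moreover have "a / \<pi> ^ m * inverse (b / \<pi> ^ n) = x / \<pi> powi (int m - int n)"
      using \<pi> ab by (simp add: power_int_diff field_simps)
    ultimately show ?thesis by auto
  qed
  \<comment> \<open>No non-trivial power of \<pi> is a unit (\<open>pow0\<close>), so the exponent
    is unique; this is \<open>ord_eq\<close>.\<close>
  define ord where "ord x = (SOME k. x / \<pi> powi k \<in> U)" for x
  have ord: "x / \<pi> powi ord x \<in> U" if "x \<noteq> 0" for x
    unfolding ord_def using ex[OF that] by (rule someI_ex)
  have ord_eq: "ord x = k" if "x / \<pi> powi k \<in> U" for x k
  proof -
    have x0: "x \<noteq> 0" using that by (auto simp: U_def)
    have "x / \<pi> powi ord x * inverse (x / \<pi> powi k) \<in> U" using U_mult U_inv ord[OF x0] that by blast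
    then have "\<pi> powi (k - ord x) \<in> U" using x0 \<pi> by (simp add: power_int_diff field_simps)
    then show ?thesis using pow0 by fastforce
  qed
  have ord_mult: "ord (x * y) = ord x + ord y" if "x \<noteq> 0" "y \<noteq> 0" for x y
    using U_mult[OF ord ord, OF that] \<pi> by (intro ord_eq) (simp add: power_int_add field_simps)
  have ord_W: "x \<in> W \<longleftrightarrow> 0 \<le> ord x" if x: "x \<noteq> 0" for x
  proof
    assume "x \<in> W"
    then obtain n :: nat where "x / \<pi> ^ n \<in> W" "\<pi> ^ n / x \<in> W" using dec x by blast
    then have "x / \<pi> powi int n \<in> U" using x \<pi> by (auto simp: U_def)
    then show "0 \<le> ord x" using ord_eq by fastforce
  next
    assume "0 \<le> ord x"
    then have "x / \<pi> ^ nat (ord x) \<in> W" using ord[OF x] by (auto simp: U_def power_int_def)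
    then have "x / \<pi> ^ nat (ord x) * \<pi> ^ nat (ord x) \<in> W" using \<pi>pow W' by blast
    then show "x \<in> W" using \<pi> by simp
  qed
  define w where "w x = (if x = 0 then \<infinity> else ereal (of_int (ord x)))" for x
  have "1 / \<pi> powi 0 \<in> U" using W' by (auto simp: U_def)
  then have ord1: "ord 1 = 0" by (rule ord_eq)
  have "\<pi> / \<pi> powi 1 \<in> U" using W' \<pi> by (auto simp: U_def)
  then have ord\<pi>: "ord \<pi> = 1" by (rule ord_eq)
  have w_mult: "w (x * y) = w x + w y" for x y using ord_mult by (auto simp: w_def)
  have w_W: "x \<in> W \<longleftrightarrow> 0 \<le> w x" for x using ord_W W' by (auto simp: w_def)
  \<comment> \<open>Dividing by the element of smaller value reduces the ultrametric inequality to 1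
    + y / x \<in> \<open>W\<close>.\<close>
  have w_add': "w x \<le> w (x + y)" if "w x \<le> w y" for x y
  proof (cases "x = 0")
    case False
    have "y = x * (y / x)" using False by simp
    then have "w y = w x + w (y / x)" using w_mult by metis
    then have "0 \<le> w (y / x)" using that False by (cases "w (y / x)") (auto simp: w_def)
    then have "0 \<le> w (1 + y / x)" using w_W W' by blast
    moreover have "x + y = x * (1 + y / x)" using False by (simp add: field_simps)
    then have "w (x + y) = w x + w (1 + y / x)" using w_mult by metis
    ultimately show ?thesis using False by (cases "w (1 + y / x)") (auto simp: w_def)
  qed (use that in \<open>auto simp: w_def\<close>)
  have "dval w 1"
  proof
    show "min (w x) (w y) \<le> w (x + y)" for x y
      using w_add'[of x y] w_add'[of y x] by (auto simp: min_def add.commute)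
    show "\<exists>x. x \<noteq> 0 \<and> 0 < w x" using \<pi> ord\<pi> by (intro exI[of _ \<pi>]) (auto simp: w_def)
  qed (auto simp: w_mult ord1, auto simp: w_def ord1 split: if_splits)
  then show ?thesis using w_W by blast
qed

text \<open>Different pairs give the same fraction, so one is chosen; \<open>fract_val_Fract\<close>
  shows that the choice is immaterial for a valuation.\<close>

definition fract_val :: "('d::idom \<Rightarrow> ereal) \<Rightarrow> 'd fract \<Rightarrow> ereal" where
  "fract_val w z = (SOME t. \<exists>f g. g \<noteq> 0 \<and> z = Fract f g \<and> t = w f - w g)"

locale domval = pval w for w :: "'d::idom \<Rightarrow> ereal" +
  assumes w_infD: "w x = \<infinity> \<Longrightarrow> x = 0"
begin

lemma w_realE:
  assumes "x \<noteq> 0"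
  obtains r where "w x = ereal r"
  using assms w_infD[of x] v_not_MInf[of x] by (cases "w x") auto

lemma fract_val_Fract:
  assumes "g \<noteq> 0"
  shows "fract_val w (Fract f g) = w f - w g"
proof -
  have "\<exists>t f' g'. g' \<noteq> 0 \<and> Fract f g = Fract f' g' \<and> t = w f' - w g'" using assms by blast
  then have "\<exists>f' g'. g' \<noteq> 0 \<and> Fract f g = Fract f' g' \<and> fract_val w (Fract f g) = w f' - w g'"
    unfolding fract_val_def by (rule someI_ex)
  then obtain f' g' where *: "g' \<noteq> 0" "Fract f g = Fract f' g'" "fract_val w (Fract f g) = w f' - w g'"
    by blast
  then have "f * g' = f' * g" using assms by (simp add: eq_fract)
  then have eq: "w f + w g' = w f' + w g" by (metis v_mult)
  obtain a b where "w g = ereal a" "w g' = ereal b" using w_realE assms *(1) by meson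
  then have "w f - w g = w f' - w g'" using eq by (cases "w f"; cases "w f'") auto
  then show ?thesis using * by simp
qed

lemma fval_fract_val: "fval (fract_val w)"
proof
  fix x y :: "'d fract"
  obtain a b where x: "x = Fract a b" "b \<noteq> 0" by (cases x) auto
  obtain c d where y: "y = Fract c d" "d \<noteq> 0" by (cases y) auto
  obtain r s where rs: "w b = ereal r" "w d = ereal s" using w_realE x y by meson
  show "fract_val w x \<noteq> -\<infinity>"
    using x rs v_not_MInf[of a] by (cases "w a") (auto simp: fract_val_Fract)
  show "fract_val w (x * y) = fract_val w x + fract_val w y"
    using x y rs v_not_MInf[of a] v_not_MInf[of c]
    by (cases "w a"; cases "w c") (auto simp: fract_val_Fract v_mult)
  show "x = 0" if "fract_val w x = \<infinity>"
    using that x rs w_infD[of a] by (cases "w a") (auto simp: fract_val_Fract Zero_fract_def eq_fract)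
  have "min (w (a * d)) (w (c * b)) \<le> w (a * d + c * b)" by (rule v_add)
  then show "min (fract_val w x) (fract_val w y) \<le> fract_val w (x + y)"
    using x y rs v_not_MInf[of a] v_not_MInf[of c]
    by (cases "w a"; cases "w c"; cases "w (a * d + c * b)")
      (auto simp: fract_val_Fract v_mult min_def split: if_splits)
qed (simp_all add: fract_val_Fract Zero_fract_def One_fract_def)

end

lemma const_fract_mult: "const_fract (a * b) = const_fract a * const_fract b"
  by (simp add: const_fract_def mult.commute)

lemma const_fract_0 [simp]: "const_fract 0 = 0" and const_fract_1 [simp]: "const_fract 1 = 1"
  by (simp_all add: const_fract_def Zero_fract_def One_fract_def pCons_one)

lemma const_fract_eq_0_iff [simp]: "const_fract a = 0 \<longleftrightarrow> a = 0"
  by (simp add: const_fract_def Zero_fract_def eq_fract)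

lemma const_fract_power: "const_fract (a ^ n) = const_fract a ^ n"
  by (induction n) (auto simp: const_fract_mult)

lemma const_fract_divide: "const_fract (a / b) = const_fract a / const_fract b"
  by (cases "b = 0") (auto simp: eq_divide_eq simp flip: const_fract_mult)

context Cp
begin

lemma Zring_eq:
  assumes "domval (vpoly v \<alpha> \<delta>)"
  shows "Zring v \<alpha> \<delta> = {\<phi>. 0 \<le> fract_val (vpoly v \<alpha> \<delta>) \<phi>}"
proof -
  interpret domval "vpoly v \<alpha> \<delta>" by fact
  have "0 \<le> fract_val (vpoly v \<alpha> \<delta>) (Fract f g) \<longleftrightarrow> vpoly v \<alpha> \<delta> g \<le> vpoly v \<alpha> \<delta> f" if "g \<noteq> 0" for f g
  proof -
    obtain r where "vpoly v \<alpha> \<delta> g = ereal r" using w_realE \<open>g \<noteq> 0\<close> by blast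
    then show ?thesis using that by (cases "vpoly v \<alpha> \<delta> f") (auto simp: fract_val_Fract)
  qed
  then show ?thesis unfolding Zring_def by (auto, metis Fract_cases)
qed

lemma Zring_memI:
  assumes "domval (vpoly v \<alpha> \<delta>)" "g \<noteq> 0"
  shows "Fract f g \<in> Zring v \<alpha> \<delta> \<longleftrightarrow> vpoly v \<alpha> \<delta> g \<le> vpoly v \<alpha> \<delta> f"
proof -
  interpret domval "vpoly v \<alpha> \<delta>" by fact
  obtain r where "vpoly v \<alpha> \<delta> g = ereal r" using w_realE \<open>g \<noteq> 0\<close> by blast
  then show ?thesis using assms by (cases "vpoly v \<alpha> \<delta> f") (auto simp: Zring_eq fract_val_Fract)
qed

lemma map_poly_of_rat_add: "map_poly of_rat (f + g) = map_poly of_rat f + (map_poly of_rat g :: 'a poly)"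
  by (rule poly_eqI) (simp add: coeff_map_poly of_rat_add)

lemma map_poly_of_rat_mult: "map_poly of_rat (f * g) = map_poly of_rat f * (map_poly of_rat g :: 'a poly)"
  by (rule poly_eqI) (simp add: coeff_map_poly coeff_mult of_rat_sum of_rat_mult)

lemma map_poly_of_rat_eq_0_iff [simp]: "(map_poly of_rat f :: 'a poly) = 0 \<longleftrightarrow> f = 0"
  by (simp add: map_poly_eq_0_iff)

lemma map_poly_of_rat_const [simp]: "map_poly of_rat [:c:] = [:of_rat c :: 'a:]"
  by (cases "c = 0") (auto simp: map_poly_pCons)

lemma pval_comp_of_rat:
  assumes "pval u"
  shows "pval (\<lambda>f. u (map_poly of_rat f :: 'a poly))"
proof -
  interpret pval u by fact
  show ?thesis
    by unfold_locales (auto simp: map_poly_of_rat_add map_poly_of_rat_mult v_mult v_add)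
qed

lemma domval_vpoly:
  assumes "\<delta> = None \<Longrightarrow> \<not> algebraic \<alpha>"
  shows "domval (vpoly v \<alpha> \<delta>)"
proof -
  interpret pval "vpoly v \<alpha> \<delta>"
    unfolding vpoly_eq_vK[abs_def] by (intro pval_comp_of_rat pval_vK)
  show ?thesis
  proof
    fix f assume f: "vpoly v \<alpha> \<delta> f = \<infinity>"
    show "f = 0"
    proof (cases \<delta>)
      case None
      then show ?thesis using f assms by (auto simp: algebraic_iff_rat_poly vpoly_def)
    next
      case (Some d)
      then show ?thesis using f vK_Some_finite[of "map_poly of_rat f"] by (auto simp: vpoly_eq_vK)
    qed
  qed
qed

lemma vpoly_const: "vpoly v \<alpha> \<delta> [:c:] = v (of_rat c)"
  by (simp add: vpoly_eq_vK)

lemma Zring_in_W_p: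
  assumes dom: "domval (vpoly v \<alpha> \<delta>)" and e: "e > 0"
    and disc: "\<And>f. f \<noteq> 0 \<Longrightarrow> \<exists>k::int. vpoly v \<alpha> \<delta> f = ereal (of_int k / real e)"
  shows "Zring v \<alpha> \<delta> \<in> W_p p"
proof -
  interpret domval "vpoly v \<alpha> \<delta>" by (rule dom)
  interpret F: fval "fract_val (vpoly v \<alpha> \<delta>)" by (rule fval_fract_val)
  have const: "fract_val (vpoly v \<alpha> \<delta>) (const_fract r) = v (of_rat r)" for r
    by (simp add: const_fract_def fract_val_Fract vpoly_const)
  interpret F: dval "fract_val (vpoly v \<alpha> \<delta>)" e
  proof
    fix x :: "rat poly fract" assume "x \<noteq> 0"
    obtain f g where x: "x = Fract f g" "g \<noteq> 0" by (cases x) auto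
    then have "f \<noteq> 0" using \<open>x \<noteq> 0\<close> by (auto simp: Zero_fract_def eq_fract)
    then obtain k l where "vpoly v \<alpha> \<delta> f = ereal (of_int k / real e)" "vpoly v \<alpha> \<delta> g = ereal (of_int l / real e)"
      using disc x by meson
    then show "\<exists>k::int. fract_val (vpoly v \<alpha> \<delta>) x = ereal (of_int k / real e)"
      using x by (intro exI[of _ "k - l"]) (auto simp: fract_val_Fract diff_divide_distrib)
  next
    show "\<exists>x. x \<noteq> 0 \<and> 0 < fract_val (vpoly v \<alpha> \<delta>) x"
      by (intro exI[of _ "const_fract (of_nat p)"]) (auto simp: const prime_gt_0_nat[OF prime_p])
  qed (rule e)
  show ?thesis unfolding W_p_def Zring_eq[OF dom] using F.DVR
    by (auto simp: const v_of_rat_ge0_iff)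
qed

text \<open>Dividing the valuation of \<open>W\<close> by its value k at p normalises it; k is
  positive because 1/p is not in Z_(p). Both valuations vanish on units of Z_(p) and agree at p,
  hence on all rationals.\<close>

lemma W_p_imp_dval:
  assumes W: "W \<in> W_p p"
  shows "\<exists>\<omega> e. dval \<omega> e \<and> W = {x. 0 \<le> \<omega> x} \<and> (\<forall>r. \<omega> (const_fract r) = v (of_rat r))"
proof -
  obtain w where w: "dval w 1" "W = {x. 0 \<le> w x}" using W DVR_imp_dval by (auto simp: W_p_def)
  interpret w: dval w 1 by fact
  have mem: "0 \<le> w (const_fract r) \<longleftrightarrow> 0 \<le> v (of_rat r)" for r
    using W w(2) by (auto simp: W_p_def v_of_rat_ge0_iff)
  have p0: "p > 0" using prime_p prime_gt_0_nat by blast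
  let ?P = "const_fract (of_nat p)"
  have P0: "?P \<noteq> 0" using p0 by simp
  obtain k :: int where k: "w ?P = ereal (of_int k)" using w.discrete[OF P0] by auto
  have "\<not> 0 \<le> v (of_rat (1 / of_nat p) :: 'a)" by (simp add: of_rat_divide v_divide)
  then have "\<not> 0 \<le> w (const_fract (1 / of_nat p))" using mem by blast
  then have kpos: "k > 0" using k P0 by (simp add: const_fract_divide w.v_divide)
  define \<omega> where "\<omega> x = w x * ereal (1 / of_int k)" for x
  have nonneg: "0 \<le> \<omega> x \<longleftrightarrow> 0 \<le> w x" for x
    using kpos by (cases "w x") (auto simp: \<omega>_def zero_le_divide_iff)
  have pos: "0 < \<omega> x \<longleftrightarrow> 0 < w x" for x
    using kpos by (cases "w x") (auto simp: \<omega>_def zero_less_divide_iff)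
  interpret \<omega>: dval \<omega> "nat k"
  proof
    fix x y
    show "\<omega> x \<noteq> -\<infinity>" using kpos by (cases "w x") (auto simp: \<omega>_def)
    show "\<omega> (x * y) = \<omega> x + \<omega> y" using kpos w.v_not_MInf[of x] w.v_not_MInf[of y]
      by (cases "w x"; cases "w y") (auto simp: \<omega>_def w.v_mult distrib_right add_divide_distrib)
    show "min (\<omega> x) (\<omega> y) \<le> \<omega> (x + y)"
      using w.v_add[of x y] kpos
      by (cases "w x"; cases "w y"; cases "w (x + y)")
        (auto simp: \<omega>_def min_def divide_le_cancel split: if_splits)
    show "x = 0" if "\<omega> x = \<infinity>" using that kpos by (cases "w x") (auto simp: \<omega>_def)
    show "\<exists>l::int. \<omega> x = ereal (of_int l / real (nat k))" if "x \<noteq> 0"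
      using w.discrete[OF that] kpos by (auto simp: \<omega>_def)
    show "\<exists>x. x \<noteq> 0 \<and> 0 < \<omega> x" using w.nontrivial by (simp add: pos)
  qed (use kpos in \<open>auto simp: \<omega>_def\<close>)
  have unit: "\<omega> (const_fract r) = 0" if "v (of_rat r) = 0" for r
  proof -
    have "0 \<le> w (const_fract r)" using mem that by simp
    have r0: "r \<noteq> 0" using that by auto
    have "v (of_rat (inverse r)) = 0" using that r0 by (simp add: of_rat_inverse v_inverse)
    then have "0 \<le> w (const_fract (1 / r))" using mem[of "inverse r"] by (simp add: inverse_eq_divide)
    then have "0 \<le> - w (const_fract r)" using r0 by (simp add: const_fract_divide w.v_divide)
    then have "w (const_fract r) = 0" using \<open>0 \<le> w (const_fract r)\<close>
      by (cases "w (const_fract r)") auto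
    then show ?thesis by (simp add: \<omega>_def)
  qed
  have P1: "\<omega> ?P = 1" using k kpos by (simp add: \<omega>_def one_ereal_def)
  have "\<omega> (const_fract r) = v (of_rat r)" for r
  proof (cases "r = 0")
    case False
    then obtain l :: int where l: "v (of_rat r) = ereal (of_int l)" using v_of_rat_int by blast
    \<comment> \<open>The unit r / p^l is written as s / t so that only natural exponents occur; one
      of the two powers of p is always 1.\<close>
    define s where "s = r * of_nat p ^ nat (-l)"
    define t where "t = (of_nat p ^ nat l :: rat)"
    have "v (of_rat s) = ereal (of_int l + real (nat (-l)))"
      by (simp add: s_def of_rat_mult of_rat_power v_mult l)
    moreover have "v (of_rat t) = ereal (real (nat l))" by (simp add: t_def of_rat_power)
    moreover have t0: "t \<noteq> 0" using p0 by (simp add: t_def)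
    ultimately have "v (of_rat (s / t)) = 0"
      by (simp add: of_rat_divide v_divide)
    then have "\<omega> (const_fract (s / t)) = 0" by (rule unit)
    then have "\<omega> (const_fract s) - \<omega> (const_fract t) = 0" using t0 by (simp add: const_fract_divide \<omega>.v_divide)
    moreover have "\<omega> (const_fract t) = ereal (real (nat l))"
      by (simp add: t_def const_fract_power \<omega>.v_power P1)
    moreover have "\<omega> (const_fract s) = \<omega> (const_fract r) + ereal (real (nat (-l)))"
      by (simp add: s_def const_fract_mult const_fract_power \<omega>.v_power \<omega>.v_mult P1)
    ultimately show ?thesis using l by (cases "\<omega> (const_fract r)") auto
  qed simp
  then show ?thesis using \<omega>.dval_axioms nonneg w(2) by (intro exI[of _ \<omega>] exI[of _ "nat k"]) auto
qed

text \<open>The ring shows which of two polynomials has the larger value. Since f^e has the value of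
  some rational constant, whose value is the same on both sides, the value of \<open>f\<close> can
  be read off.\<close>

lemma Zring_eq_imp_vpoly_eq:
  assumes a: "domval (vpoly v \<alpha> \<delta>)" and b: "domval (vpoly v \<beta> \<epsilon>)" and eq: "Zring v \<alpha> \<delta> = Zring v \<beta> \<epsilon>"
    and e: "e > 0" "f \<noteq> 0 \<Longrightarrow> \<exists>k::int. vpoly v \<alpha> \<delta> f = ereal (of_int k / real e)"
  shows "vpoly v \<alpha> \<delta> f = vpoly v \<beta> \<epsilon> f"
proof -
  interpret a: domval "vpoly v \<alpha> \<delta>" by fact
  interpret b: domval "vpoly v \<beta> \<epsilon>" by fact
  have iff: "vpoly v \<alpha> \<delta> g \<le> vpoly v \<alpha> \<delta> h \<longleftrightarrow> vpoly v \<beta> \<epsilon> g \<le> vpoly v \<beta> \<epsilon> h" if "g \<noteq> 0" for g h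
    using Zring_memI[OF a that] Zring_memI[OF b that] eq by blast
  show ?thesis
  proof (cases "f = 0")
    case False
    obtain k :: int where k: "vpoly v \<alpha> \<delta> f = ereal (of_int k / real e)" using e False by blast
    obtain c where c: "c \<noteq> 0" "v c = ereal (of_int k)" "\<exists>r. c = of_rat r" using ex_v_of_int by blast
    then obtain r where r: "c = of_rat r" by blast
    have fe: "f ^ e \<noteq> 0" "[:r:] \<noteq> 0" using False c r by auto
    have "vpoly v \<alpha> \<delta> (f ^ e) = vpoly v \<alpha> \<delta> [:r:]" using k c r e by (simp add: a.v_power vpoly_const)
    then have "vpoly v \<beta> \<epsilon> (f ^ e) = vpoly v \<beta> \<epsilon> [:r:]"
      using iff[OF fe(1), of "[:r:]"] iff[OF fe(2), of "f ^ e"] by auto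
    then have "ereal (real e) * vpoly v \<beta> \<epsilon> f = ereal (of_int k)" using c r by (simp add: b.v_power vpoly_const)
    then show ?thesis using k e by (cases "vpoly v \<beta> \<epsilon> f") (auto simp: field_simps split: if_splits)
  qed simp
qed

end

section \<open>Finite-dimensional spaces over a complete subfield\<close>

definition subfield :: "'a::field set \<Rightarrow> bool" where
  "subfield E \<longleftrightarrow> 1 \<in> E \<and> (\<forall>x\<in>E. \<forall>y\<in>E. x + y \<in> E \<and> x - y \<in> E \<and> x * y \<in> E \<and> inverse x \<in> E)"

lemma subfieldD:
  assumes "subfield E"
  shows "1 \<in> E" "0 \<in> E" "x \<in> E \<Longrightarrow> y \<in> E \<Longrightarrow> x + y \<in> E" "x \<in> E \<Longrightarrow> y \<in> E \<Longrightarrow> x - y \<in> E"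
    "x \<in> E \<Longrightarrow> y \<in> E \<Longrightarrow> x * y \<in> E" "x \<in> E \<Longrightarrow> y \<in> E \<Longrightarrow> x / y \<in> E" "x \<in> E \<Longrightarrow> - x \<in> E"
    "(\<And>i. i \<in> A \<Longrightarrow> f i \<in> E) \<Longrightarrow> sum f A \<in> E"
proof -
  show 1: "1 \<in> E" "x \<in> E \<Longrightarrow> y \<in> E \<Longrightarrow> x + y \<in> E" "x \<in> E \<Longrightarrow> y \<in> E \<Longrightarrow> x - y \<in> E"
    "x \<in> E \<Longrightarrow> y \<in> E \<Longrightarrow> x * y \<in> E" "x \<in> E \<Longrightarrow> y \<in> E \<Longrightarrow> x / y \<in> E" for x y
    using assms by (auto simp: subfield_def divide_inverse)
  show 0: "0 \<in> E" using 1(3)[of 1 1] 1(1) by simp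
  show "x \<in> E \<Longrightarrow> - x \<in> E" using 1(3)[of 0 x] 0 by simp
  show "(\<And>i. i \<in> A \<Longrightarrow> f i \<in> E) \<Longrightarrow> sum f A \<in> E"
    by (induction A rule: infinite_finite_induct) (use 0 1 in auto)
qed

text \<open>Gaussian elimination with pivot (i0, j0): removing the pivot row and the column j0
  leaves more rows than columns. Keeping every l i in \<open>E\<close>, also outside
  \<open>I\<close>, avoids side conditions later.\<close>

lemma linear_dependence:
  fixes M :: "'i \<Rightarrow> 'j \<Rightarrow> 'a::field"
  assumes "finite J" "finite I" "card J < card I" "subfield E" "\<And>i j. i \<in> I \<Longrightarrow> j \<in> J \<Longrightarrow> M i j \<in> E"
  shows "\<exists>l. (\<forall>i. l i \<in> E) \<and> (\<exists>i\<in>I. l i \<noteq> 0) \<and> (\<forall>j\<in>J. (\<Sum>i\<in>I. l i * M i j) = 0)"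
  using assms(1,2,3,5)
proof (induction J arbitrary: I M rule: finite_induct)
  case empty
  then show ?case using subfieldD(1)[OF assms(4)] by (intro exI[of _ "\<lambda>_. 1"]) (auto simp: card_gt_0_iff)
next
  case (insert j0 J)
  note E = subfieldD[OF assms(4)]
  show ?case
  proof (cases "\<forall>i\<in>I. M i j0 = 0")
    case True
    obtain l where l: "\<forall>i. l i \<in> E" "\<exists>i\<in>I. l i \<noteq> 0" "\<forall>j\<in>J. (\<Sum>i\<in>I. l i * M i j) = 0"
      using insert.IH[of I M] insert.prems insert.hyps by auto
    then show ?thesis using True by (intro exI[of _ l]) auto
  next
    case False
    then obtain i0 where i0: "i0 \<in> I" "M i0 j0 \<noteq> 0" by blast
    define I' where "I' = I - {i0}"
    define t where "t i = M i j0 / M i0 j0" for i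
    define M' where "M' i j = M i j - t i * M i0 j" for i j
    have t: "t i \<in> E" if "i \<in> I" for i unfolding t_def using that i0 insert.prems by (intro E(6)) auto
    have "\<exists>l. (\<forall>i. l i \<in> E) \<and> (\<exists>i\<in>I'. l i \<noteq> 0) \<and> (\<forall>j\<in>J. (\<Sum>i\<in>I'. l i * M' i j) = 0)"
    proof (rule insert.IH)
      show "finite I'" "card J < card I'" using insert.prems insert.hyps i0 by (auto simp: I'_def)
      show "M' i j \<in> E" if "i \<in> I'" "j \<in> J" for i j
        unfolding M'_def using that t i0 insert.prems by (intro E(4) E(5)) (auto simp: I'_def)
    qed
    then obtain l where l: "\<forall>i. l i \<in> E" "\<exists>i\<in>I'. l i \<noteq> 0" "\<forall>j\<in>J. (\<Sum>i\<in>I'. l i * M' i j) = 0" by blast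
    \<comment> \<open>The weight of the pivot row is forced by column j0; in the other columns it
      undoes the row operations.\<close>
    define l' where "l' i = (if i = i0 then - (\<Sum>i\<in>I'. l i * t i) else l i)" for i
    have split: "(\<Sum>i\<in>I. l' i * M i j) = (\<Sum>i\<in>I'. l i * M i j) - (\<Sum>i\<in>I'. l i * t i) * M i0 j" for j
    proof -
      have "(\<Sum>i\<in>I. l' i * M i j) = l' i0 * M i0 j + (\<Sum>i\<in>I'. l' i * M i j)"
        unfolding I'_def using i0 insert.prems by (intro sum.remove) auto
      also have "(\<Sum>i\<in>I'. l' i * M i j) = (\<Sum>i\<in>I'. l i * M i j)"
        by (intro sum.cong) (auto simp: l'_def I'_def)
      finally show ?thesis by (simp add: l'_def)
    qed
    have "(\<Sum>i\<in>I. l' i * M i j) = 0" if "j \<in> insert j0 J" for j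
    proof (cases "j = j0")
      case True
      have "(\<Sum>i\<in>I'. l i * M i j0) = (\<Sum>i\<in>I'. l i * t i) * M i0 j0"
        using i0 by (simp add: t_def sum_distrib_right)
      then show ?thesis using split[of j0] True by simp
    next
      case False
      then have "(\<Sum>i\<in>I'. l i * M' i j) = 0" using l that by auto
      then show ?thesis using split[of j]
        by (simp add: M'_def right_diff_distrib sum_subtractf sum_distrib_right mult.assoc)
    qed
    moreover have "\<forall>i. l' i \<in> E"
      using l t by (auto simp: l'_def I'_def intro!: E(7) E(8) E(5))
    moreover have "\<exists>i\<in>I. l' i \<noteq> 0" using l by (auto simp: l'_def I'_def)
    ultimately show ?thesis by blast
  qed
qed

section \<open>Convergence and equivalence of norms\<close>

context Cp
begin

lemma converges_const: "converges (\<lambda>_. c) c"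
  by (simp add: converges_def)

lemma converges_add:
  assumes "converges X x" "converges Y y"
  shows "converges (\<lambda>n. X n + Y n) (x + y)"
  unfolding converges_def
proof
  fix M :: real
  obtain N1 N2 where "\<forall>n\<ge>N1. ereal M \<le> v (X n - x)" "\<forall>n\<ge>N2. ereal M \<le> v (Y n - y)"
    using assms by (meson converges_def)
  then have "ereal M \<le> v ((X n - x) + (Y n - y))" if "n \<ge> max N1 N2" for n
    using that by (intro v_add_ge) auto
  then show "\<exists>N. \<forall>n\<ge>N. ereal M \<le> v (X n + Y n - (x + y))"
    by (intro exI[of _ "max N1 N2"]) (simp add: algebra_simps)
qed

lemma converges_mult_left:
  assumes "converges X x"
  shows "converges (\<lambda>n. c * X n) (c * x)"
proof (cases "c = 0")
  case False
  then obtain r where r: "v c = ereal r" by (rule v_realE)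
  show ?thesis unfolding converges_def
  proof
    fix M :: real
    obtain N where N: "\<forall>n\<ge>N. ereal (M - r) \<le> v (X n - x)" using assms by (meson converges_def)
    have "ereal M \<le> v (c * X n - c * x)" if "n \<ge> N" for n
    proof -
      have "v (c * X n - c * x) = ereal r + v (X n - x)"
        unfolding right_diff_distrib[symmetric] v_mult r ..
      then show ?thesis using N[rule_format, OF that] by (cases "v (X n - x)") auto
    qed
    then show "\<exists>N. \<forall>n\<ge>N. ereal M \<le> v (c * X n - c * x)" by blast
  qed
qed (simp add: converges_const)

lemma converges_mult:
  assumes "converges X x" "converges Y y"
  shows "converges (\<lambda>n. X n * Y n) (x * y)"
proof -
  have "converges (\<lambda>n. (X n - x) * (Y n - y)) 0"
    unfolding converges_def
  proof
    fix M :: real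
    \<comment> \<open>The values of the factors add up, and for negative M the sum 2 M would fall
      below M; hence \<open>max M 0\<close>.\<close>
    obtain N1 N2 where *: "\<forall>n\<ge>N1. ereal (max M 0) \<le> v (X n - x)" "\<forall>n\<ge>N2. ereal (max M 0) \<le> v (Y n - y)"
      using assms by (meson converges_def)
    have "ereal M \<le> v ((X n - x) * (Y n - y) - 0)" if "n \<ge> max N1 N2" for n
    proof -
      have "ereal (max M 0) + ereal (max M 0) \<le> v (X n - x) + v (Y n - y)"
        using * that by (intro add_mono) auto
      moreover have "M \<le> max M 0 + max M 0" by (simp add: max_def)
      then have "ereal M \<le> ereal (max M 0) + ereal (max M 0)"
        by (metis ereal_less_eq(3) plus_ereal.simps(1))
      ultimately have "ereal M \<le> v (X n - x) + v (Y n - y)" by (rule order_trans[rotated])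
      then show ?thesis by (simp add: v_mult)
    qed
    then show "\<exists>N. \<forall>n\<ge>N. ereal M \<le> v ((X n - x) * (Y n - y) - 0)" by blast
  qed
  from converges_add[OF this converges_add[OF converges_mult_left[OF assms(1), of y]
      converges_add[OF converges_mult_left[OF assms(2), of x] converges_const[of "- x * y"]]]]
  show ?thesis by (simp add: algebra_simps)
qed

lemma converges_sum:
  assumes "\<And>i. i \<in> A \<Longrightarrow> converges (X i) (x i)"
  shows "converges (\<lambda>n. \<Sum>i\<in>A. X i n) (\<Sum>i\<in>A. x i)"
  using assms by (induction A rule: infinite_finite_induct) (auto intro: converges_const converges_add)

lemma converges_poly: "converges X x \<Longrightarrow> converges (\<lambda>n. poly f (X n)) (poly f x)"
  by (induction f) (auto intro: converges_const converges_add converges_mult)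

lemma converges_unique:
  assumes "converges X x" "converges X y"
  shows "x = y"
proof -
  have "ereal M \<le> v (x - y)" for M
  proof -
    obtain N1 where N1: "\<forall>n\<ge>N1. ereal M \<le> v (X n - x)"
      using assms(1)[unfolded converges_def, rule_format, of M] by blast
    obtain N2 where N2: "\<forall>n\<ge>N2. ereal M \<le> v (X n - y)"
      using assms(2)[unfolded converges_def, rule_format, of M] by blast
    have "ereal M \<le> v (X (max N1 N2) - y)" "ereal M \<le> v (X (max N1 N2) - x)"
      using N1 N2 by simp_all
    then have "ereal M \<le> v (X (max N1 N2) - y - (X (max N1 N2) - x))" by (rule v_diff_ge)
    moreover have "X (max N1 N2) - y - (X (max N1 N2) - x) = x - y" by (rule diff_diff_eq2[THEN trans]) simp
    ultimately show ?thesis by metis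
  qed
  then have "v (x - y) = \<infinity>" by (rule ereal_top)
  then show ?thesis by simp
qed

text \<open>By the ultrametric inequality the valuation is locally constant away from 0.\<close>

lemma converges_v:
  assumes "converges X x" "x \<noteq> 0"
  shows "\<exists>N. \<forall>n\<ge>N. v (X n) = v x"
proof -
  obtain r where r: "v x = ereal r" using assms(2) by (rule v_realE)
  obtain N where N: "\<forall>n\<ge>N. ereal (r + 1) \<le> v (X n - x)" using assms(1) by (meson converges_def)
  have "v (X n) = v x" if "n \<ge> N" for n
  proof (rule v_eq_if_close)
    have "v x < ereal (r + 1)" by (simp add: r)
    then show "v x < v (X n - x)" using N that by (meson less_le_trans)
  qed
  then show ?thesis by blast
qed

lemma converges_v_eq:
  assumes X: "converges X x" and Y: "converges Y y" and eq: "\<And>n. v (X n) = v (Y n)"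
  shows "v x = v y"
proof -
  have zero: "z = 0" if Z: "converges Z z" "converges Z' 0" "\<And>n. v (Z n) = v (Z' n)" for Z Z' z
  proof (rule ccontr)
    assume z: "z \<noteq> 0"
    obtain N where N: "\<forall>n\<ge>N. v (Z n) = v z" using converges_v[OF Z(1) z] by blast
    obtain r where r: "v z = ereal r" using z by (rule v_realE)
    obtain N' where N': "\<forall>n\<ge>N'. ereal (r + 1) \<le> v (Z' n - 0)" using Z(2) by (meson converges_def)
    show False using N[rule_format, of "max N N'"] N'[rule_format, of "max N N'"] Z(3)[of "max N N'"] r by simp
  qed
  show ?thesis
  proof (cases "x = 0 \<or> y = 0")
    case True
    then show ?thesis using zero[of X x Y] zero[of Y y X] X Y eq by auto
  next
    case False
    obtain N N' where "\<forall>n\<ge>N. v (X n) = v x" "\<forall>n\<ge>N'. v (Y n) = v y"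
      using converges_v X Y False by meson
    then show ?thesis using eq[of "max N N'"] by auto
  qed
qed

lemma converges_imp_cauchy:
  assumes "converges X x"
  shows "cauchy X"
  unfolding cauchy_def
proof
  fix M :: real
  obtain N where N: "\<forall>n\<ge>N. ereal M \<le> v (X n - x)" using assms by (meson converges_def)
  have "ereal M \<le> v (X m - x - (X n - x))" if "m \<ge> N" "n \<ge> N" for m n
    using N that by (intro v_diff_ge[of M "X m - x" "X n - x"]; simp)
  then show "\<exists>N. \<forall>m\<ge>N. \<forall>n\<ge>N. ereal M \<le> v (X m - X n)" by (intro exI[of _ N]) auto
qed

lemma converges_if_ge_nat:
  assumes "\<And>n. ereal (real n) \<le> v (X n - x)"
  shows "converges X x"
  unfolding converges_def
proof
  fix M :: real
  obtain N where N: "M \<le> real N" using real_arch_simple by blast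
  have "ereal M \<le> v (X n - x)" if "n \<ge> N" for n
  proof -
    have "ereal M \<le> ereal (real n)" using N that by simp
    then show ?thesis using assms[of n] order_trans by blast
  qed
  then show "\<exists>N. \<forall>n\<ge>N. ereal M \<le> v (X n - x)" by blast
qed

text \<open>Since the large field is complete, a closed subfield is a complete one; this form fits
  closures and domains of isometries.\<close>

definition vclosed :: "'a set \<Rightarrow> bool" where
  "vclosed E \<longleftrightarrow> (\<forall>x. (\<forall>M::real. \<exists>a\<in>E. ereal M \<le> v (x - a)) \<longrightarrow> x \<in> E)"

lemma vclosed_converges:
  assumes "vclosed E" "converges X x" "\<And>n. X n \<in> E"
  shows "x \<in> E"
proof -
  have "\<exists>a\<in>E. ereal M \<le> v (x - a)" for M
  proof -
    obtain N where "\<forall>n\<ge>N. ereal M \<le> v (X n - x)" using assms(2) by (meson converges_def)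
    then show ?thesis using assms(3)[of N] by (metis v_diff_commute order_refl)
  qed
  then show ?thesis using assms(1) by (auto simp: vclosed_def)
qed

text \<open>Equivalence of norms on a finite-dimensional space over a complete field: a vector is
  not much smaller than its coefficients. In the induction step the new basis vector stays at a
  positive distance from the span of the earlier ones.\<close>

theorem coefficient_bound:
  fixes b :: "nat \<Rightarrow> 'a" and n :: nat
  assumes E: "subfield E" "vclosed E"
    and indep: "\<And>c. (\<And>j. c j \<in> E) \<Longrightarrow> (\<Sum>j<n. c j * b j) = 0 \<Longrightarrow> \<forall>j<n. c j = 0"
  shows "\<exists>C::real. \<forall>c. (\<forall>j. c j \<in> E) \<longrightarrow> (\<forall>j<n. v (\<Sum>j<n. c j * b j) \<le> v (c j) + ereal C)"
  using indep
proof (induction n)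
  case (Suc k)
  note E' = subfieldD[OF E(1)]
  have indep_k: "\<forall>j<k. c j = 0" if c: "\<And>j. c j \<in> E" "(\<Sum>j<k. c j * b j) = 0" for c
  proof -
    have "(\<Sum>j<k. (if j < k then c j else 0) * b j) = (\<Sum>j<k. c j * b j)" by (intro sum.cong) auto
    then have "\<forall>j<Suc k. (if j < k then c j else 0) = 0"
      using c E'(2) by (intro Suc.prems) auto
    then show ?thesis by (metis less_Suc_eq)
  qed
  obtain C where C: "\<And>c j. (\<And>j. c j \<in> E) \<Longrightarrow> j < k \<Longrightarrow> v (\<Sum>j<k. c j * b j) \<le> v (c j) + ereal C"
    using Suc.IH[OF indep_k] by auto
  \<comment> \<open>Otherwise combinations of the earlier vectors tend to \<open>b k\<close>. The
    inductive bound makes their coefficients Cauchy, and the limits, which lie in \<open>E\<close>,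
    give a linear relation.\<close>
  have "\<exists>D::real. \<forall>c. (\<forall>j. c j \<in> E) \<longrightarrow> v (b k - (\<Sum>j<k. c j * b j)) \<le> ereal D"
  proof (rule ccontr)
    assume "\<not> ?thesis"
    then have "\<forall>m::nat. \<exists>c. (\<forall>j. c j \<in> E) \<and> ereal (real m) \<le> v (b k - (\<Sum>j<k. c j * b j))"
      by (meson linear)
    then obtain c where cE: "\<And>m j. c m j \<in> E" and c: "\<And>m. ereal (real m) \<le> v (b k - (\<Sum>j<k. c m j * b j))"
      by metis
    have lim_bk: "converges (\<lambda>m. \<Sum>j<k. c m j * b j) (b k)"
      by (rule converges_if_ge_nat) (metis c v_diff_commute)
    have "cauchy (\<lambda>m. c m j)" if j: "j < k" for j
      unfolding cauchy_def
    proof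
      fix M :: real
      obtain N where N: "\<And>m n. m \<ge> N \<Longrightarrow> n \<ge> N \<Longrightarrow>
          ereal (M + C) \<le> v ((\<Sum>j<k. c m j * b j) - (\<Sum>j<k. c n j * b j))"
        using converges_imp_cauchy[OF lim_bk] unfolding cauchy_def by meson
      have "ereal M \<le> v (c m j - c n j)" if "m \<ge> N" "n \<ge> N" for m n
      proof -
        have "v (\<Sum>j<k. (c m j - c n j) * b j) \<le> v (c m j - c n j) + ereal C"
          using cE E'(4) j by (intro C[where c = "\<lambda>j. c m j - c n j"]) auto
        then have "ereal (M + C) \<le> v (c m j - c n j) + ereal C"
          using N[OF that] by (simp add: left_diff_distrib sum_subtractf)
        then show ?thesis by (cases "v (c m j - c n j)") auto
      qed
      then show "\<exists>N. \<forall>m\<ge>N. \<forall>n\<ge>N. ereal M \<le> v (c m j - c n j)" by blast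
    qed
    then have "\<forall>j. \<exists>L. j < k \<longrightarrow> converges (\<lambda>m. c m j) L" using cauchy_converges by meson
    then obtain L where L: "\<And>j. j < k \<Longrightarrow> converges (\<lambda>m. c m j) (L j)" by metis
    have "converges (\<lambda>m. \<Sum>j<k. c m j * b j) (\<Sum>j<k. L j * b j)"
      using L by (intro converges_sum) (auto intro: converges_mult converges_const)
    then have bk: "b k = (\<Sum>j<k. L j * b j)" using lim_bk converges_unique by blast
    define l where "l j = (if j < k then L j else -1)" for j
    have "l j \<in> E" for j using vclosed_converges[OF E(2) L cE] E'(1,7) by (auto simp: l_def)
    moreover have "(\<Sum>j<k. l j * b j) = (\<Sum>j<k. L j * b j)" by (intro sum.cong) (auto simp: l_def)
    then have "(\<Sum>j<Suc k. l j * b j) = 0" using bk by (simp add: l_def)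
    ultimately have "\<forall>j<Suc k. l j = 0" by (rule Suc.prems)
    then show False by (auto simp: l_def)
  qed
  then obtain D where D: "\<And>c. (\<And>j. c j \<in> E) \<Longrightarrow> v (b k - (\<Sum>j<k. c j * b j)) \<le> ereal D" by blast
  obtain B where B: "ereal B \<le> v (b k)"
    by (cases "v (b k)") auto
  \<comment> \<open>With this B' the quantity v S + B' bounds both v S and v (c k * b k) from below,
    hence also the value of the remaining sum, to which the constant C applies.\<close>
  obtain B' where B': "B' \<le> 0" "B' \<le> B - D" by (metis min.cobounded1 min.cobounded2)
  have "v (\<Sum>j<Suc k. c j * b j) \<le> v (c j) + ereal (max (C - B') D)" if c: "\<And>j. c j \<in> E" and j: "j < Suc k" for c j
  proof -
    define S where "S = (\<Sum>j<Suc k. c j * b j)"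
    have top: "v S \<le> v (c k) + ereal D"
    proof (cases "c k = 0")
      case False
      have "S = c k * (b k - (\<Sum>j<k. (- (c j / c k)) * b j))"
        using False by (simp add: S_def sum_negf sum_distrib_left distrib_left)
      moreover have "v (b k - (\<Sum>j<k. (- (c j / c k)) * b j)) \<le> ereal D"
        using c E' by (intro D) auto
      ultimately show ?thesis by (simp add: v_mult add_left_mono)
    qed simp
    show ?thesis
    proof (cases "j = k")
      case True
      then show ?thesis using top by (cases "v (c k)"; cases "v S") (auto simp: S_def max_def)
    next
      case False
      then have jk: "j < k" using j by simp
      have "v S + ereal B' \<le> v (c k * b k)"
        using top B B' by (cases "v S"; cases "v (c k)"; cases "v (b k)") (auto simp: v_mult)
      moreover have "v S + ereal B' \<le> v S" using B' by (cases "v S") auto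
      ultimately have "v S + ereal B' \<le> v (S - c k * b k)" by (rule v_diff_ge[rotated])
      moreover have "S - c k * b k = (\<Sum>j<k. c j * b j)" by (simp add: S_def)
      ultimately have "v S + ereal B' \<le> v (\<Sum>j<k. c j * b j)" by (simp only:)
      also have "\<dots> \<le> v (c j) + ereal C" using c jk by (rule C)
      finally have "v S + ereal B' \<le> v (c j) + ereal C" .
      then show ?thesis unfolding S_def[symmetric] by (cases "v S"; cases "v (c j)") (auto simp: max_def)
    qed
  qed
  then show ?case by blast
qed simp

end

section \<open>Isometric isomorphisms between subrings\<close>

context Cp
begin

text \<open>A partial isometric isomorphism is handled as its graph: as a subring of the product ring all of
  whose pairs have equal valuations it is automatically single-valued and injective, and the roles
  of domain and range are symmetric.\<close>

definition iso_graph :: "('a \<times> 'a) set \<Rightarrow> bool" where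
  "iso_graph R \<longleftrightarrow> (1, 1) \<in> R \<and> (\<forall>a b c d. (a, b) \<in> R \<longrightarrow> (c, d) \<in> R \<longrightarrow>
     (a + c, b + d) \<in> R \<and> (a - c, b - d) \<in> R \<and> (a * c, b * d) \<in> R) \<and> (\<forall>a b. (a, b) \<in> R \<longrightarrow> v a = v b)"

definition rel_poly :: "('a \<times> 'a) set \<Rightarrow> 'a poly \<Rightarrow> 'a poly \<Rightarrow> bool" where
  "rel_poly R F G \<longleftrightarrow> (\<forall>i. (coeff F i, coeff G i) \<in> R)"

text \<open>For a subring \<open>R\<close> of the product ring this is the subring generated by
  \<open>R\<close> and (x, y).\<close>

definition adjoin :: "('a \<times> 'a) set \<Rightarrow> 'a \<Rightarrow> 'a \<Rightarrow> ('a \<times> 'a) set" where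
  "adjoin R x y = {(poly F x, poly G y) |F G. rel_poly R F G}"

lemma iso_graphD:
  assumes "iso_graph R"
  shows "(1, 1) \<in> R" "(0, 0) \<in> R" "(a, b) \<in> R \<Longrightarrow> (c, d) \<in> R \<Longrightarrow> (a + c, b + d) \<in> R"
    "(a, b) \<in> R \<Longrightarrow> (c, d) \<in> R \<Longrightarrow> (a - c, b - d) \<in> R"
    "(a, b) \<in> R \<Longrightarrow> (c, d) \<in> R \<Longrightarrow> (a * c, b * d) \<in> R" "(a, b) \<in> R \<Longrightarrow> v a = v b"
    "(a, b) \<in> R \<Longrightarrow> (- a, - b) \<in> R"
    "(\<And>i. i \<in> A \<Longrightarrow> (f i, g i) \<in> R) \<Longrightarrow> (sum f A, sum g A) \<in> R"
    "(a, b) \<in> R \<Longrightarrow> (a ^ n, b ^ n) \<in> R"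
proof -
  show 1: "(1, 1) \<in> R" "(a, b) \<in> R \<Longrightarrow> (c, d) \<in> R \<Longrightarrow> (a + c, b + d) \<in> R"
    "(a, b) \<in> R \<Longrightarrow> (c, d) \<in> R \<Longrightarrow> (a - c, b - d) \<in> R"
    "(a, b) \<in> R \<Longrightarrow> (c, d) \<in> R \<Longrightarrow> (a * c, b * d) \<in> R" "(a, b) \<in> R \<Longrightarrow> v a = v b" for a b c d
    using assms unfolding iso_graph_def by blast+
  show 0: "(0, 0) \<in> R" using 1(3)[OF 1(1) 1(1)] by simp
  show "(a, b) \<in> R \<Longrightarrow> (- a, - b) \<in> R" using 1(3)[OF 0] by simp
  show "(\<And>i. i \<in> A \<Longrightarrow> (f i, g i) \<in> R) \<Longrightarrow> (sum f A, sum g A) \<in> R"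
    by (induction A rule: infinite_finite_induct) (use 0 1 in auto)
  show "(a, b) \<in> R \<Longrightarrow> (a ^ n, b ^ n) \<in> R" by (induction n) (use 1 in auto)
qed

lemma iso_graph_converse: "iso_graph R \<Longrightarrow> iso_graph (R\<inverse>)"
  unfolding iso_graph_def by (simp; metis)

lemma iso_graph_eq_0_iff: "iso_graph R \<Longrightarrow> (a, b) \<in> R \<Longrightarrow> a = 0 \<longleftrightarrow> b = 0"
  using iso_graphD(6) by (metis v_inf_iff)

lemma rel_poly_simps:
  assumes R: "iso_graph R"
  shows "(a, b) \<in> R \<Longrightarrow> rel_poly R [:a:] [:b:]" "rel_poly R [:0, 1:] [:0, 1:]"
    "rel_poly R F G \<Longrightarrow> rel_poly R F' G' \<Longrightarrow> rel_poly R (F + F') (G + G')"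
    "rel_poly R F G \<Longrightarrow> rel_poly R F' G' \<Longrightarrow> rel_poly R (F - F') (G - G')"
    "rel_poly R F G \<Longrightarrow> rel_poly R F' G' \<Longrightarrow> rel_poly R (F * F') (G * G')"
  unfolding rel_poly_def coeff_mult
  by (auto simp: coeff_pCons split: nat.splits intro!: iso_graphD[OF R])

lemma adjoin_closed:
  assumes R: "iso_graph R"
  shows "R \<subseteq> adjoin R x y" "(x, y) \<in> adjoin R x y"
    "(a, b) \<in> adjoin R x y \<Longrightarrow> (c, d) \<in> adjoin R x y \<Longrightarrow> (a + c, b + d) \<in> adjoin R x y"
    "(a, b) \<in> adjoin R x y \<Longrightarrow> (c, d) \<in> adjoin R x y \<Longrightarrow> (a - c, b - d) \<in> adjoin R x y"
    "(a, b) \<in> adjoin R x y \<Longrightarrow> (c, d) \<in> adjoin R x y \<Longrightarrow> (a * c, b * d) \<in> adjoin R x y"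
proof -
  have mem: "(s, t) \<in> adjoin R x y" if "rel_poly R F G" "s = poly F x" "t = poly G y" for F G s t
    using that by (auto simp: adjoin_def)
  show "R \<subseteq> adjoin R x y"
    using mem[OF rel_poly_simps(1)[OF R]] by (simp add: subset_iff)
  show "(x, y) \<in> adjoin R x y"
    using mem[OF rel_poly_simps(2)[OF R]] by simp
  assume "(a, b) \<in> adjoin R x y" "(c, d) \<in> adjoin R x y"
  then obtain F G F' G' where *: "rel_poly R F G" "a = poly F x" "b = poly G y"
      "rel_poly R F' G'" "c = poly F' x" "d = poly G' y" by (auto simp: adjoin_def)
  show "(a + c, b + d) \<in> adjoin R x y" using * by (intro mem[OF rel_poly_simps(3)[OF R]]) auto
  show "(a - c, b - d) \<in> adjoin R x y" using * by (intro mem[OF rel_poly_simps(4)[OF R]]) auto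
  show "(a * c, b * d) \<in> adjoin R x y" using * by (intro mem[OF rel_poly_simps(5)[OF R]]) auto
qed

lemma iso_graph_adjoin:
  assumes R: "iso_graph R" and eq: "\<And>F G. rel_poly R F G \<Longrightarrow> v (poly F x) = v (poly G y)"
  shows "iso_graph (adjoin R x y)"
  unfolding iso_graph_def
proof (intro conjI allI impI)
  show "(1, 1) \<in> adjoin R x y" using adjoin_closed(1)[OF R] iso_graphD(1)[OF R] by auto
  show "v a = v b" if "(a, b) \<in> adjoin R x y" for a b using that eq by (auto simp: adjoin_def)
qed (use adjoin_closed(3-5)[OF R] in auto)

definition field_graph :: "('a \<times> 'a) set \<Rightarrow> bool" where
  "field_graph R \<longleftrightarrow> iso_graph R \<and> (\<forall>a b. (a, b) \<in> R \<longrightarrow> (inverse a, inverse b) \<in> R)"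

lemma field_graph_divide:
  assumes "field_graph R" "(a, b) \<in> R" "(c, d) \<in> R"
  shows "(a / c, b / d) \<in> R"
  using assms unfolding field_graph_def divide_inverse by (blast intro: iso_graphD(5))

lemma subfield_Domain:
  assumes "field_graph R"
  shows "subfield (Domain R)"
proof -
  have R: "iso_graph R" and inv: "\<And>a b. (a, b) \<in> R \<Longrightarrow> (inverse a, inverse b) \<in> R"
    using assms by (auto simp: field_graph_def)
  show ?thesis unfolding subfield_def
  proof (intro conjI ballI)
    show "1 \<in> Domain R" using iso_graphD(1)[OF R] by blast
    fix x y assume "x \<in> Domain R" "y \<in> Domain R"
    then obtain x' y' where *: "(x, x') \<in> R" "(y, y') \<in> R" by blast
    then show "x + y \<in> Domain R" "x - y \<in> Domain R" "x * y \<in> Domain R" "inverse x \<in> Domain R"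
      using iso_graphD(3,4,5)[OF R *] inv by blast+
  qed
qed

lemma field_graph_of_rat:
  assumes "field_graph R"
  shows "(of_rat q, of_rat q) \<in> R"
proof -
  have R: "iso_graph R" using assms by (simp add: field_graph_def)
  have nat: "(of_nat n, of_nat n) \<in> R" for n
    by (induction n) (use iso_graphD(1,2,3)[OF R] in auto)
  have int: "(of_int n, of_int n) \<in> R" for n
    by (cases n) (use nat iso_graphD(7)[OF R] in \<open>auto simp del: of_nat_Suc\<close>)
  obtain a b :: int where ab: "b > 0" "q = of_int a / of_int b" using of_rat_quotient by blast
  then show ?thesis using field_graph_divide[OF assms int int, of a b] by (simp add: of_rat_divide)
qed

text \<open>Positivity is what continuity or a norm estimate yields directly. It forces value 0 to
  go to value 0, and every non-zero element has a power that differs from value 0 by a rational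
  scalar.\<close>

lemma isometric_if_positive:
  assumes mult: "\<And>a b c d. (a, b) \<in> S \<Longrightarrow> (c, d) \<in> S \<Longrightarrow> (a * c, b * d) \<in> S"
    and rat: "\<And>q. (of_rat q, of_rat q) \<in> S"
    and inv: "\<And>a b. (a, b) \<in> S \<Longrightarrow> a \<noteq> 0 \<Longrightarrow> (inverse a, inverse b) \<in> S \<and> b \<noteq> 0"
    and pos: "\<And>a b. (a, b) \<in> S \<Longrightarrow> 0 < v a \<Longrightarrow> 0 < v b"
    and ab: "(a, b) \<in> S" "a \<noteq> 0"
  shows "v a = v b"
proof -
  have pow: "(a ^ n, b ^ n) \<in> S" if "(a, b) \<in> S" for a b n
    by (induction n) (use mult that rat[of 1] in auto)
  have nonneg: "0 \<le> v b" if S: "(a, b) \<in> S" "v a = 0" for a b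
  proof (rule ccontr)
    have "a \<noteq> 0" using S by auto
    then have "b \<noteq> 0" using inv S by blast
    then obtain r where r: "v b = ereal r" by (rule v_realE)
    assume "\<not> 0 \<le> v b"
    then have "0 < - r" using r by simp
    \<comment> \<open>Then p a^N has value 1 > 0, but p b^N has value 1 + N r < 0.\<close>
    then obtain N where N: "1 < real N * (- r)" using reals_Archimedean3 by blast
    have "(of_rat (of_nat p) * a ^ N, of_rat (of_nat p) * b ^ N) \<in> S" using mult rat pow S by blast
    moreover have "0 < v (of_rat (of_nat p) * a ^ N)" using S by (simp add: v_mult v_power)
    ultimately have "0 < v (of_rat (of_nat p) * b ^ N)" by (rule pos)
    then have "0 < 1 + real N * r" by (simp add: v_mult v_power r one_ereal_def)
    then show False using N by simp
  qed
  have zero: "v b = 0" if S: "(a, b) \<in> S" "v a = 0" for a b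
  proof -
    have a0: "a \<noteq> 0" using S by auto
    then have "(inverse a, inverse b) \<in> S" "b \<noteq> 0" using inv S by blast+
    then have "0 \<le> v (inverse b)" using S a0 by (intro nonneg[of "inverse a"]) (auto simp: v_inverse)
    then show ?thesis using nonneg[OF S] \<open>b \<noteq> 0\<close> by (cases "v b") (auto simp: v_inverse)
  qed
  obtain k :: int and m :: nat where km: "m > 0" "v a = ereal (of_int k / real m)"
    using v_rational[OF ab(2)] by blast
  obtain c where c: "c \<noteq> 0" "v c = ereal (of_int (-k))" "\<exists>r. c = of_rat r" using ex_v_of_int by blast
  have "(c * a ^ m, c * b ^ m) \<in> S" using mult rat pow[OF ab(1)] c by blast
  moreover have "v (c * a ^ m) = 0" using km c by (simp add: v_mult v_power)
  ultimately have "v (c * b ^ m) = 0" by (rule zero)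
  then have "ereal (of_int (-k)) + ereal (real m) * v b = 0" using c by (simp add: v_mult v_power)
  then show ?thesis using km by (cases "v b") (auto simp: field_simps zero_ereal_def split: if_splits)
qed

section \<open>Adjoining an algebraic element to an isometry\<close>

definition span_pairs :: "('a \<times> 'a) set \<Rightarrow> nat \<Rightarrow> 'a \<Rightarrow> 'a \<Rightarrow> ('a \<times> 'a) set" where
  "span_pairs R n x y = {(\<Sum>j<n. c j * x ^ j, \<Sum>j<n. d j * y ^ j) |c d. \<forall>j. (c j, d j) \<in> R}"

lemma span_pairs_iff: "(a, b) \<in> span_pairs R n x y \<longleftrightarrow>
    (\<exists>c d. (\<forall>j. (c j, d j) \<in> R) \<and> a = (\<Sum>j<n. c j * x ^ j) \<and> b = (\<Sum>j<n. d j * y ^ j))"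
  unfolding span_pairs_def mem_Collect_eq prod.inject by blast

text \<open>The n-th powers of x and y are reduced by matching relations, so both components of a
  pair can be brought to degree below n simultaneously.\<close>

lemma adjoin_subset_span_pairs:
  assumes R: "iso_graph R" and n: "n > 0"
    and top: "(x ^ n, y ^ n) \<in> span_pairs R n x y"
  shows "adjoin R x y \<subseteq> span_pairs R n x y"
proof -
  note R' = iso_graphD[OF R]
  let ?S = "span_pairs R n x y"
  have mem: "(s, t) \<in> ?S" if "\<And>j. (c j, d j) \<in> R" "s = (\<Sum>j<n. c j * x ^ j)" "t = (\<Sum>j<n. d j * y ^ j)" for s t c d
    using that unfolding span_pairs_iff by blast
  have add: "(a + a', b + b') \<in> ?S" if "(a, b) \<in> ?S" "(a', b') \<in> ?S" for a b a' b'
  proof -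
    obtain c d where "\<forall>j. (c j, d j) \<in> R" "a = (\<Sum>j<n. c j * x ^ j)" "b = (\<Sum>j<n. d j * y ^ j)"
      using \<open>(a, b) \<in> ?S\<close> unfolding span_pairs_iff by blast
    moreover obtain c' d' where "\<forall>j. (c' j, d' j) \<in> R" "a' = (\<Sum>j<n. c' j * x ^ j)" "b' = (\<Sum>j<n. d' j * y ^ j)"
      using \<open>(a', b') \<in> ?S\<close> unfolding span_pairs_iff by blast
    ultimately show ?thesis using R'(3)
      by (intro mem[of "\<lambda>j. c j + c' j" "\<lambda>j. d j + d' j"]) (auto simp: distrib_right sum.distrib)
  qed
  have smult: "(r * a, s * b) \<in> ?S" if "(r, s) \<in> R" "(a, b) \<in> ?S" for r s a b
  proof -
    obtain c d where "\<forall>j. (c j, d j) \<in> R" "a = (\<Sum>j<n. c j * x ^ j)" "b = (\<Sum>j<n. d j * y ^ j)"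
      using \<open>(a, b) \<in> ?S\<close> unfolding span_pairs_iff by blast
    then show ?thesis using R'(5) \<open>(r, s) \<in> R\<close>
      by (intro mem[of "\<lambda>j. r * c j" "\<lambda>j. s * d j"]) (auto simp: sum_distrib_left mult.assoc)
  qed
  have shift: "(x * a, y * b) \<in> ?S" if ab: "(a, b) \<in> ?S" for a b
  proof -
    obtain c d where cd: "\<forall>j. (c j, d j) \<in> R" "a = (\<Sum>j<n. c j * x ^ j)" "b = (\<Sum>j<n. d j * y ^ j)"
      using ab unfolding span_pairs_iff by blast
    obtain m where m: "n = Suc m" using n by (cases n) auto
    \<comment> \<open>Multiplication by z shifts the coefficients; only the top one, c m with n = m
      + 1, leaves the range and needs \<open>top\<close>.\<close>
    have eq: "z * (\<Sum>j<n. c j * z ^ j) = (\<Sum>j<n. (if j = 0 then 0 else c (j - 1)) * z ^ j) + c m * z ^ n" for c and z :: 'a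
    proof -
      have "(\<Sum>j<n. (if j = 0 then 0 else c (j - 1)) * z ^ j) = (\<Sum>j<m. c j * z ^ Suc j)"
        unfolding m sum.lessThan_Suc_shift by simp
      then show ?thesis by (simp add: m sum_distrib_left distrib_left mult_ac)
    qed
    have "(\<Sum>j<n. (if j = 0 then 0 else c (j - 1)) * x ^ j, \<Sum>j<n. (if j = 0 then 0 else d (j - 1)) * y ^ j) \<in> ?S"
      using cd R'(2) by (intro mem[OF _ refl refl]) auto
    moreover have "(c m * x ^ n, d m * y ^ n) \<in> ?S" using smult top cd by blast
    ultimately show ?thesis unfolding cd(2,3) eq by (rule add)
  qed
  have one: "(1, 1) \<in> ?S"
  proof (rule mem[of "\<lambda>j. if j = 0 then 1 else 0" "\<lambda>j. if j = 0 then 1 else 0"])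
    show "((if j = 0 then 1 else 0), (if j = 0 then 1 else 0)) \<in> R" for j :: nat using R'(1,2) by auto
  qed (use n in \<open>auto simp: if_distrib[of "\<lambda>c. c * _"] cong: if_cong\<close>)
  have pow: "(x ^ i, y ^ i) \<in> ?S" for i by (induction i) (use one shift in auto)
  have sums: "(sum f A, sum g A) \<in> ?S" if "\<And>i. i \<in> A \<Longrightarrow> (f i, g i) \<in> ?S" for f g and A :: "nat set"
    using that
  proof (induction A rule: infinite_finite_induct)
    case (insert i A)
    then show ?case using add by auto
  qed (use smult[OF R'(2) one] in auto)
  show ?thesis
  proof
    fix t assume "t \<in> adjoin R x y"
    then obtain F G where t: "t = (poly F x, poly G y)" "rel_poly R F G" by (auto simp: adjoin_def)
    define N where "N = max (degree F) (degree G)"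
    have val: "poly H z = (\<Sum>i\<le>N. coeff H i * z ^ i)" if "degree H \<le> N" for H :: "'a poly" and z
      unfolding poly_altdef using that by (intro sum.mono_neutral_left) (auto simp: coeff_eq_0)
    have "(coeff F i * x ^ i, coeff G i * y ^ i) \<in> ?S" for i
      using t smult pow by (auto simp: rel_poly_def)
    then show "t \<in> ?S" using val[of F x] val[of G y] sums[of "{..N}"] t by (simp add: N_def)
  qed
qed

text \<open>Uniqueness of the extended valuation over a complete field. If v a > 0, the coefficients
  of a^k have values growing linearly in k by \<open>coefficient_bound\<close>; so do those of the
  partner b^k, whence v b > 0, and \<open>isometric_if_positive\<close> concludes.\<close>

theorem algebraic_extension:
  assumes R: "field_graph R" and closed: "vclosed (Domain R)" and n: "n > 0"
    and top: "(x ^ n, y ^ n) \<in> span_pairs R n x y"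
    and indep: "\<And>c. (\<And>j. c j \<in> Domain R) \<Longrightarrow> (\<Sum>j<n. c j * x ^ j) = 0 \<Longrightarrow> \<forall>j<n. c j = 0"
    and FG: "rel_poly R F G"
  shows "v (poly F x) = v (poly G y)"
proof -
  have iso: "iso_graph R" using R by (simp add: field_graph_def)
  note R' = iso_graphD[OF iso] and S' = adjoin_closed[OF iso, where x = x and y = y]
  let ?S = "adjoin R x y"
  have Spow: "(a ^ k, b ^ k) \<in> ?S" if "(a, b) \<in> ?S" for a b k
    by (induction k) (use S'(1,5) R'(1) that in auto)
  have repr: "\<exists>c d. (\<forall>j. (c j, d j) \<in> R) \<and> a = (\<Sum>j<n. c j * x ^ j) \<and> b = (\<Sum>j<n. d j * y ^ j)"
    if "(a, b) \<in> ?S" for a b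
    using that adjoin_subset_span_pairs[OF iso n top] span_pairs_iff by blast
  obtain C where C: "\<And>c j. (\<And>j. c j \<in> Domain R) \<Longrightarrow> j < n \<Longrightarrow> v (\<Sum>j<n. c j * x ^ j) \<le> v (c j) + ereal C"
    using coefficient_bound[OF subfield_Domain[OF R] closed indep] by blast
  have zero: "b = 0" if ab: "(0, b) \<in> ?S" for b
  proof -
    obtain c d where cd: "\<forall>j. (c j, d j) \<in> R" "0 = (\<Sum>j<n. c j * x ^ j)" "b = (\<Sum>j<n. d j * y ^ j)"
      using repr[OF ab] by blast
    then have "\<forall>j<n. c j = 0" by (intro indep) auto
    then have "\<forall>j<n. d j = 0" using cd(1) iso_graph_eq_0_iff[OF iso] by metis
    then show ?thesis using cd by simp
  qed
  have pos: "0 < v b" if ab: "(a, b) \<in> ?S" "0 < v a" for a b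
  proof -
    obtain s where s: "0 < s" "ereal s \<le> v a" using ab(2) by (cases "v a") (auto intro: that[of 1])
    \<comment> \<open>A common lower bound for the values of the powers y^j.
      \<open>real_of_ereal\<close> sends \<infinity> to 0, which is harmless since any bound holds
      there.\<close>
    define B where "B = Min (insert 0 ((\<lambda>j. real_of_ereal (v (y ^ j))) ` {..<n}))"
    have B: "ereal B \<le> v (y ^ j)" if "j < n" for j
    proof (cases "v (y ^ j)")
      case (real r)
      then have "B \<le> r" unfolding B_def using that by (intro Min_le) (auto intro!: image_eqI[of _ _ j])
      then show ?thesis using real by simp
    qed (auto simp del: v_inf_iff)
    \<comment> \<open>The growth k s must exceed the loss C in passing to the coefficients and the
      loss -B in passing back to the sum.\<close>
    obtain k :: nat where k: "C - B < real k * s" using reals_Archimedean3[OF s(1)] by blast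
    obtain c d where cd: "\<forall>j. (c j, d j) \<in> R" "a ^ k = (\<Sum>j<n. c j * x ^ j)" "b ^ k = (\<Sum>j<n. d j * y ^ j)"
      using repr[OF Spow[OF ab(1)]] by blast
    have "ereal (real k * s - C + B) \<le> v (b ^ k)"
      unfolding cd(3)
    proof (rule v_sum_ge)
      fix j assume j: "j \<in> {..<n}"
      have "ereal (real k) * ereal s \<le> v (a ^ k)"
        unfolding v_power by (rule ereal_mult_left_mono) (use s in auto)
      also have "\<dots> \<le> v (c j) + ereal C"      proof -
        have "c i \<in> Domain R" for i using cd(1) by blast
        then show ?thesis unfolding cd(2) using C[of c j] j by simp
      qed
      also have "v (c j) = v (d j)" using cd(1) R'(6) by blast
      finally have "ereal (real k * s - C) \<le> v (d j)" by (cases "v (d j)") auto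
      then have "ereal (real k * s - C) + ereal B \<le> v (d j) + v (y ^ j)"
        using B j by (intro add_mono) auto
      then show "ereal (real k * s - C + B) \<le> v (d j * y ^ j)" by (simp add: v_mult)
    qed
    moreover have "0 < ereal (real k * s - C + B)" using k by simp
    ultimately have "0 < v (b ^ k)" by (rule less_le_trans[rotated])
    then show ?thesis unfolding v_power by (cases "v b") (auto simp: zero_less_mult_iff zero_ereal_def)
  qed
  have inv: "(inverse a, inverse b) \<in> ?S \<and> b \<noteq> 0" if ab: "(a, b) \<in> ?S" "a \<noteq> 0" for a b
  proof -
    have "\<exists>c. (\<forall>j. c j \<in> Domain R) \<and> a ^ i = (\<Sum>j<n. c j * x ^ j)" for i
      using repr[OF Spow[OF ab(1)], of i] by (metis DomainI)
    then obtain M where M: "\<And>i j. M i j \<in> Domain R" "\<And>i. a ^ i = (\<Sum>j<n. M i j * x ^ j)" by metis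
    \<comment> \<open>The n + 1 powers of \<open>a\<close> lie in the span of n elements. The
      resulting relation, divided by its lowest term, exhibits the inverse of \<open>a\<close> as a
      polynomial in \<open>a\<close>.\<close>
    have "\<exists>l. (\<forall>i. l i \<in> Domain R) \<and> (\<exists>i\<in>{..n}. l i \<noteq> 0) \<and> (\<forall>j\<in>{..<n}. (\<Sum>i\<in>{..n}. l i * M i j) = 0)"
      by (rule linear_dependence[OF _ _ _ subfield_Domain[OF R]]) (use M in auto)
    then obtain l where l: "\<And>i. l i \<in> Domain R" "\<exists>i\<le>n. l i \<noteq> 0" "\<And>j. j < n \<Longrightarrow> (\<Sum>i\<le>n. l i * M i j) = 0"
      by auto
    have "\<forall>i. \<exists>t. (l i, t) \<in> R" using l(1) by blast
    then obtain l' where l': "\<And>i. (l i, l' i) \<in> R" by metis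
    define m where "m = (LEAST i. l i \<noteq> 0)"
    have lm: "l m \<noteq> 0" unfolding m_def using l(2) by (metis (mono_tags, lifting) LeastI)
    have low: "l i = 0" if "i < m" for i using not_less_Least[of i "\<lambda>i. l i \<noteq> 0"] that m_def by auto
    have "m \<le> n" using l(2) low by (meson leD le_less_linear less_le_trans)
    have "(\<Sum>i\<le>n. l i * a ^ i) = (\<Sum>i\<le>n. \<Sum>j<n. l i * M i j * x ^ j)"
      by (simp only: M(2) sum_distrib_left mult.assoc)
    also have "\<dots> = (\<Sum>j<n. (\<Sum>i\<le>n. l i * M i j) * x ^ j)"
      by (subst sum.swap) (simp only: sum_distrib_right)
    also have "\<dots> = 0" using l(3) by simp
    finally have "0 = (\<Sum>i\<le>n. l i * a ^ i)" by simp
    also have "\<dots> = (\<Sum>i=m..n. l i * a ^ i)"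
      using low by (intro sum.mono_neutral_right) (auto simp: not_le)
    also have "\<dots> = l m * a ^ m + (\<Sum>i=Suc m..n. l i * a ^ i)"
      using \<open>m \<le> n\<close> by (rule sum.atLeast_Suc_atMost)
    also have "(\<Sum>i=Suc m..n. l i * a ^ i) = a ^ m * (a * (\<Sum>i=Suc m..n. l i * a ^ (i - Suc m)))"
      unfolding sum_distrib_left by (intro sum.cong) (auto simp: mult_ac simp flip: power_add power_Suc)
    finally have "a ^ m * (l m + a * (\<Sum>i=Suc m..n. l i * a ^ (i - Suc m))) = 0"
      by (simp add: distrib_left mult.commute)
    then have "l m + a * (\<Sum>i=Suc m..n. l i * a ^ (i - Suc m)) = 0" using ab(2) by simp
    then have "a * ((-1 / l m) * (\<Sum>i=Suc m..n. l i * a ^ (i - Suc m))) = 1"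
      using lm by (simp add: field_simps) (simp add: neg_eq_iff_add_eq_0 add.commute)
    then have inva: "inverse a = (-1 / l m) * (\<Sum>i=Suc m..n. l i * a ^ (i - Suc m))" by (rule inverse_unique)
    have sums: "(sum f A, sum g A) \<in> ?S" if "\<And>i. i \<in> A \<Longrightarrow> (f i, g i) \<in> ?S" for f g and A :: "nat set"
      using that by (induction A rule: infinite_finite_induct) (use S'(1,3) R'(2) in auto)
    define w where "w = (-1 / l' m) * (\<Sum>i=Suc m..n. l' i * b ^ (i - Suc m))"
    have "(-1 / l m, -1 / l' m) \<in> R" using field_graph_divide[OF R R'(7)[OF R'(1)] l'] .
    then have w: "(inverse a, w) \<in> ?S" unfolding inva w_def
      using l' S'(1) Spow[OF ab(1)] by (intro S'(5) sums) auto
    \<comment> \<open>The first component is 0, so \<open>zero\<close> identifies the partner w as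
      the inverse of \<open>b\<close>.\<close>
    have "(a * inverse a - 1, b * w - 1) \<in> ?S" using S'(1) R'(1) w ab by (intro S'(4,5)) auto
    then have "b * w = 1" using zero ab by fastforce
    then have "inverse b = w" "b \<noteq> 0" by (auto intro: inverse_unique)
    then show ?thesis using w by simp
  qed
  have FS: "(poly F x, poly G y) \<in> ?S" using FG by (auto simp: adjoin_def)
  show ?thesis
  proof (cases "poly F x = 0")
    case True
    then have "poly G y = 0" using zero FS by simp
    then show ?thesis using True by simp
  next
    case False
    show ?thesis
    proof (rule isometric_if_positive[of ?S])
      show "(of_rat q, of_rat q) \<in> ?S" for q using field_graph_of_rat[OF R] S'(1) by blast
    qed (use S'(5) inv pos FS False in auto)
  qed
qed

section \<open>Maximal isometries are automorphisms\<close>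

definition maximal_graph :: "('a \<times> 'a) set \<Rightarrow> bool" where
  "maximal_graph R \<longleftrightarrow> iso_graph R \<and> (\<forall>S. iso_graph S \<longrightarrow> R \<subseteq> S \<longrightarrow> S = R)"

lemma maximal_graph_converse:
  assumes "maximal_graph R"
  shows "maximal_graph (R\<inverse>)"
  unfolding maximal_graph_def
proof (intro conjI allI impI)
  show "iso_graph (R\<inverse>)" using assms iso_graph_converse by (auto simp: maximal_graph_def)
  fix S assume S: "iso_graph S" "R\<inverse> \<subseteq> S"
  then have "R \<subseteq> S\<inverse>" by auto
  then have "S\<inverse> = R" using assms iso_graph_converse[OF S(1)] by (simp add: maximal_graph_def)
  then show "S = R\<inverse>" by (metis converse_converse)
qed

lemma ex_maximal_graph:
  assumes R0: "iso_graph R0"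
  shows "\<exists>R. R0 \<subseteq> R \<and> maximal_graph R"
proof -
  define F where "F = {S. iso_graph S \<and> R0 \<subseteq> S}"
  have "\<Union>C \<in> F" if C: "C \<noteq> {}" "subset.chain F C" for C
  proof -
    have CF: "C \<subseteq> F" and tot: "\<And>X Y. X \<in> C \<Longrightarrow> Y \<in> C \<Longrightarrow> X \<subseteq> Y \<or> Y \<subseteq> X"
      using C(2) by (auto simp: subset.chain_def)
    then have iso: "iso_graph X" "R0 \<subseteq> X" if "X \<in> C" for X using that by (auto simp: F_def)
    have two: "\<exists>X\<in>C. s \<in> X \<and> t \<in> X" if "s \<in> \<Union>C" "t \<in> \<Union>C" for s t
      using that tot by blast
    have "iso_graph (\<Union>C)"
      unfolding iso_graph_def
    proof (intro conjI allI impI)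
      show "(1, 1) \<in> \<Union>C" using C(1) iso_graphD(1)[OF iso(1)] by blast
      show "v a = v b" if "(a, b) \<in> \<Union>C" for a b using that iso_graphD(6)[OF iso(1)] by blast
    next
      fix a b c d assume "(a, b) \<in> \<Union>C" "(c, d) \<in> \<Union>C"
      then obtain X where X: "X \<in> C" "(a, b) \<in> X" "(c, d) \<in> X" using two by blast
      then show "(a + c, b + d) \<in> \<Union>C" "(a - c, b - d) \<in> \<Union>C" "(a * c, b * d) \<in> \<Union>C"
        using iso_graphD(3-5)[OF iso(1)] by blast+
    qed
    then show ?thesis unfolding F_def using C(1) iso(2) by blast
  qed
  moreover have "F \<noteq> {}" using R0 by (auto simp: F_def)
  ultimately obtain M where M: "M \<in> F" "\<And>X. X \<in> F \<Longrightarrow> M \<subseteq> X \<Longrightarrow> X = M"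
    using subset_Zorn_nonempty[of F] by metis
  then have "maximal_graph M" unfolding maximal_graph_def F_def by blast
  then show ?thesis using M by (auto simp: F_def)
qed

text \<open>Quotients of related pairs again form an isometric graph, so a maximal graph contains
  them.\<close>

lemma maximal_graph_field_graph:
  assumes max: "maximal_graph R"
  shows "field_graph R"
proof -
  have R: "iso_graph R" using max by (simp add: maximal_graph_def)
  note R' = iso_graphD[OF R]
  define S where "S = {(a / c, b / d) |a b c d. (a, b) \<in> R \<and> (c, d) \<in> R \<and> c \<noteq> 0}"
  have mem: "(s, t) \<in> S" if "(a, b) \<in> R" "(c, d) \<in> R" "c \<noteq> 0" "s = a / c" "t = b / d" for a b c d s t
    using that unfolding S_def by blast
  have nz: "d \<noteq> 0" if "(c, d) \<in> R" "c \<noteq> 0" for c d using iso_graph_eq_0_iff[OF R] that by blast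
  have "iso_graph S"
    unfolding iso_graph_def
  proof (intro conjI allI impI)
    show "(1, 1) \<in> S" by (rule mem[OF R'(1) R'(1)]) auto
    show "v s = v t" if st: "(s, t) \<in> S" for s t
    proof -
      obtain a b c d where *: "(a, b) \<in> R" "(c, d) \<in> R" "c \<noteq> 0" "s = a / c" "t = b / d"
        using st unfolding S_def mem_Collect_eq prod.inject by metis
      then show ?thesis using nz[of c d] R'(6) by (metis v_divide)
    qed
  next
    fix s t s' t' assume "(s, t) \<in> S" "(s', t') \<in> S"
    then obtain a b c d a' b' c' d' where *: "(a, b) \<in> R" "(c, d) \<in> R" "c \<noteq> 0" "s = a / c" "t = b / d"
        "(a', b') \<in> R" "(c', d') \<in> R" "c' \<noteq> 0" "s' = a' / c'" "t' = b' / d'"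
      unfolding S_def mem_Collect_eq prod.inject by metis
    have d: "d \<noteq> 0" "d' \<noteq> 0" using * nz by blast+
    have 1: "(a * c', b * d') \<in> R" "(a' * c, b' * d) \<in> R" "(c * c', d * d') \<in> R" "(a * a', b * b') \<in> R"
      using * R'(5) by blast+
    show "(s + s', t + t') \<in> S"
      by (rule mem[OF R'(3)[OF 1(1,2)] 1(3)]) (use * d in \<open>auto simp: add_frac_eq\<close>)
    show "(s - s', t - t') \<in> S"
      by (rule mem[OF R'(4)[OF 1(1,2)] 1(3)]) (use * d in \<open>auto simp: diff_frac_eq\<close>)
    show "(s * s', t * t') \<in> S"
      by (rule mem[OF 1(4,3)]) (use * d in auto)
  qed
  moreover have "R \<subseteq> S"
  proof
    fix z assume "z \<in> R"
    then show "z \<in> S" using mem[OF _ R'(1), of "fst z" "snd z"] by (cases z) auto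
  qed
  ultimately have "S = R" using max by (auto simp: maximal_graph_def)
  then have "(inverse a, inverse b) \<in> R" if "(a, b) \<in> R" for a b
  proof (cases "a = 0")
    case True
    then show ?thesis using that iso_graph_eq_0_iff[OF R that] by simp
  next
    case False
    then have "(1 / a, 1 / b) \<in> S" using mem[OF R'(1) that] by simp
    then show ?thesis using \<open>S = R\<close> by (simp add: divide_inverse)
  qed
  then show ?thesis using R by (auto simp: field_graph_def)
qed

lemma maximal_graph_adjoin:
  assumes max: "maximal_graph R" and eq: "\<And>F G. rel_poly R F G \<Longrightarrow> v (poly F x) = v (poly G y)"
  shows "(x, y) \<in> R"
proof -
  have R: "iso_graph R" using max by (simp add: maximal_graph_def)
  have "adjoin R x y = R"
    using max iso_graph_adjoin[OF R eq] adjoin_closed(1)[OF R] unfolding maximal_graph_def by blast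
  then show ?thesis using adjoin_closed(2)[OF R] by blast
qed

text \<open>For a sequence in the domain tending to x, the partner sequence is Cauchy, since
  differences keep their values. Values of polynomials pass to the limits, so the pair of limits can
  be adjoined.\<close>

lemma maximal_graph_closed:
  assumes max: "maximal_graph R"
  shows "vclosed (Domain R)"
  unfolding vclosed_def
proof (intro allI impI)
  fix x assume x: "\<forall>M. \<exists>a\<in>Domain R. ereal M \<le> v (x - a)"
  have R: "iso_graph R" using max by (simp add: maximal_graph_def)
  note R' = iso_graphD[OF R]
  have "\<forall>n::nat. \<exists>a b. (a, b) \<in> R \<and> ereal (real n) \<le> v (a - x)"
    using x by (metis DomainE v_diff_commute)
  then obtain a b where ab: "\<And>n. (a n, b n) \<in> R" "\<And>n::nat. ereal (real n) \<le> v (a n - x)" by metis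
  have a: "converges a x" using ab(2) by (rule converges_if_ge_nat)
  have "v (b m - b n) = v (a m - a n)" for m n using R'(6)[OF R'(4)[OF ab(1) ab(1)]] by simp
  then have "cauchy b" using converges_imp_cauchy[OF a] by (simp add: cauchy_def)
  then obtain y where y: "converges b y" using cauchy_converges by blast
  have "(x, y) \<in> R"
  proof (rule maximal_graph_adjoin[OF max])
    fix F G assume FG: "rel_poly R F G"
    show "v (poly F x) = v (poly G y)"
    proof (rule converges_v_eq[OF converges_poly[OF a] converges_poly[OF y]])
      fix n
      have "(coeff F i * a n ^ i, coeff G i * b n ^ i) \<in> R" for i
        using FG ab(1) by (auto simp: rel_poly_def intro: R'(5,9))
      then have "(\<Sum>i\<le>max (degree F) (degree G). coeff F i * a n ^ i, \<Sum>i\<le>max (degree F) (degree G). coeff G i * b n ^ i) \<in> R"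
        by (rule R'(8))
      moreover have "poly F (a n) = (\<Sum>i\<le>max (degree F) (degree G). coeff F i * a n ^ i)"
        unfolding poly_altdef by (intro sum.mono_neutral_left) (auto simp: coeff_eq_0)
      moreover have "poly G (b n) = (\<Sum>i\<le>max (degree F) (degree G). coeff G i * b n ^ i)"
        unfolding poly_altdef by (intro sum.mono_neutral_left) (auto simp: coeff_eq_0)
      ultimately show "v (poly F (a n)) = v (poly G (b n))" using R'(6) by metis
    qed
  qed
  then show "x \<in> Domain R" by blast
qed

text \<open>This replaces the minimal polynomial: n is least with x^n in the span of the lower
  powers, and independence of those powers is what the norm estimate consumes.\<close>

lemma minimal_relation:
  fixes x :: 'a
  assumes E: "subfield E" and f: "f \<noteq> 0" "\<And>i. coeff f i \<in> E" "poly f x = 0"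
  shows "\<exists>n>0. (\<exists>c. (\<forall>j. c j \<in> E) \<and> x ^ n = (\<Sum>j<n. c j * x ^ j)) \<and>
    (\<forall>c. (\<forall>j. c j \<in> E) \<longrightarrow> (\<Sum>j<n. c j * x ^ j) = 0 \<longrightarrow> (\<forall>j<n. c j = 0)) \<and> n \<le> degree f"
proof -
  note E' = subfieldD[OF E]
  define Q where "Q n \<longleftrightarrow> (\<exists>c. (\<forall>j. c j \<in> E) \<and> x ^ n = (\<Sum>j<n. c j * x ^ j))" for n
  \<comment> \<open>Solve a non-trivial relation for the highest power with a non-zero
    coefficient.\<close>
  have rel: "\<exists>k<m. Q k" if "\<And>j. c j \<in> E" "(\<Sum>j<m. c j * x ^ j) = 0" "j0 < m" "c j0 \<noteq> 0" for c and m j0 :: nat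
    using that(2-4)
  proof (induction m)
    case (Suc m)
    show ?case
    proof (cases "c m = 0")
      case True
      then have "\<exists>k<m. Q k" using Suc by (intro Suc.IH) (auto simp: less_Suc_eq)
      then show ?thesis by (auto intro: less_SucI)
    next
      case False
      have "x ^ m = (\<Sum>j<m. (- (c j / c m)) * x ^ j)"
      proof -
        have "c m * x ^ m = - (\<Sum>j<m. c j * x ^ j)"
          using Suc.prems(1) by (simp add: eq_neg_iff_add_eq_0 add.commute)
        also have "\<dots> = c m * (\<Sum>j<m. (- (c j / c m)) * x ^ j)"
          using False by (simp add: sum_distrib_left sum_negf)
        finally show ?thesis using False by simp
      qed
      then have "Q m" unfolding Q_def
        by (intro exI[of _ "\<lambda>j. - (c j / c m)"]) (use that(1) E' in auto)
      then show ?thesis by blast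
    qed
  qed simp
  have "(\<Sum>j<Suc (degree f). coeff f j * x ^ j) = 0"
    using f(3) unfolding poly_altdef lessThan_Suc_atMost .
  then have "\<exists>k<Suc (degree f). Q k" using f by (intro rel[of "coeff f" _ "degree f"]) auto
  then obtain k where k: "Q k" "k \<le> degree f" by auto
  define n where "n = (LEAST n. Q n)"
  have n: "Q n" unfolding n_def using k(1) by (rule LeastI)
  have "n \<le> degree f" unfolding n_def using Least_le[of Q, OF k(1)] k(2) by (rule order_trans)
  moreover have "n \<noteq> 0"
  proof
    assume "n = 0"
    then show False using n by (simp add: Q_def)
  qed
  then have "n > 0" by simp
  moreover have "\<forall>j<n. c j = 0" if cE: "\<forall>j. c j \<in> E" and c0: "(\<Sum>j<n. c j * x ^ j) = 0" for c
  proof (rule ccontr)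
    assume "\<not> ?thesis"
    then obtain j where j: "j < n" "c j \<noteq> 0" by blast
    obtain k where "k < n" "Q k" using rel[OF cE[rule_format] c0 j] by blast
    then show False using not_less_Least[of k Q] by (simp add: n_def)
  qed
  ultimately show ?thesis using n unfolding Q_def by (intro exI[of _ n] conjI) blast+
qed

lemma ex_root_of_relation:
  fixes d :: "nat \<Rightarrow> 'a"
  assumes "n > 0"
  shows "\<exists>y. y ^ n = (\<Sum>j<n. d j * y ^ j)"
proof -
  define g where "g = - (\<Sum>j<n. monom (d j) j)"
  have "degree (\<Sum>j<n. monom (d j) j) < n"
    by (rule degree_sum_less) (use assms in \<open>auto intro: le_less_trans[OF degree_monom_le]\<close>)
  then have "degree (monom 1 n + g) = n"
    by (subst degree_add_eq_left) (auto simp: g_def degree_monom_eq)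
  then obtain y where "poly (monom 1 n + g) y = 0" using ex_root[of "monom 1 n + g"] assms by metis
  then show ?thesis by (intro exI[of _ y]) (simp add: g_def poly_sum poly_monom)
qed

lemma maximal_graph_Domain:
  assumes max: "maximal_graph R"
  shows "Domain R = UNIV"
proof -
  have iso: "iso_graph R" using max by (simp add: maximal_graph_def)
  note R = maximal_graph_field_graph[OF max] and closed = maximal_graph_closed[OF max]
  have "x \<in> Domain R" if x: "algebraic x" for x
  proof -
    obtain f :: "rat poly" where f: "f \<noteq> 0" "poly (map_poly of_rat f) x = 0"
      using x algebraic_iff_rat_poly by blast
    have co: "coeff (map_poly of_rat f :: 'a poly) i \<in> Domain R" for i
      using field_graph_of_rat[OF R] by (auto simp: coeff_map_poly)
    obtain n c where n: "n > 0" and c: "\<And>j. c j \<in> Domain R" "x ^ n = (\<Sum>j<n. c j * x ^ j)"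
      and indep: "\<And>c. (\<And>j. c j \<in> Domain R) \<Longrightarrow> (\<Sum>j<n. c j * x ^ j) = 0 \<Longrightarrow> \<forall>j<n. c j = 0"
      using minimal_relation[OF subfield_Domain[OF R] _ co f(2)] f(1) by auto
    have "\<forall>j. \<exists>d. (c j, d) \<in> R" using c(1) by blast
    then obtain d where d: "\<And>j. (c j, d j) \<in> R" by metis
    \<comment> \<open>Any root of the transported relation serves as the image of x.\<close>
    obtain y where y: "y ^ n = (\<Sum>j<n. d j * y ^ j)" using ex_root_of_relation[OF n] by blast
    have "(x ^ n, y ^ n) \<in> span_pairs R n x y" unfolding span_pairs_iff using c d y by blast
    then have "(x, y) \<in> R"
      by (intro maximal_graph_adjoin[OF max] algebraic_extension[OF R closed n _ indep])
    then show ?thesis by blast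
  qed
  then have "x \<in> Domain R" for x
    using closed algebraic_dense unfolding vclosed_def by blast
  then show ?thesis by blast
qed

theorem iso_graph_extends:
  assumes "iso_graph R0"
  shows "\<exists>\<sigma>\<in>Gal_p v. \<forall>a b. (a, b) \<in> R0 \<longrightarrow> \<sigma> a = b"
proof -
  obtain R where R0: "R0 \<subseteq> R" and max: "maximal_graph R" using ex_maximal_graph[OF assms] by blast
  have iso: "iso_graph R" using max by (simp add: maximal_graph_def)
  note R' = iso_graphD[OF iso]
  \<comment> \<open>Surjectivity is totality of the converse graph, which is maximal as
    well.\<close>
  have "Domain R = UNIV" "Range R = UNIV"
    using maximal_graph_Domain[OF max] maximal_graph_Domain[OF maximal_graph_converse[OF max]] by auto
  have right_unique: "b = b'" if "(a, b) \<in> R" "(a, b') \<in> R" for a b b'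
    using iso_graph_eq_0_iff[OF iso R'(4)[OF that]] by simp
  have left_unique: "a = a'" if "(a, b) \<in> R" "(a', b) \<in> R" for a a' b
    using iso_graph_eq_0_iff[OF iso R'(4)[OF that]] by simp
  have "\<forall>a. \<exists>b. (a, b) \<in> R" using \<open>Domain R = UNIV\<close> by blast
  then obtain \<sigma> where \<sigma>: "\<And>a. (a, \<sigma> a) \<in> R" by metis
  have \<sigma>_eq: "\<sigma> a = b" if "(a, b) \<in> R" for a b using right_unique \<sigma> that by blast
  have v\<sigma>: "v (\<sigma> x - \<sigma> y) = v (x - y)" for x y using R'(6)[OF R'(4)[OF \<sigma> \<sigma>]] by simp
  have "\<sigma> \<in> Gal_p v"
    unfolding Gal_p_def
  proof (intro CollectI conjI allI ballI)
    have "inj \<sigma>" using left_unique \<sigma> by (metis injI)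
    moreover have "\<forall>b. \<exists>a. (a, b) \<in> R" using \<open>Range R = UNIV\<close> by blast
    then have "surj \<sigma>" unfolding surj_def using \<sigma>_eq by metis
    ultimately show "bij \<sigma>" by (simp add: bij_def)
    show "\<sigma> (x + y) = \<sigma> x + \<sigma> y" "\<sigma> (x * y) = \<sigma> x * \<sigma> y" for x y
      using \<sigma>_eq[OF R'(3)[OF \<sigma> \<sigma>]] \<sigma>_eq[OF R'(5)[OF \<sigma> \<sigma>]] by auto
    have \<sigma>_rat: "\<sigma> (of_rat q) = of_rat q" for q
      using \<sigma>_eq field_graph_of_rat[OF maximal_graph_field_graph[OF max]] by blast
    show "\<sigma> x = x" if x: "x \<in> Qp_in v" for x
    proof -
      have "ereal M \<le> v (\<sigma> x - x)" for M
      proof -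
        obtain q where q: "ereal M \<le> v (x - of_rat q)" using x by (auto simp: Qp_in_def)
        then have "ereal M \<le> v (\<sigma> x - of_rat q)" using v\<sigma>[of x "of_rat q"] \<sigma>_rat by simp
        then have "ereal M \<le> v (\<sigma> x - of_rat q - (x - of_rat q))" using q by (rule v_diff_ge)
        then show ?thesis by simp
      qed
      then have "v (\<sigma> x - x) = \<infinity>" by (rule ereal_top)
      then show ?thesis by simp
    qed
    show "\<exists>N::real. \<forall>y. ereal N \<le> v (y - x) \<longrightarrow> ereal M \<le> v (\<sigma> y - \<sigma> x)" for x and M :: real
      using v\<sigma> by auto
  qed
  then show ?thesis using \<sigma>_eq R0 by blast
qed

text \<open>\<open>Gal_p\<close> asks only for continuity. If v a > 0, the powers of
  \<open>a\<close> tend to 0, hence so do their images, and this forces the image of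
  \<open>a\<close> to have positive value.\<close>

lemma Gal_p_isometric:
  assumes \<sigma>: "\<sigma> \<in> Gal_p v"
  shows "v (\<sigma> x) = v x"
proof -
  have hom: "\<sigma> (x + y) = \<sigma> x + \<sigma> y" "\<sigma> (x * y) = \<sigma> x * \<sigma> y" for x y using \<sigma> by (auto simp: Gal_p_def)
  have bij: "bij \<sigma>" using \<sigma> by (auto simp: Gal_p_def)
  have rat: "\<sigma> (of_rat q) = of_rat q" for q
  proof -
    have "of_rat q \<in> Qp_in v" by (auto simp: Qp_in_def intro!: exI[of _ q])
    then show ?thesis using \<sigma> by (auto simp: Gal_p_def)
  qed
  have zero: "\<sigma> 0 = 0" and one: "\<sigma> 1 = 1" using rat[of 0] rat[of 1] by auto
  show ?thesis
  proof (cases "x = 0")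
    case True
    then show ?thesis by (simp add: zero)
  next
    case False
    have pow: "\<sigma> (a ^ n) = \<sigma> a ^ n" for a n by (induction n) (auto simp: hom one)
    have "v x = v (\<sigma> x)"
    proof (rule isometric_if_positive[of "{(a, \<sigma> a) |a. True}"])
      fix a b assume ab: "(a, b) \<in> {(a, \<sigma> a) |a. True}" "a \<noteq> 0"
      then have "\<sigma> a * \<sigma> (inverse a) = 1" using hom(2)[of a "inverse a"] one by simp
      then show "(inverse a, inverse b) \<in> {(a, \<sigma> a) |a. True} \<and> b \<noteq> 0"
        using ab inverse_unique[of "\<sigma> a"] by auto
    next
      fix a b assume ab: "(a, b) \<in> {(a, \<sigma> a) |a. True}" "0 < v a"
      obtain N :: real where N: "\<And>y. ereal N \<le> v (y - 0) \<Longrightarrow> ereal 1 \<le> v (\<sigma> y - \<sigma> 0)"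
        using \<sigma> unfolding Gal_p_def by blast
      obtain s where s: "0 < s" "ereal s \<le> v a" using ab(2) by (cases "v a") (auto intro: that[of 1])
      obtain n :: nat where n: "N < real n * s" using reals_Archimedean3[OF s(1)] by blast
      have "ereal (real n) * ereal s \<le> v (a ^ n)"
        unfolding v_power by (rule ereal_mult_left_mono) (use s in auto)
      moreover have "ereal N \<le> ereal (real n) * ereal s" using n by simp
      ultimately have "ereal N \<le> v (a ^ n)" by (rule order_trans[rotated])
      then have "1 \<le> v (\<sigma> a ^ n)" using N[of "a ^ n"] by (simp add: zero pow one_ereal_def)
      then have "0 < ereal (real n) * v (\<sigma> a)" unfolding v_power
        by (rule less_le_trans[rotated]) simp
      then show "0 < v b" using ab by (cases "v (\<sigma> a)") (auto simp: zero_less_mult_iff zero_ereal_def)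
    next
      show "(of_rat q, of_rat q) \<in> {(a, \<sigma> a) |a. True}" for q by (simp add: rat)
    qed (use hom False in auto)
    then show ?thesis by simp
  qed
qed

section \<open>Conjugate elements\<close>

lemma rational_coefficients:
  fixes F :: "'a poly"
  assumes "\<And>i. coeff F i \<in> \<rat>"
  shows "\<exists>f. F = map_poly of_rat f"
  using assms
proof (induction F)
  case 0
  show ?case by (intro exI[of _ 0]) simp
next
  case (pCons a F)
  have "coeff F i \<in> \<rat>" for i using pCons.prems[of "Suc i"] by simp
  then obtain f where f: "F = map_poly of_rat f" using pCons.IH by blast
  have "a \<in> \<rat>" using pCons.prems[of 0] by simp
  then obtain r where r: "a = of_rat r" by (auto elim: Rats_cases)
  have "map_poly of_rat (pCons r f) = pCons a F"
    by (intro poly_eqI) (auto simp: coeff_map_poly coeff_pCons f r split: nat.splits)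
  then show ?case by metis
qed

text \<open>Extend the identity of the rationals by the pair (\<alpha>, \<beta>); the hypothesis
  says exactly that this extension is isometric.\<close>

theorem Gal_p_transitive:
  assumes "\<And>f::rat poly. v (poly (map_poly of_rat f) \<alpha>) = v (poly (map_poly of_rat f) \<beta>)"
  shows "\<exists>\<sigma>\<in>Gal_p v. \<sigma> \<alpha> = \<beta>"
proof -
  define Q where "Q = {(a, a) |a::'a. a \<in> \<rat>}"
  have Q: "iso_graph Q" by (auto simp: iso_graph_def Q_def)
  have "iso_graph (adjoin Q \<alpha> \<beta>)"
  proof (rule iso_graph_adjoin[OF Q])
    fix F G assume "rel_poly Q F G"
    then have "F = G" "\<And>i. coeff F i \<in> \<rat>" by (auto simp: rel_poly_def Q_def poly_eq_iff)
    then show "v (poly F \<alpha>) = v (poly G \<beta>)" using assms rational_coefficients[of F] by auto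
  qed
  then show ?thesis using iso_graph_extends adjoin_closed(2)[OF Q] by blast
qed

section \<open>The closed subfield Q_p and conjugates over it\<close>

lemma Qp_in_iff_limit: "x \<in> Qp_in v \<longleftrightarrow> (\<exists>X. converges (\<lambda>n. of_rat (X n)) x)"
proof
  assume "x \<in> Qp_in v"
  then have "\<forall>n::nat. \<exists>q. ereal (real n) \<le> v (x - of_rat q)" by (auto simp: Qp_in_def)
  then obtain X where "\<And>n::nat. ereal (real n) \<le> v (x - of_rat (X n))" by metis
  then have "converges (\<lambda>n. of_rat (X n)) x"
    by (intro converges_if_ge_nat) (simp add: v_diff_commute[of _ x])
  then show "\<exists>X. converges (\<lambda>n. of_rat (X n)) x" by blast
next
  assume "\<exists>X. converges (\<lambda>n. of_rat (X n)) x"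
  then obtain X where X: "converges (\<lambda>n. of_rat (X n)) x" by blast
  show "x \<in> Qp_in v"
    unfolding Qp_in_def
  proof (intro CollectI allI)
    fix M :: real
    obtain N where "\<forall>n\<ge>N. ereal M \<le> v (of_rat (X n) - x)" using X unfolding converges_def by blast
    then have "ereal M \<le> v (of_rat (X N) - x)" by simp
    then show "\<exists>q. ereal M \<le> v (x - of_rat q)" by (metis v_diff_commute)
  qed
qed

lemma converges_inverse:
  assumes "converges X x" "x \<noteq> 0"
  shows "converges (\<lambda>n. inverse (X n)) (inverse x)"
  unfolding converges_def
proof
  fix M :: real
  obtain r where r: "v x = ereal r" using assms(2) by (rule v_realE)
  obtain N1 where N1: "\<forall>n\<ge>N1. v (X n) = v x" using converges_v[OF assms] by blast
  obtain N2 where N2: "\<forall>n\<ge>N2. ereal (M + 2 * r) \<le> v (X n - x)" using assms(1) unfolding converges_def by blast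
  have "ereal M \<le> v (inverse (X n) - inverse x)" if n: "n \<ge> max N1 N2" for n
  proof -
    have Xn: "v (X n) = ereal r" using N1 n r by simp
    then have nz: "X n \<noteq> 0" by auto
    then have "inverse (X n) - inverse x = - ((X n - x) / (X n * x))"
      using assms(2) by (simp add: field_simps)
    then have "v (inverse (X n) - inverse x) = v (X n - x) - (ereal r + ereal r)"
      using nz assms(2) r Xn by (simp add: v_divide v_mult del: plus_ereal.simps)
    moreover have "ereal (M + 2 * r) \<le> v (X n - x)" using N2 n by simp
    ultimately show ?thesis by (cases "v (X n - x)") auto
  qed
  then show "\<exists>N. \<forall>n\<ge>N. ereal M \<le> v (inverse (X n) - inverse x)" by blast
qed

lemma subfield_Qp: "subfield (Qp_in v)"
  unfolding subfield_def
proof (intro conjI ballI)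
  show "1 \<in> Qp_in v" unfolding Qp_in_iff_limit using converges_const[of 1] by (intro exI[of _ "\<lambda>_. 1"]) simp
  fix x y assume "x \<in> Qp_in v" "y \<in> Qp_in v"
  then obtain X Y where X: "converges (\<lambda>n. of_rat (X n)) x" and Y: "converges (\<lambda>n. of_rat (Y n)) y"
    by (auto simp: Qp_in_iff_limit)
  show "x + y \<in> Qp_in v" unfolding Qp_in_iff_limit using converges_add[OF X Y]
    by (intro exI[of _ "\<lambda>n. X n + Y n"]) (simp add: of_rat_add)
  show "x * y \<in> Qp_in v" unfolding Qp_in_iff_limit using converges_mult[OF X Y]
    by (intro exI[of _ "\<lambda>n. X n * Y n"]) (simp add: of_rat_mult)
  show "x - y \<in> Qp_in v" unfolding Qp_in_iff_limit using converges_add[OF X converges_mult_left[OF Y, of "-1"]]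
    by (intro exI[of _ "\<lambda>n. X n - Y n"]) (simp add: of_rat_diff)
  show "inverse x \<in> Qp_in v"
  proof (cases "x = 0")
    case True
    then show ?thesis using \<open>x \<in> Qp_in v\<close> by simp
  next
    case False
    then show ?thesis unfolding Qp_in_iff_limit using converges_inverse[OF X]
      by (intro exI[of _ "\<lambda>n. inverse (X n)"]) (simp add: of_rat_inverse)
  qed
qed

lemma of_rat_in_Qp: "of_rat q \<in> Qp_in v"
  by (auto simp: Qp_in_def intro!: exI[of _ q])

lemma vclosed_Qp: "vclosed (Qp_in v)"
  unfolding vclosed_def
proof (intro allI impI)
  fix x assume x: "\<forall>M. \<exists>a\<in>Qp_in v. ereal M \<le> v (x - a)"
  show "x \<in> Qp_in v"
    unfolding Qp_in_def
  proof (intro CollectI allI)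
    fix M :: real
    obtain a where a: "a \<in> Qp_in v" "ereal M \<le> v (x - a)" using x by blast
    obtain q where q: "ereal M \<le> v (a - of_rat q)" using a by (auto simp: Qp_in_def)
    have "ereal M \<le> v (x - a + (a - of_rat q))" using a(2) q by (rule v_add_ge)
    then show "\<exists>q. ereal M \<le> v (x - of_rat q)" by auto
  qed
qed

lemma Id_on_Qp_field_graph: "field_graph (Id_on (Qp_in v))"
  using subfieldD(1,3,4,5)[OF subfield_Qp] subfieldD(6)[OF subfield_Qp subfieldD(1)[OF subfield_Qp]]
  unfolding field_graph_def iso_graph_def by (auto simp: Id_on_def divide_inverse)

text \<open>Apply \<open>algebraic_extension\<close> to the identity of Q_p: elements with the same
  minimal relation give equal values to all rational polynomials.\<close>

theorem conjugate_over_Qp: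
  assumes n: "n > 0" and c: "\<And>j. c j \<in> Qp_in v" "\<alpha> ^ n = (\<Sum>j<n. c j * \<alpha> ^ j)" "\<alpha>' ^ n = (\<Sum>j<n. c j * \<alpha>' ^ j)"
    and indep: "\<And>c. (\<And>j. c j \<in> Qp_in v) \<Longrightarrow> (\<Sum>j<n. c j * \<alpha> ^ j) = 0 \<Longrightarrow> \<forall>j<n. c j = 0"
  shows "\<exists>\<sigma>\<in>Gal_p v. \<sigma> \<alpha> = \<alpha>'"
proof (rule Gal_p_transitive)
  fix f :: "rat poly"
  let ?R = "Id_on (Qp_in v)"
  show "v (poly (map_poly of_rat f) \<alpha>) = v (poly (map_poly of_rat f) \<alpha>')"
  proof (rule algebraic_extension[OF Id_on_Qp_field_graph _ n])
    show "(\<alpha> ^ n, \<alpha>' ^ n) \<in> span_pairs ?R n \<alpha> \<alpha>'"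
      unfolding span_pairs_iff using c by blast
    show "rel_poly ?R (map_poly of_rat f) (map_poly of_rat f)"
      by (auto simp: rel_poly_def coeff_map_poly of_rat_in_Qp)
  qed (use indep vclosed_Qp in auto)
qed

lemma v_Qp_int:
  assumes "x \<in> Qp_in v" "x \<noteq> 0"
  shows "\<exists>k::int. v x = ereal (of_int k)"
proof -
  obtain X where X: "converges (\<lambda>n. of_rat (X n)) x" using assms Qp_in_iff_limit by blast
  obtain N where N: "\<forall>n\<ge>N. v (of_rat (X n)) = v x" using converges_v[OF X assms(2)] by blast
  then have "v (of_rat (X N)) = v x" by simp
  moreover from this have "X N \<noteq> 0" using assms(2) v_infD by (metis of_rat_0 v_zero)
  ultimately show ?thesis using v_of_rat_int by metis
qed

text \<open>Each polynomial value z at \<alpha> satisfies an equation of degree at most n over Q_p,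
  because its powers lie in an n-dimensional space. Its Newton slope has a denominator at most n,
  which divides n!; so n! serves as the bound.\<close>

lemma alg_over_Qp_in_Cp_br:
  assumes "alg_over (Qp_in v) \<alpha>"
  shows "\<alpha> \<in> Cp_br v"
proof -
  obtain f where f: "f \<noteq> 0" "\<And>i. coeff f i \<in> Qp_in v" "poly f \<alpha> = 0"
    using assms by (auto simp: alg_over_def)
  obtain n c where n: "n > 0" and c: "\<And>j. c j \<in> Qp_in v" "\<alpha> ^ n = (\<Sum>j<n. c j * \<alpha> ^ j)"
    using minimal_relation[OF subfield_Qp f] by blast
  let ?R = "Id_on (Qp_in v)"
  have iso: "iso_graph ?R" using Id_on_Qp_field_graph by (simp add: field_graph_def)
  have top: "(\<alpha> ^ n, \<alpha> ^ n) \<in> span_pairs ?R n \<alpha> \<alpha>"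
    unfolding span_pairs_iff using c by blast
  have val: "\<exists>k::int. ereal (real (fact n)) * v z = ereal (of_int k)"
    if z: "z = poly P \<alpha>" "\<And>i. coeff P i \<in> Qp_in v" "z \<noteq> 0" for z P
  proof -
    have "(z, z) \<in> adjoin ?R \<alpha> \<alpha>" unfolding adjoin_def rel_poly_def using z by blast
    moreover have "(1, 1) \<in> adjoin ?R \<alpha> \<alpha>" using adjoin_closed(1)[OF iso] iso_graphD(1)[OF iso] by blast
    ultimately have "(z ^ i, z ^ i) \<in> adjoin ?R \<alpha> \<alpha>" for i
      by (induction i) (auto intro: adjoin_closed(5)[OF iso])
    then have "\<forall>i. (z ^ i, z ^ i) \<in> span_pairs ?R n \<alpha> \<alpha>"
      using adjoin_subset_span_pairs[OF iso n top] by blast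
    then have "\<forall>i. \<exists>c. (\<forall>j. c j \<in> Qp_in v) \<and> z ^ i = (\<Sum>j<n. c j * \<alpha> ^ j)"
      unfolding span_pairs_iff Id_on_iff by blast
    then obtain M where M: "\<And>i j. M i j \<in> Qp_in v" "\<And>i. z ^ i = (\<Sum>j<n. M i j * \<alpha> ^ j)" by metis
    have "\<exists>l. (\<forall>i. l i \<in> Qp_in v) \<and> (\<exists>i\<in>{..n}. l i \<noteq> 0) \<and> (\<forall>j\<in>{..<n}. (\<Sum>i\<in>{..n}. l i * M i j) = 0)"
      by (rule linear_dependence[OF _ _ _ subfield_Qp]) (use M in auto)
    then obtain l i0 where l: "\<And>i. l i \<in> Qp_in v" "i0 \<le> n" "l i0 \<noteq> 0" "\<And>j. j < n \<Longrightarrow> (\<Sum>i\<le>n. l i * M i j) = 0"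
      by auto
    have "(\<Sum>i\<le>n. l i * z ^ i) = (\<Sum>i\<le>n. \<Sum>j<n. l i * M i j * \<alpha> ^ j)"
      by (simp only: M(2) sum_distrib_left mult.assoc)
    also have "\<dots> = (\<Sum>j<n. (\<Sum>i\<le>n. l i * M i j) * \<alpha> ^ j)"
      by (subst sum.swap) (simp only: sum_distrib_right)
    also have "\<dots> = 0" using l(4) by simp
    finally obtain i j where ij: "i < j" "j \<le> n" "l i \<noteq> 0" "l j \<noteq> 0" "v (l i) - v (l j) = ereal (real (j - i)) * v z"
      using v_root_of_polynomial[where a = l, OF _ l(2,3) z(3)] by blast
    obtain a b :: int where "v (l i) = ereal a" "v (l j) = ereal b" using v_Qp_int l(1) ij by meson
    moreover obtain r where r: "v z = ereal r" using z(3) by (rule v_realE)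
    ultimately have ab: "of_int (a - b) = real (j - i) * r" using ij by simp
    have "(j - i) dvd fact n" using ij by (intro dvd_fact) auto
    then obtain q where q: "fact n = (j - i) * q" by (auto elim: dvdE)
    have "real (fact n) * r = of_int (int q * (a - b))"
      unfolding q of_nat_mult of_int_mult ab by simp
    then have "ereal (real (fact n)) * v z = ereal (of_int (int q * (a - b)))" using r by simp
    then show ?thesis by blast
  qed
  show ?thesis
    unfolding Cp_br_def
  proof (intro CollectI exI[of _ "fact n :: nat"] conjI ballI impI)
    fix y assume y: "y \<in> Qp_adj v \<alpha>" "y \<noteq> 0"
    then obtain P Q where PQ: "\<And>i. coeff P i \<in> Qp_in v" "\<And>i. coeff Q i \<in> Qp_in v" "poly Q \<alpha> \<noteq> 0" "y = poly P \<alpha> / poly Q \<alpha>"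
      unfolding Qp_adj_def by blast
    then have "poly P \<alpha> \<noteq> 0" using y by auto
    obtain k where k: "ereal (real (fact n)) * v (poly P \<alpha>) = ereal (of_int k)" using val[OF refl PQ(1) \<open>poly P \<alpha> \<noteq> 0\<close>] by blast
    obtain l where l: "ereal (real (fact n)) * v (poly Q \<alpha>) = ereal (of_int l)" using val[OF refl PQ(2,3)] by blast
    obtain r s where "v (poly P \<alpha>) = ereal r" "v (poly Q \<alpha>) = ereal s" using v_realE PQ(3) \<open>poly P \<alpha> \<noteq> 0\<close> by meson
    then show "\<exists>k::int. ereal (real (fact n)) * v y = ereal (of_int k)"
      using k l PQ by (intro exI[of _ "k - l"]) (simp add: v_divide right_diff_distrib)
  qed simp
qed

section \<open>The rings of the theorem are discrete valuation rings\<close>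

lemma Cp_br_discrete:
  assumes "\<alpha> \<in> Cp_br v"
  obtains e :: nat where "e > 0"
    "\<And>f::rat poly. poly (map_poly of_rat f) \<alpha> \<noteq> 0 \<Longrightarrow> \<exists>k::int. v (poly (map_poly of_rat f) \<alpha>) = ereal (of_int k / real e)"
proof -
  obtain e :: nat where e: "e > 0" "\<And>y. y \<in> Qp_adj v \<alpha> \<Longrightarrow> y \<noteq> 0 \<Longrightarrow> \<exists>k::int. ereal (real e) * v y = ereal (of_int k)"
    using assms unfolding Cp_br_def by blast
  show thesis
  proof (rule that[OF e(1)])
    fix f :: "rat poly" assume nz: "poly (map_poly of_rat f) \<alpha> \<noteq> 0"
    have "poly (map_poly of_rat f) \<alpha> \<in> Qp_adj v \<alpha>"
      unfolding Qp_adj_def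
      by (intro CollectI exI[of _ "map_poly of_rat f"] exI[of _ 1])
        (auto simp: coeff_map_poly of_rat_in_Qp coeff_1 subfieldD(1,2)[OF subfield_Qp])
    then obtain k :: int where "ereal (real e) * v (poly (map_poly of_rat f) \<alpha>) = ereal (of_int k)"
      using e(2) nz by blast
    moreover obtain r where "v (poly (map_poly of_rat f) \<alpha>) = ereal r" using nz by (rule v_realE)
    ultimately show "\<exists>k::int. v (poly (map_poly of_rat f) \<alpha>) = ereal (of_int k / real e)"
      using e(1) by (intro exI[of _ k]) (auto simp: field_simps)
  qed
qed

text \<open>The Taylor coefficients at \<alpha> are the divided derivatives f^(i)/i! evaluated
  there. Hence the discreteness given by \<open>Cp_br_discrete\<close> applies to each of
  them.\<close>

lemma coeff_shift_is_value:
  "\<exists>g::rat poly. coeff (pcompose (map_poly of_rat f) [:\<alpha>, 1:]) i = poly (map_poly of_rat g) (\<alpha>::'a)"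
proof (induction f arbitrary: i)
  case 0
  show ?case by (intro exI[of _ 0]) simp
next
  case (pCons a f)
  have "\<forall>i. \<exists>g::rat poly. coeff (pcompose (map_poly of_rat f) [:\<alpha>, 1:]) i = poly (map_poly of_rat g) \<alpha>"
    using pCons.IH by blast
  then obtain G :: "nat \<Rightarrow> rat poly" where
    G: "\<And>i. coeff (pcompose (map_poly of_rat f) [:\<alpha>, 1:]) i = poly (map_poly of_rat (G i)) \<alpha>" by metis
  have eq: "pcompose (map_poly of_rat (pCons a f)) [:\<alpha>, 1:] =
      [:of_rat a:] + [:\<alpha>, 1:] * pcompose (map_poly of_rat f) [:\<alpha>, 1:]"
    using pCons.hyps by (auto simp: map_poly_pCons pcompose_pCons)
  show ?case
  proof (cases i)
    case 0
    then show ?thesis unfolding eq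
      by (intro exI[of _ "pCons a (G 0)"]) (simp add: map_poly_pCons flip: G)
  next
    case (Suc j)
    then show ?thesis unfolding eq
      by (intro exI[of _ "pCons 0 (G i) + G j"])
        (simp add: map_poly_of_rat_add map_poly_pCons G mult.commute)
  qed
qed

lemma vpoly_discrete:
  assumes \<alpha>: "\<alpha> \<in> Cp_br v" and "\<delta> = None \<Longrightarrow> \<not> algebraic \<alpha>"
  shows "\<exists>e>0. \<forall>f. f \<noteq> 0 \<longrightarrow> (\<exists>k::int. vpoly v \<alpha> \<delta> f = ereal (of_int k / real e))"
proof -
  obtain e :: nat where e: "e > 0"
    "\<And>f::rat poly. poly (map_poly of_rat f) \<alpha> \<noteq> 0 \<Longrightarrow> \<exists>k::int. v (poly (map_poly of_rat f) \<alpha>) = ereal (of_int k / real e)"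
    using Cp_br_discrete[OF \<alpha>] by metis
  show ?thesis
  proof (cases \<delta>)
    case None
    then have "poly (map_poly of_rat f) \<alpha> \<noteq> 0" if "f \<noteq> 0" for f :: "rat poly"
      using assms(2) that algebraic_iff_rat_poly by blast
    then show ?thesis using e None by (intro exI[of _ e]) (auto simp: vpoly_def)
  next
    case (Some d)
    obtain a b :: int where ab: "b > 0" "d = of_int a / of_int b" using of_rat_quotient by blast
    \<comment> \<open>The denominator e comes from the Taylor coefficients, the denominator b from
      the multiples of d.\<close>
    have "\<exists>k::int. vpoly v \<alpha> \<delta> f = ereal (of_int k / real (e * nat b))" if "f \<noteq> 0" for f
    proof -
      let ?g = "pcompose (map_poly of_rat f) [:\<alpha>, 1:]"
      obtain i where i: "vpoly v \<alpha> \<delta> f = v (coeff ?g i) + ereal (real i * of_rat d)"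
        using gauss_attained[of "of_rat d" ?g] Some by (auto simp: vpoly_eq_vK vK_def)
      obtain h :: "rat poly" where h: "coeff ?g i = poly (map_poly of_rat h) \<alpha>" using coeff_shift_is_value by blast
      have "vpoly v \<alpha> \<delta> f \<noteq> \<infinity>"
        using vK_Some_finite[of "map_poly of_rat f"] that Some by (auto simp: vpoly_eq_vK)
      then have "poly (map_poly of_rat h) \<alpha> \<noteq> 0" using i h by auto
      then obtain k :: int where "v (coeff ?g i) = ereal (of_int k / real e)" using e(2) h by metis
      then show ?thesis using i ab e(1)
        by (intro exI[of _ "k * b + int i * a * int e"]) (auto simp: field_simps of_rat_divide)
    qed
    then show ?thesis using e(1) ab by (intro exI[of _ "e * nat b"]) auto
  qed
qed

theorem Zring_is_DVR:
  assumes "\<alpha> \<in> Cp_br v" "admissible v \<alpha> \<delta>"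
  shows "Zring v \<alpha> \<delta> \<in> W_p p"
proof -
  have None: "\<delta> = None \<Longrightarrow> \<not> algebraic \<alpha>" using assms by (simp add: admissible_def)
  obtain e where "e > 0" "\<And>f. f \<noteq> 0 \<Longrightarrow> \<exists>k::int. vpoly v \<alpha> \<delta> f = ereal (of_int k / real e)"
    using vpoly_discrete[OF assms(1) None] by blast
  then show ?thesis using Zring_in_W_p[OF domval_vpoly[OF None]] by blast
qed

section \<open>Equality of the rings\<close>

text \<open>Horner's scheme: the precision M - B for the quotient by X makes up for a lower bound B
  of the value of X. One approximation serves both valuations, so that they can be compared through
  it.\<close>

lemma approximate_by_rational_poly:
  assumes u1: "pval u1" "\<And>c. u1 [:c:] = v c" and u2: "pval u2" "\<And>c. u2 [:c:] = v c"
    and P: "\<And>i. coeff P i \<in> Qp_in v"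
  shows "\<exists>f. ereal M \<le> u1 (P - map_poly of_rat f) \<and> ereal M \<le> u2 (P - map_poly of_rat f)"
  using P
proof (induction P arbitrary: M)
  case 0
  interpret u1: pval u1 by fact
  interpret u2: pval u2 by fact
  show ?case by (intro exI[of _ 0]) simp
next
  case (pCons a P)
  interpret u1: pval u1 by fact
  interpret u2: pval u2 by fact
  have "\<exists>B. ereal B \<le> x" if "x \<noteq> -\<infinity>" for x :: ereal using that by (cases x) auto
  then obtain B1 B2 where "ereal B1 \<le> u1 [:0, 1:]" "ereal B2 \<le> u2 [:0, 1:]"
    using u1.v_not_MInf u2.v_not_MInf by meson
  then obtain B where B: "ereal B \<le> u1 [:0, 1:]" "ereal B \<le> u2 [:0, 1:]"
    by (meson ereal_less_eq(3) linear order_trans)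
  have "coeff P i \<in> Qp_in v" for i using pCons.prems[of "Suc i"] by simp
  then obtain f where f: "ereal (M - B) \<le> u1 (P - map_poly of_rat f)" "ereal (M - B) \<le> u2 (P - map_poly of_rat f)"
    using pCons.IH by blast
  obtain q where q: "ereal M \<le> v (a - of_rat q)" using pCons.prems[of 0] by (auto simp: Qp_in_def)
  have "map_poly of_rat (pCons q f) = pCons (of_rat q) (map_poly of_rat f :: 'a poly)"
    by (intro poly_eqI) (auto simp: coeff_map_poly coeff_pCons split: nat.splits)
  then have eq: "pCons a P - map_poly of_rat (pCons q f) = [:a - of_rat q:] + [:0, 1:] * (P - map_poly of_rat f)"
    by simp
  have step: "ereal M \<le> x + y" if "ereal B \<le> x" "ereal (M - B) \<le> y" for x y
    using add_mono[OF that] by simp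
  have "ereal M \<le> u1 [:a - of_rat q:]" "ereal M \<le> u2 [:a - of_rat q:]" using q u1(2) u2(2) by simp_all
  moreover have "ereal M \<le> u1 ([:0, 1:] * (P - map_poly of_rat f))" "ereal M \<le> u2 ([:0, 1:] * (P - map_poly of_rat f))"
    unfolding u1.v_mult u2.v_mult using step B f by blast+
  ultimately show ?case
    by (intro exI[of _ "pCons q f"]) (simp only: eq u1.v_add_ge u2.v_add_ge simp_thms)
qed

text \<open>The minimal polynomial over Q_p does not have rational coefficients, so equality on Q[X]
  must be extended. If w1 P < w2 P, a close rational polynomial has value w1 P for w1 and a larger
  one for w2.\<close>

lemma poly_valuation_eq_Qp:
  assumes u1: "pval u1" "\<And>c. u1 [:c:] = v c" and u2: "pval u2" "\<And>c. u2 [:c:] = v c"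
    and P: "\<And>i. coeff P i \<in> Qp_in v"
    and eq: "\<And>f::rat poly. u1 (map_poly of_rat f) = u2 (map_poly of_rat f)"
  shows "u1 P = u2 P"
proof -
  have "\<not> w1 P < w2 P" if w1: "pval w1" "\<And>c. w1 [:c:] = v c" and w2: "pval w2" "\<And>c. w2 [:c:] = v c"
      and eq: "\<And>f::rat poly. w1 (map_poly of_rat f) = w2 (map_poly of_rat f)" for w1 w2
  proof
    interpret w1: pval w1 by fact
    interpret w2: pval w2 by fact
    assume less: "w1 P < w2 P"
    then obtain r where r: "w1 P = ereal r" using w1.v_not_MInf[of P] by (cases "w1 P") auto
    obtain f where f: "ereal (r + 1) \<le> w1 (P - map_poly of_rat f)" "ereal (r + 1) \<le> w2 (P - map_poly of_rat f)"
      using approximate_by_rational_poly[OF w1 w2 P] by blast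
    have r1: "ereal r < ereal (r + 1)" by simp
    have "ereal r < w1 (map_poly of_rat f - P)" using f(1) r1 w1.v_diff_commute less_le_trans by metis
    then have "w1 (map_poly of_rat f) = ereal r" using w1.v_eq_if_close[of P "map_poly of_rat f"] r by simp
    moreover have "ereal r < w2 (P - map_poly of_rat f)" using f(2) r1 less_le_trans by blast
    then have "ereal r < w2 (P - (P - map_poly of_rat f))"
      by (rule w2.v_diff_gt[rotated]) (use less r in simp)
    ultimately show False using eq[of f] by simp
  qed
  from this[OF u1 u2 eq] this[OF u2 u1 eq[symmetric]] show ?thesis by (simp add: not_less_iff_gr_or_eq)
qed

lemma Gal_p_hom:
  assumes "\<sigma> \<in> Gal_p v"
  shows "\<sigma> (x + y) = \<sigma> x + \<sigma> y" "\<sigma> (x * y) = \<sigma> x * \<sigma> y" "x \<in> Qp_in v \<Longrightarrow> \<sigma> x = x" "\<sigma> 0 = 0" "\<sigma> 1 = 1"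
    "\<sigma> (x - y) = \<sigma> x - \<sigma> y"
proof -
  show 1: "\<sigma> (x + y) = \<sigma> x + \<sigma> y" "\<sigma> (x * y) = \<sigma> x * \<sigma> y" "x \<in> Qp_in v \<Longrightarrow> \<sigma> x = x" for x y
    using assms by (auto simp: Gal_p_def)
  show "\<sigma> 0 = 0" "\<sigma> 1 = 1" using 1(3) subfieldD(1,2)[OF subfield_Qp] by auto
  show "\<sigma> (x - y) = \<sigma> x - \<sigma> y" using 1(1)[of "x - y" y] by simp
qed

lemma vK_Gal:
  assumes \<sigma>: "\<sigma> \<in> Gal_p v" and P: "\<And>i. coeff P i \<in> Qp_in v"
  shows "vK v (\<sigma> \<alpha>) \<delta> P = vK v \<alpha> \<delta> P"
proof -
  note hom = Gal_p_hom[OF \<sigma>]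
  have eval: "poly P (\<sigma> \<alpha>) = \<sigma> (poly P \<alpha>)" if P: "\<And>i. coeff P i \<in> Qp_in v" for P
    using P
  proof (induction P)
    case (pCons a P)
    have "coeff P i \<in> Qp_in v" "a \<in> Qp_in v" for i using pCons.prems[of "Suc i"] pCons.prems[of 0] by auto
    then show ?case using pCons.IH hom by simp
  qed (simp add: hom)
  have co: "coeff (pcompose P [:\<sigma> \<alpha>, 1:]) i = \<sigma> (coeff (pcompose P [:\<alpha>, 1:]) i)" for i
    using P
  proof (induction P arbitrary: i)
    case (pCons a P)
    have "coeff P i \<in> Qp_in v" "a \<in> Qp_in v" for i using pCons.prems[of "Suc i"] pCons.prems[of 0] by auto
    then show ?case using pCons.IH hom eval[of P] by (cases i) (auto simp: pcompose_pCons)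
  qed (simp add: hom)
  have "gauss v d (pcompose P [:\<sigma> \<alpha>, 1:]) = gauss v d (pcompose P [:\<alpha>, 1:])" for d
  proof (rule antisym; rule gauss_ge)
    fix i
    show "gauss v d (pcompose P [:\<sigma> \<alpha>, 1:]) \<le> v (coeff (pcompose P [:\<alpha>, 1:]) i) + ereal (real i * d)"
      using gauss_le[of d "pcompose P [:\<sigma> \<alpha>, 1:]" i] Gal_p_isometric[OF \<sigma>] by (simp add: co)
    show "gauss v d (pcompose P [:\<alpha>, 1:]) \<le> v (coeff (pcompose P [:\<sigma> \<alpha>, 1:]) i) + ereal (real i * d)"
      using gauss_le[of d "pcompose P [:\<alpha>, 1:]" i] Gal_p_isometric[OF \<sigma>] by (simp add: co)
  qed
  then show ?thesis using eval[OF P] Gal_p_isometric[OF \<sigma>] by (auto simp: vK_def split: option.split)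
qed

lemma vpoly_Gal: "\<sigma> \<in> Gal_p v \<Longrightarrow> vpoly v (\<sigma> \<alpha>) \<delta> f = vpoly v \<alpha> \<delta> f"
  unfolding vpoly_eq_vK by (rule vK_Gal) (auto simp: coeff_map_poly of_rat_in_Qp)

lemma min_v_eq:
  assumes "D \<le> v (\<beta> - \<alpha>)"
  shows "min D (v (\<beta> - r)) = min D (v (\<alpha> - r))"
proof -
  have "min D (v (\<alpha> - r)) \<le> v (\<beta> - r)" if "D \<le> v (\<beta> - \<alpha>)" for \<alpha> \<beta>
    using v_add[of "\<beta> - \<alpha>" "\<alpha> - r"] that by (auto simp: min_def split: if_splits intro: order_trans)
  from this[OF assms] this[of \<alpha> \<beta>] assms v_diff_commute[of \<alpha> \<beta>] show ?thesis
    by (auto simp: min_def split: if_splits)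
qed

lemma vK_ball:
  assumes "ext_val \<delta> \<le> v (\<beta> - \<alpha>)"
  shows "vK v \<beta> \<delta> P = vK v \<alpha> \<delta> P"
  by (rule poly_valuation_eq) (use min_v_eq[OF assms] in \<open>auto simp: vK_linear pval.v_mult[OF pval_vK]\<close>)

lemma ext_val_inj: "ext_val \<delta> = ext_val \<epsilon> \<longleftrightarrow> \<delta> = \<epsilon>"
  by (auto simp: ext_val_def split: option.splits)

text \<open>The radius is determined because every rational is a value: moving the centre by an
  element of value exactly \<delta> stays in the larger ball and leaves the smaller one.\<close>

lemma ball_p_eq_iff: "ball_p v \<beta> \<epsilon> = ball_p v \<alpha> \<delta> \<longleftrightarrow> \<delta> = \<epsilon> \<and> ext_val \<delta> \<le> v (\<beta> - \<alpha>)"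
proof
  assume eq: "ball_p v \<beta> \<epsilon> = ball_p v \<alpha> \<delta>"
  have le: "\<not> ext_val \<delta> < ext_val \<epsilon>" if eq: "ball_p v \<beta> \<epsilon> = ball_p v \<alpha> \<delta>" for \<alpha> \<beta> \<delta> \<epsilon>
  proof
    assume less: "ext_val \<delta> < ext_val \<epsilon>"
    then obtain d where d: "\<delta> = Some d" by (cases \<delta>) (auto simp: ext_val_def)
    obtain c where c: "v c = ereal (of_rat d)" using ex_v_of_rat by blast
    have "\<beta> \<in> ball_p v \<beta> \<epsilon>" by (simp add: ball_p_def)
    then have "\<beta> \<in> ball_p v \<alpha> \<delta>" using eq by simp
    then have "ext_val \<delta> \<le> v (\<beta> - \<alpha> + c)" using c d by (intro v_add_ge) (auto simp: ball_p_def ext_val_def)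
    then have "\<beta> + c \<in> ball_p v \<alpha> \<delta>" by (simp add: ball_p_def algebra_simps)
    then have "\<beta> + c \<in> ball_p v \<beta> \<epsilon>" using eq by simp
    then show False using less c d by (simp add: ball_p_def ext_val_def)
  qed
  then have "ext_val \<delta> = ext_val \<epsilon>" using le[OF eq] le[OF eq[symmetric]] by (simp add: not_less)
  moreover have "\<beta> \<in> ball_p v \<beta> \<epsilon>" by (simp add: ball_p_def)
  then have "\<beta> \<in> ball_p v \<alpha> \<delta>" using eq by simp
  ultimately show "\<delta> = \<epsilon> \<and> ext_val \<delta> \<le> v (\<beta> - \<alpha>)" by (simp add: ext_val_inj ball_p_def)
next
  assume *: "\<delta> = \<epsilon> \<and> ext_val \<delta> \<le> v (\<beta> - \<alpha>)"
  have "ext_val \<delta> \<le> v (x - \<beta>) \<longleftrightarrow> ext_val \<delta> \<le> v (x - \<alpha>)" for x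
    using min_v_eq[of "ext_val \<delta>" \<beta> \<alpha> x] * v_diff_commute[of x] by (auto simp: min_def split: if_splits)
  then show "ball_p v \<beta> \<epsilon> = ball_p v \<alpha> \<delta>" using * by (auto simp: ball_p_def)
qed

text \<open>Evaluate both valuations at the minimal polynomial of \<open>\<alpha>\<close>; if the conjugate of \<open>\<alpha>\<close> nearest to \<open>\<beta>\<close>
  were outside the ball, every root would contribute at most as much to the second valuation as to the
  first, and that conjugate strictly less.\<close>

lemma nearest_conjugate:
  assumes alg: "alg_over (Qp_in v) \<alpha>" and eq: "\<And>f. vpoly v \<alpha> (Some d) f = vpoly v \<beta> \<epsilon> f"
  shows "\<exists>\<sigma>\<in>Gal_p v. ext_val (Some d) \<le> v (\<beta> - \<sigma> \<alpha>) \<and> ext_val (Some d) \<le> ext_val \<epsilon>"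
proof -
  obtain f where f: "f \<noteq> 0" "\<And>i. coeff f i \<in> Qp_in v" "poly f \<alpha> = 0"
    using alg by (auto simp: alg_over_def)
  obtain n c where n: "n > 0" and c: "\<And>j. c j \<in> Qp_in v" "\<alpha> ^ n = (\<Sum>j<n. c j * \<alpha> ^ j)"
    and indep: "\<And>c. (\<And>j. c j \<in> Qp_in v) \<Longrightarrow> (\<Sum>j<n. c j * \<alpha> ^ j) = 0 \<Longrightarrow> \<forall>j<n. c j = 0"
    using minimal_relation[OF subfield_Qp f] by blast
  define g where "g = monom 1 n - (\<Sum>j<n. monom (c j) j)"
  have root: "poly g s = 0 \<longleftrightarrow> s ^ n = (\<Sum>j<n. c j * s ^ j)" for s
    by (simp add: g_def poly_sum poly_monom)
  have "coeff g n = 1" by (simp add: g_def coeff_sum)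
  then have g0: "g \<noteq> 0" by auto
  have g: "coeff g i \<in> Qp_in v" for i
    using c(1) unfolding g_def coeff_diff coeff_sum coeff_monom
    by (intro subfieldD(4,8)[OF subfield_Qp]) (auto simp: subfieldD(1,2)[OF subfield_Qp])
  have fin: "finite {s. poly g s = 0}" using g0 by (rule poly_roots_finite)
  have ne: "{s. poly g s = 0} \<noteq> {}" using c root by auto
  define m where "m = Max ((\<lambda>s. v (\<beta> - s)) ` {s. poly g s = 0})"
  have "m \<in> (\<lambda>s. v (\<beta> - s)) ` {s. poly g s = 0}"
    unfolding m_def by (rule Max_in) (use fin ne in auto)
  then obtain \<alpha>' where \<alpha>': "poly g \<alpha>' = 0" "m = v (\<beta> - \<alpha>')" by auto
  have max: "v (\<beta> - s) \<le> v (\<beta> - \<alpha>')" if "poly g s = 0" for s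
    unfolding \<alpha>'(2)[symmetric] m_def by (rule Max_ge) (use fin that in auto)
  obtain \<sigma> where \<sigma>: "\<sigma> \<in> Gal_p v" "\<sigma> \<alpha> = \<alpha>'"
    using conjugate_over_Qp[OF n c _ indep] \<alpha>'(1) root by blast
  have "ext_val (Some d) \<le> min (ext_val \<epsilon>) (v (\<beta> - \<alpha>'))"
  proof (rule ccontr)
    assume "\<not> ?thesis"
    then have less: "min (ext_val \<epsilon>) (v (\<beta> - \<alpha>')) < ext_val (Some d)" by (simp only: not_le)
    have "vK v \<beta> \<epsilon> g = vK v \<alpha> (Some d) g"
      by (rule poly_valuation_eq_Qp[OF pval_vK vK_const pval_vK vK_const g]) (simp add: eq flip: vpoly_eq_vK)
    moreover have "vK v \<alpha>' (Some d) g = vK v \<alpha> (Some d) g" using vK_Gal[OF \<sigma>(1) g, of \<alpha> "Some d"] \<sigma>(2) by simp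
    moreover have "vK v \<beta> \<epsilon> g < vK v \<alpha>' (Some d) g"
    proof (rule poly_valuation_less[of _ _ _ \<alpha>'])
      fix s assume s: "poly g s = 0"
      \<comment> \<open>Since \<alpha>' is nearest to \<beta>, the difference of \<beta> - s and
        \<beta> - \<alpha>' has value at least v (\<beta> - s).\<close>
      have le: "v (\<beta> - s) \<le> v (\<alpha>' - s)"
        using v_diff[of "\<beta> - s" "\<beta> - \<alpha>'"] max[OF s] by (simp add: min_def)
      have "min (ext_val \<epsilon>) (v (\<beta> - s)) \<le> min (ext_val \<epsilon>) (v (\<beta> - \<alpha>'))" using max[OF s] by (simp add: min.coboundedI2)
      then have "min (ext_val \<epsilon>) (v (\<beta> - s)) \<le> ext_val (Some d)" using less by (meson less_imp_le order_trans)
      moreover have "min (ext_val \<epsilon>) (v (\<beta> - s)) \<le> v (\<alpha>' - s)" using le by (simp add: min.coboundedI2)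
      ultimately show "vK v \<beta> \<epsilon> [:- s, 1:] \<le> vK v \<alpha>' (Some d) [:- s, 1:]" by (simp add: vK_linear)
    next
      show "vK v \<beta> \<epsilon> [:- \<alpha>', 1:] < vK v \<alpha>' (Some d) [:- \<alpha>', 1:]" using less by (simp add: vK_linear)
      show "\<bar>vK v \<beta> \<epsilon> g\<bar> \<noteq> \<infinity>"
        using calculation(1) vK_Some_finite[OF g0] pval.v_not_MInf[OF pval_vK] by (auto simp: abs_ereal.simps elim!: abs_ereal.elims)
    qed (use \<alpha>' in \<open>auto simp: pval.v_mult[OF pval_vK]\<close>)
    ultimately show False by simp
  qed
  then show ?thesis using \<sigma> by (intro bexI[of _ \<sigma>]) auto
qed

text \<open>A rational polynomial vanishing at an algebraic number inside the ball of radius d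
  around \<beta>, and closer than d, sees the cut-off at d.\<close>

lemma vpoly_None_neq_Some: "\<exists>f. vpoly v \<beta> (Some d) f \<noteq> vpoly v \<beta> None f"
proof -
  obtain \<gamma> where \<gamma>: "algebraic \<gamma>" "ereal (of_rat d + 1) \<le> v (\<beta> - \<gamma>)" using algebraic_dense by blast
  obtain f :: "rat poly" where f: "f \<noteq> 0" "poly (map_poly of_rat f) \<gamma> = 0"
    using \<gamma> algebraic_iff_rat_poly by blast
  have "ext_val (Some d) < ereal (of_rat d + 1)" by (simp add: ext_val_def)
  then have less: "ext_val (Some d) < v (\<beta> - \<gamma>)" using \<gamma>(2) by (rule less_le_trans)
  have "vK v \<beta> (Some d) (map_poly of_rat f) < vK v \<beta> None (map_poly of_rat f)"
  proof (rule poly_valuation_less[of _ _ _ \<gamma>])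
    show "vK v \<beta> (Some d) [:- \<gamma>, 1:] < vK v \<beta> None [:- \<gamma>, 1:]"
      using less by (auto simp: vK_linear ext_val_def min_def)
    show "\<bar>vK v \<beta> (Some d) (map_poly of_rat f)\<bar> \<noteq> \<infinity>"
      using vK_Some_finite[of "map_poly of_rat f"] f pval.v_not_MInf[OF pval_vK] by (auto simp: abs_ereal.simps elim!: abs_ereal.elims)
  qed (use f in \<open>auto simp: pval.v_mult[OF pval_vK] vK_linear ext_val_def\<close>)
  then show ?thesis unfolding vpoly_eq_vK by (metis less_irrefl)
qed

theorem Zring_eq_iff:
  assumes \<alpha>: "\<alpha> \<in> Cp_br v" "admissible v \<alpha> \<delta>" and \<beta>: "\<beta> \<in> Cp_br v" "admissible v \<beta> \<epsilon>"
  shows "(\<exists>\<sigma>\<in>Gal_p v. ball_p v \<beta> \<epsilon> = ball_p v (\<sigma> \<alpha>) \<delta>) \<longleftrightarrow> Zring v \<alpha> \<delta> = Zring v \<beta> \<epsilon>"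
proof
  assume "\<exists>\<sigma>\<in>Gal_p v. ball_p v \<beta> \<epsilon> = ball_p v (\<sigma> \<alpha>) \<delta>"
  then obtain \<sigma> where \<sigma>: "\<sigma> \<in> Gal_p v" "\<delta> = \<epsilon>" "ext_val \<delta> \<le> v (\<beta> - \<sigma> \<alpha>)" unfolding ball_p_eq_iff by blast
  then have "vpoly v \<beta> \<epsilon> f = vpoly v \<alpha> \<delta> f" for f
    using vK_ball[OF \<sigma>(3)] vpoly_Gal[OF \<sigma>(1)] by (simp add: vpoly_eq_vK)
  then show "Zring v \<alpha> \<delta> = Zring v \<beta> \<epsilon>" by (simp add: Zring_def)
next
  assume eq: "Zring v \<alpha> \<delta> = Zring v \<beta> \<epsilon>"
  have None: "\<delta> = None \<Longrightarrow> \<not> algebraic \<alpha>" "\<epsilon> = None \<Longrightarrow> \<not> algebraic \<beta>"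
    using \<alpha> \<beta> by (auto simp: admissible_def)
  obtain e where "e > 0" "\<And>f. f \<noteq> 0 \<Longrightarrow> \<exists>k::int. vpoly v \<alpha> \<delta> f = ereal (of_int k / real e)"
    using vpoly_discrete[OF \<alpha>(1) None(1)] by blast
  then have veq: "vpoly v \<alpha> \<delta> f = vpoly v \<beta> \<epsilon> f" for f
    using Zring_eq_imp_vpoly_eq[OF domval_vpoly[OF None(1)] domval_vpoly[OF None(2)] eq] by blast
  \<comment> \<open>A finite and an infinite radius cannot give the same valuation: a conjugate of
    the ball would contain \<beta>, so its valuation could be centred at \<beta>.\<close>
  have mixed: False if alg: "alg_over (Qp_in v) \<alpha>" and eq: "\<And>f. vpoly v \<alpha> (Some d) f = vpoly v \<beta> None f" for \<alpha> \<beta> d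
  proof -
    obtain \<sigma> where \<sigma>: "\<sigma> \<in> Gal_p v" "ext_val (Some d) \<le> v (\<beta> - \<sigma> \<alpha>)"
      using nearest_conjugate[OF alg eq] by blast
    then have "vpoly v \<beta> (Some d) f = vpoly v \<alpha> (Some d) f" for f
      using vK_ball[OF \<sigma>(2)] vpoly_Gal[OF \<sigma>(1)] by (simp add: vpoly_eq_vK)
    then show False using vpoly_None_neq_Some[of \<beta> d] eq by metis
  qed
  show "\<exists>\<sigma>\<in>Gal_p v. ball_p v \<beta> \<epsilon> = ball_p v (\<sigma> \<alpha>) \<delta>"
  proof (cases \<delta>)
    case dNone: None
    show ?thesis
    proof (cases \<epsilon>)
      case None
      then have "v (poly (map_poly of_rat f) \<alpha>) = v (poly (map_poly of_rat f) \<beta>)" for f :: "rat poly"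
        using veq[of f] dNone by (simp add: vpoly_def)
      then obtain \<sigma> where "\<sigma> \<in> Gal_p v" "\<sigma> \<alpha> = \<beta>" using Gal_p_transitive by blast
      then show ?thesis using None dNone by (intro bexI[of _ \<sigma>]) auto
    next
      case (Some e)
      then show ?thesis using mixed[of \<beta> e \<alpha>] \<beta> veq dNone by (auto simp: admissible_def)
    qed
  next
    case dSome: (Some d)
    then have alg: "alg_over (Qp_in v) \<alpha>" using \<alpha> by (auto simp: admissible_def)
    show ?thesis
    proof (cases \<epsilon>)
      case None
      then show ?thesis using mixed[OF alg] veq dSome by auto
    next
      case (Some e)
      then have alg': "alg_over (Qp_in v) \<beta>" using \<beta> by (auto simp: admissible_def)
      obtain \<sigma> where \<sigma>: "\<sigma> \<in> Gal_p v" "ext_val \<delta> \<le> v (\<beta> - \<sigma> \<alpha>)" "ext_val \<delta> \<le> ext_val \<epsilon>"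
        using nearest_conjugate[OF alg] veq unfolding dSome by blast
      \<comment> \<open>The roles of the two pairs are exchanged to compare the radii in the other
        direction; the conjugating automorphism is kept from the first application.\<close>
      have "ext_val \<epsilon> \<le> ext_val \<delta>"
        using nearest_conjugate[OF alg', of e \<alpha> \<delta>] veq unfolding Some by auto
      then show ?thesis using \<sigma> unfolding ball_p_eq_iff by (metis antisym ext_val_inj)
    qed
  qed
qed

end

section \<open>Valuation rings above a given local ring\<close>

text \<open>For a subring A this is A[x]; for an ideal I of A it is the extended ideal I
  A[x].\<close>

definition poly_values :: "'b::comm_ring_1 set \<Rightarrow> 'b \<Rightarrow> 'b set" where
  "poly_values A x = {poly F x |F. \<forall>i. coeff F i \<in> A}"

lemma subring_ofD:
  assumes "subring_of A"
  shows "0 \<in> A" "1 \<in> A" "x \<in> A \<Longrightarrow> y \<in> A \<Longrightarrow> x + y \<in> A" "x \<in> A \<Longrightarrow> y \<in> A \<Longrightarrow> x - y \<in> A"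
    "x \<in> A \<Longrightarrow> y \<in> A \<Longrightarrow> x * y \<in> A"
  using assms by (auto simp: subring_of_def)

lemma subring_of_power: "subring_of A \<Longrightarrow> x \<in> A \<Longrightarrow> x ^ n \<in> A"
  by (induction n) (auto simp: subring_of_def)

lemma subring_of_sum: "subring_of A \<Longrightarrow> (\<And>i. i \<in> S \<Longrightarrow> f i \<in> A) \<Longrightarrow> sum f S \<in> A"
  by (induction S rule: infinite_finite_induct) (auto simp: subring_of_def)

lemma ideal_of_sum: "ideal_of A I \<Longrightarrow> (\<And>i. i \<in> S \<Longrightarrow> f i \<in> I) \<Longrightarrow> sum f S \<in> I"
  by (induction S rule: infinite_finite_induct) (auto simp: ideal_of_def)

lemma poly_values_props:
  fixes A :: "'b::comm_ring_1 set"
  assumes A: "subring_of A" and I: "ideal_of A I"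
  shows "A \<subseteq> poly_values A x" "x \<in> poly_values A x" "I \<subseteq> poly_values I x" "subring_of (poly_values A x)"
    "ideal_of (poly_values A x) (poly_values I x)"
proof -
  note A' = subring_ofD[OF A] and I' = ideal_ofD[OF I]
  have memA: "t \<in> poly_values A x" if "\<And>i. coeff F i \<in> A" "t = poly F x" for F t
    using that unfolding poly_values_def by blast
  have memI: "t \<in> poly_values I x" if "\<And>i. coeff F i \<in> I" "t = poly F x" for F t
    using that unfolding poly_values_def by blast
  show sub: "A \<subseteq> poly_values A x"
  proof
    fix a assume "a \<in> A"
    then show "a \<in> poly_values A x" using A' by (intro memA[of "[:a:]"]) (auto simp: coeff_pCons split: nat.split)
  qed
  show "x \<in> poly_values A x" using A'
    by (intro memA[of "[:0, 1:]"]) (auto simp: coeff_pCons split: nat.split)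
  show "I \<subseteq> poly_values I x"
  proof
    fix a assume "a \<in> I"
    then show "a \<in> poly_values I x" using I' by (intro memI[of "[:a:]"]) (auto simp: coeff_pCons split: nat.split)
  qed
  show "subring_of (poly_values A x)"
    unfolding subring_of_def
  proof (intro conjI ballI)
    show "0 \<in> poly_values A x" "1 \<in> poly_values A x" using sub A' by blast+
    fix s t assume "s \<in> poly_values A x" "t \<in> poly_values A x"
    then obtain F G where FG: "\<And>i. coeff F i \<in> A" "s = poly F x" "\<And>i. coeff G i \<in> A" "t = poly G x"
      unfolding poly_values_def by blast
    show "s + t \<in> poly_values A x" using FG A' by (intro memA[of "F + G"]) auto
    show "s - t \<in> poly_values A x" using FG A' by (intro memA[of "F - G"]) auto
    show "s * t \<in> poly_values A x" using FG A'
      by (intro memA[of "F * G"]) (auto simp: coeff_mult intro!: subring_of_sum[OF A])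
  qed
  show "ideal_of (poly_values A x) (poly_values I x)"
    unfolding ideal_of_def
  proof (intro conjI ballI)
    show "poly_values I x \<subseteq> poly_values A x" using I'(1) unfolding poly_values_def by blast
    show "0 \<in> poly_values I x" using I'(2) by (intro memI[of 0]) auto
  next
    fix s t assume "s \<in> poly_values I x" "t \<in> poly_values I x"
    then obtain F G where FG: "\<And>i. coeff F i \<in> I" "s = poly F x" "\<And>i. coeff G i \<in> I" "t = poly G x"
      unfolding poly_values_def by blast
    show "s + t \<in> poly_values I x" using FG I' by (intro memI[of "F + G"]) auto
  next
    fix s t assume "s \<in> poly_values A x" "t \<in> poly_values I x"
    then obtain F G where FG: "\<And>i. coeff F i \<in> A" "s = poly F x" "\<And>i. coeff G i \<in> I" "t = poly G x"
      unfolding poly_values_def by blast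
    show "s * t \<in> poly_values I x" using FG I'
      by (intro memI[of "F * G"]) (auto simp: coeff_mult intro!: ideal_of_sum[OF I])
  qed
qed

text \<open>Chevalley's ordering of pairs of a ring and a proper ideal. Maximality is recorded for
  the ring, since the next theorem enlarges the ring.\<close>

lemma ex_maximal_pair:
  fixes A0 :: "'b::comm_ring_1 set"
  assumes "subring_of A0" "ideal_of A0 I0" "1 \<notin> I0"
  shows "\<exists>A I. subring_of A \<and> ideal_of A I \<and> 1 \<notin> I \<and> A0 \<subseteq> A \<and> I0 \<subseteq> I \<and>
    (\<forall>A' I'. subring_of A' \<longrightarrow> ideal_of A' I' \<longrightarrow> 1 \<notin> I' \<longrightarrow> A \<subseteq> A' \<longrightarrow> I \<subseteq> I' \<longrightarrow> A' = A)"
proof -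
  \<comment> \<open>a pair is coded as one subset of the disjoint sum, so that Zorn's lemma for inclusion applies\<close>
  define L where "L S = {x::'b. Inl x \<in> S}" for S :: "('b + 'b) set"
  define R where "R S = {x::'b. Inr x \<in> S}" for S :: "('b + 'b) set"
  define F where "F = {S. subring_of (L S) \<and> ideal_of (L S) (R S) \<and> 1 \<notin> R S \<and> A0 \<subseteq> L S \<and> I0 \<subseteq> R S}"
  have LR: "L (Inl ` A \<union> Inr ` I) = A" "R (Inl ` A \<union> Inr ` I) = I" for A I
    by (auto simp: L_def R_def)
  have "Inl ` A0 \<union> Inr ` I0 \<in> F" unfolding F_def using assms by (simp add: LR)
  moreover have "\<Union>C \<in> F" if C: "C \<noteq> {}" "subset.chain F C" for C
  proof -
    have CF: "C \<subseteq> F" and tot: "\<And>X Y. X \<in> C \<Longrightarrow> Y \<in> C \<Longrightarrow> X \<subseteq> Y \<or> Y \<subseteq> X"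
      using C(2) by (auto simp: subset.chain_def)
    then have X: "subring_of (L X)" "ideal_of (L X) (R X)" "1 \<notin> R X" "A0 \<subseteq> L X" "I0 \<subseteq> R X" if "X \<in> C" for X
      using that by (auto simp: F_def)
    have two: "\<exists>X\<in>C. s \<in> X \<and> t \<in> X" if "s \<in> \<Union>C" "t \<in> \<Union>C" for s t
      using that tot by blast
    have LU: "x \<in> L (\<Union>C) \<longleftrightarrow> Inl x \<in> \<Union>C" and RU: "x \<in> R (\<Union>C) \<longleftrightarrow> Inr x \<in> \<Union>C" for x
      by (auto simp: L_def R_def)
    obtain X0 where X0: "X0 \<in> C" using C(1) by blast
    have "subring_of (L (\<Union>C))"
      unfolding subring_of_def
    proof (intro conjI ballI)
      show "0 \<in> L (\<Union>C)" "1 \<in> L (\<Union>C)" using X0 subring_ofD(1,2)[OF X(1)[OF X0]] by (auto simp: L_def)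
      fix x y assume "x \<in> L (\<Union>C)" "y \<in> L (\<Union>C)"
      then obtain X where XC: "X \<in> C" "x \<in> L X" "y \<in> L X" unfolding LU using two unfolding L_def by blast
      then have "x + y \<in> L X" "x - y \<in> L X" "x * y \<in> L X" using subring_ofD(3-5)[OF X(1)] by auto
      then show "x + y \<in> L (\<Union>C)" "x - y \<in> L (\<Union>C)" "x * y \<in> L (\<Union>C)" using XC(1) unfolding L_def by auto
    qed
    moreover have "ideal_of (L (\<Union>C)) (R (\<Union>C))"
      unfolding ideal_of_def
    proof (intro conjI ballI)
      show "R (\<Union>C) \<subseteq> L (\<Union>C)" using ideal_ofD(1)[OF X(2)] unfolding L_def R_def by fastforce
      show "0 \<in> R (\<Union>C)" using X0 ideal_ofD(2)[OF X(2)[OF X0]] by (auto simp: R_def)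
    next
      fix x y assume "x \<in> R (\<Union>C)" "y \<in> R (\<Union>C)"
      then obtain X where XC: "X \<in> C" "x \<in> R X" "y \<in> R X" unfolding RU using two unfolding R_def by blast
      then have "x + y \<in> R X" using ideal_ofD(3)[OF X(2)] by auto
      then show "x + y \<in> R (\<Union>C)" using XC(1) unfolding R_def by auto
    next
      fix x y assume "x \<in> L (\<Union>C)" "y \<in> R (\<Union>C)"
      then obtain X where XC: "X \<in> C" "x \<in> L X" "y \<in> R X" unfolding LU RU using two unfolding L_def R_def by blast
      then have "x * y \<in> R X" using ideal_ofD(4)[OF X(2)] by auto
      then show "x * y \<in> R (\<Union>C)" using XC(1) unfolding R_def by auto
    qed
    moreover have "1 \<notin> R (\<Union>C)" using X(3) unfolding R_def by auto
    moreover have "A0 \<subseteq> L (\<Union>C)" "I0 \<subseteq> R (\<Union>C)" using X(4,5)[OF X0] X0 unfolding L_def R_def by auto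
    ultimately show ?thesis unfolding F_def by blast
  qed
  ultimately obtain M where M: "M \<in> F" "\<And>X. X \<in> F \<Longrightarrow> M \<subseteq> X \<Longrightarrow> X = M"
    using subset_Zorn_nonempty[of F] by (metis empty_iff)
  have "A' = L M" if *: "subring_of A'" "ideal_of A' I'" "1 \<notin> I'" "L M \<subseteq> A'" "R M \<subseteq> I'" for A' I'
  proof -
    have "Inl ` A' \<union> Inr ` I' \<in> F" unfolding F_def using * M(1) by (auto simp: LR F_def)
    moreover have "M \<subseteq> Inl ` A' \<union> Inr ` I'"
    proof
      fix z assume "z \<in> M"
      then show "z \<in> Inl ` A' \<union> Inr ` I'" using * by (cases z) (auto simp: L_def R_def)
    qed
    ultimately show ?thesis using M(2) LR by metis
  qed
  then show ?thesis using M(1) unfolding F_def by (intro exI[of _ "L M"] exI[of _ "R M"]) auto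
qed

text \<open>Chevalley's extension theorem. In a maximal pair, x lies in the ring unless the ideal
  becomes improper in A[x]; this cannot happen for both x and its inverse.\<close>

theorem ex_valuation_ring_above:
  fixes A0 :: "'b::field set"
  assumes "subring_of A0" "ideal_of A0 I0" "1 \<notin> I0"
  shows "\<exists>V. subring_of V \<and> A0 \<subseteq> V \<and> (\<forall>x. x \<in> V \<or> inverse x \<in> V) \<and> (\<forall>x\<in>I0. x \<noteq> 0 \<longrightarrow> inverse x \<notin> V)"
proof -
  obtain A I where AI: "subring_of A \<and> ideal_of A I \<and> 1 \<notin> I \<and> A0 \<subseteq> A \<and> I0 \<subseteq> I \<and>
    (\<forall>A' I'. subring_of A' \<longrightarrow> ideal_of A' I' \<longrightarrow> 1 \<notin> I' \<longrightarrow> A \<subseteq> A' \<longrightarrow> I \<subseteq> I' \<longrightarrow> A' = A)"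
    using ex_maximal_pair[OF assms] by (elim exE) (rule that)
  then have A: "subring_of A" and I: "ideal_of A I" and one: "1 \<notin> I" and sub: "A0 \<subseteq> A" "I0 \<subseteq> I"
    and max: "\<And>A' I'. subring_of A' \<Longrightarrow> ideal_of A' I' \<Longrightarrow> 1 \<notin> I' \<Longrightarrow> A \<subseteq> A' \<Longrightarrow> I \<subseteq> I' \<Longrightarrow> A' = A"
    by simp_all
  note A' = subring_ofD[OF A] and I' = ideal_ofD[OF I]
  have mem: "x \<in> A" if "1 \<notin> poly_values I x" for x
    using max[OF poly_values_props(4,5)[OF A I] that poly_values_props(1,3)[OF A I]]
      poly_values_props(2)[OF A I] by blast
  \<comment> \<open>A maximal pair is local. If adjoining the inverse of s made the ideal improper,
    clearing denominators would put a power of s into \<open>I\<close>, although s is congruent to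
    1.\<close>
  have unit: "inverse s \<in> A" if s: "1 - s \<in> I" for s
  proof (rule mem, rule notI)
    assume "1 \<in> poly_values I (inverse s)"
    then obtain F where F: "\<And>i. coeff F i \<in> I" "1 = poly F (inverse s)" unfolding poly_values_def by blast
    have "1 - (1 - s) \<in> A" using A'(2,4) s I'(1) by blast
    then have sA: "s \<in> A" by simp
    have s0: "s \<noteq> 0" using s one by auto
    have "s ^ degree F = (\<Sum>i\<le>degree F. coeff F i * (inverse s ^ i * s ^ degree F))"
      using arg_cong[OF F(2), of "\<lambda>t. t * s ^ degree F"]
      by (simp add: poly_altdef sum_distrib_right mult.assoc)
    also have "\<dots> = (\<Sum>i\<le>degree F. s ^ (degree F - i) * coeff F i)"
      using s0 by (intro sum.cong) (auto simp: power_diff field_simps)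
    also have "\<dots> \<in> I" using F(1) subring_of_power[OF A sA] by (intro ideal_of_sum[OF I] I'(4))
    finally have "s ^ degree F \<in> I" .
    moreover have "1 - s ^ k \<in> I" for k
    proof (induction k)
      case (Suc k)
      have "s * (1 - s ^ k) + (1 - s) \<in> I" using Suc s sA by (intro I'(3) I'(4))
      then show ?case by (simp add: algebra_simps)
    qed (use I' in simp)
    ultimately have "1 - s ^ degree F + s ^ degree F \<in> I" using I'(3) by blast
    then show False using one by simp
  qed
  \<comment> \<open>Descent on the total degree of two representations of 1, in powers of x and of
    its inverse: the longer one is shortened with the help of the other.\<close>
  have contra: False if "x \<noteq> 0" "\<And>i. coeff F i \<in> I" "\<And>i. coeff G i \<in> I" "poly F x = 1" "poly G (inverse x) = 1" for x F G
    using that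
  proof (induction "degree F + degree G" arbitrary: x F G rule: less_induct)
    case less
    have step: False if x: "x \<noteq> 0" and F: "\<And>i. coeff F i \<in> I" "poly F x = 1"
      and G: "\<And>i. coeff G i \<in> I" "poly G (inverse x) = 1" and le: "degree G \<le> degree F"
      and IH: "\<And>F'. degree F' < degree F \<Longrightarrow> (\<And>i. coeff F' i \<in> I) \<Longrightarrow> poly F' x = 1 \<Longrightarrow> False" for x F G
    proof -
      define n where "n = degree F"
      define m where "m = degree G"
      have "n > 0"
      proof (rule ccontr)
        assume "\<not> n > 0"
        then obtain a where "F = [:a:]" unfolding n_def using degree_eq_zeroE by blast
        then have "coeff F 0 = 1" using F(2) by simp
        then show False using F(1)[of 0] one by simp
      qed
      \<comment> \<open>Moving the constant term of \<open>G\<close> to the left leaves s,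
        invertible in \<open>A\<close> by \<open>unit\<close>. Multiplying by u x^n expresses x^n by
        lower powers with coefficients in \<open>I\<close>.\<close>
      define s where "s = 1 - coeff G 0"
      define u where "u = inverse s"
      have u: "u \<in> A" unfolding u_def s_def using G(1)[of 0] by (intro unit) simp
      have s0: "s \<noteq> 0" using G(1)[of 0] one by (auto simp: s_def)
      have "poly G (inverse x) = (\<Sum>i\<le>m. coeff G i * inverse x ^ i)" by (simp add: poly_altdef m_def)
      also have "\<dots> = coeff G 0 + (\<Sum>i=1..m. coeff G i * inverse x ^ i)"
        by (subst atMost_atLeast0, subst sum.atLeast_Suc_atMost) auto
      finally have "s = (\<Sum>i=1..m. coeff G i * inverse x ^ i)" using G(2)
        by (simp add: s_def diff_eq_eq add.commute)
      then have "x ^ n = (\<Sum>i=1..m. coeff G i * inverse x ^ i) * u * x ^ n" using s0 by (simp add: u_def)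
      also have "\<dots> = (\<Sum>i=1..m. u * coeff G i * (inverse x ^ i * x ^ n))"
        by (simp add: sum_distrib_left sum_distrib_right mult_ac)
      also have "\<dots> = (\<Sum>i=1..m. u * coeff G i * x ^ (n - i))"
        using x le by (intro sum.cong) (auto simp: n_def m_def power_diff field_simps)
      finally have xn: "x ^ n = (\<Sum>i=1..m. u * coeff G i * x ^ (n - i))" .
      \<comment> \<open>The leading term of \<open>F\<close> is replaced by that expression of x^n;
        the value at x stays 1 and the degree drops.\<close>
      define F' where "F' = F - monom (coeff F n) n + (\<Sum>i=1..m. monom (coeff F n * (u * coeff G i)) (n - i))"
      have "poly F' x = 1 - coeff F n * x ^ n + (\<Sum>i=1..m. coeff F n * (u * coeff G i) * x ^ (n - i))"
        using F(2) by (simp add: F'_def poly_monom poly_sum)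
      also have "(\<Sum>i=1..m. coeff F n * (u * coeff G i) * x ^ (n - i)) = coeff F n * x ^ n"
        unfolding xn by (simp add: sum_distrib_left mult.assoc)
      finally have "poly F' x = 1" by simp
      moreover have "coeff F' k \<in> I" for k
      proof -
        have "coeff F n * (u * coeff G i) \<in> I" for i
          using F(1) G(1) u I'(1) by (intro I'(4)) auto
        then have "(\<Sum>i=1..m. coeff (monom (coeff F n * (u * coeff G i)) (n - i)) k) \<in> I"
          using I'(2) by (intro ideal_of_sum[OF I]) auto
        moreover have "coeff F k - coeff (monom (coeff F n) n) k \<in> I"
          using F(1)[of k] I'(2) by auto
        ultimately show ?thesis unfolding F'_def using I'(3) by (simp add: coeff_sum)
      qed
      moreover have "degree F' < n"
      proof -
        have "coeff F' k = 0" if "k \<ge> n" for k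
        proof -
          have "coeff (monom (coeff F n * (u * coeff G i)) (n - i)) k = 0" if "i \<in> {1..m}" for i
            using that \<open>k \<ge> n\<close> le \<open>n > 0\<close> by auto
          then have "(\<Sum>i=1..m. coeff (monom (coeff F n * (u * coeff G i)) (n - i)) k) = 0" by simp
          moreover have "coeff (F - monom (coeff F n) n) k = 0"
            using \<open>k \<ge> n\<close> by (cases "k = n") (auto simp: coeff_eq_0 n_def)
          ultimately show ?thesis unfolding F'_def by (simp add: coeff_sum)
        qed
        then show ?thesis using \<open>n > 0\<close> by (metis leading_coeff_0_iff degree_0 not_le)
      qed
      ultimately show False using IH[of F'] by (simp add: n_def)
    qed
    show False
    proof (cases "degree G \<le> degree F")
      case True
      show ?thesis
      proof (rule step[OF less.prems(1,2,4,3,5) True])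
        fix F' assume "degree F' < degree F" "\<And>i. coeff F' i \<in> I" "poly F' x = 1"
        then show False using less.hyps[of F' G x] less.prems by auto
      qed
    next
      case False
      show ?thesis
      proof (rule step[of "inverse x" G F])
        fix F' assume "degree F' < degree G" "\<And>i. coeff F' i \<in> I" "poly F' (inverse x) = 1"
        then show False using less.hyps[of F F' x] less.prems by auto
      qed (use less.prems False in auto)
    qed
  qed
  have "x \<in> A \<or> inverse x \<in> A" for x
  proof (rule ccontr)
    assume not: "\<not> ?thesis"
    then have "x \<noteq> 0" using A' by auto
    have "1 \<in> poly_values I x" "1 \<in> poly_values I (inverse x)" using not mem by blast+
    then obtain F G where "\<And>i. coeff F i \<in> I" "1 = poly F x" "\<And>i. coeff G i \<in> I" "1 = poly G (inverse x)"
      unfolding poly_values_def by blast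
    then show False using contra[OF \<open>x \<noteq> 0\<close>] by metis
  qed
  moreover have "inverse x \<notin> A" if "x \<in> I" "x \<noteq> 0" for x
    using I'(4)[of "inverse x" x] that one by auto
  ultimately show ?thesis using A sub by blast
qed

section \<open>Extending a valuation of the rational function field\<close>

lemma fract_common_denominator:
  fixes y :: "'i \<Rightarrow> 'd::idom fract"
  assumes "finite S"
  shows "\<exists>d. d \<noteq> 0 \<and> (\<forall>s\<in>S. \<exists>f. y s = Fract f d)"
  using assms
proof (induction S rule: finite_induct)
  case (insert s S)
  then obtain d where d: "d \<noteq> 0" "\<forall>s\<in>S. \<exists>f. y s = Fract f d" by blast
  obtain a b where ab: "y s = Fract a b" "b \<noteq> 0" by (cases "y s") auto
  have "\<exists>f. y t = Fract f (b * d)" if t: "t \<in> insert s S" for t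
  proof (cases "t = s")
    case True
    then show ?thesis using ab d by (intro exI[of _ "a * d"]) (simp add: eq_fract)
  next
    case False
    then obtain f where "y t = Fract f d" using t d by auto
    then show ?thesis using ab d by (intro exI[of _ "b * f"]) (simp add: eq_fract)
  qed
  then show ?case using ab d by (intro exI[of _ "b * d"]) auto
qed (auto intro: exI[of _ 1])

context Cp
begin

definition emb :: "'a \<Rightarrow> 'a poly fract" where
  "emb c = Fract [:c:] 1"

text \<open>Extension of scalars from Q(X) to K(X); \<open>lift_Fract\<close> shows independence of
  the chosen representative.\<close>

definition lift :: "rat poly fract \<Rightarrow> 'a poly fract" where
  "lift z = (SOME y. \<exists>f g. g \<noteq> 0 \<and> z = Fract f g \<and> y = Fract (map_poly of_rat f) (map_poly of_rat g))"

lemma emb_simps [simp]: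
  "emb 0 = 0" "emb 1 = 1" "emb (a + b) = emb a + emb b" "emb (a * b) = emb a * emb b"
  "emb (- a) = - emb a" "emb (a - b) = emb a - emb b" "emb a = 0 \<longleftrightarrow> a = 0"
  by (simp_all add: emb_def Zero_fract_def One_fract_def pCons_one eq_fract mult.commute)

lemma emb_inverse: "emb (inverse a) = inverse (emb a)"
proof (cases "a = 0")
  case False
  then have "emb a * emb (inverse a) = 1" by (simp flip: emb_simps(4))
  then show ?thesis by (metis inverse_unique)
qed simp

lemma emb_divide: "emb (a / b) = emb a / emb b"
  by (simp add: divide_inverse emb_inverse)

lemma emb_sum: "emb (sum f S) = (\<Sum>s\<in>S. emb (f s))"
  by (induction S rule: infinite_finite_induct) auto

lemma emb_power: "emb (a ^ n) = emb a ^ n"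
  by (induction n) auto

lemma lift_Fract:
  assumes "g \<noteq> 0"
  shows "lift (Fract f g) = Fract (map_poly of_rat f) (map_poly of_rat g)"
proof -
  have "\<exists>y f' g'. g' \<noteq> 0 \<and> Fract f g = Fract f' g' \<and> y = Fract (map_poly of_rat f') (map_poly of_rat g' :: 'a poly)"
    using assms by blast
  then have "\<exists>f' g'. g' \<noteq> 0 \<and> Fract f g = Fract f' g' \<and> lift (Fract f g) = Fract (map_poly of_rat f') (map_poly of_rat g')"
    unfolding lift_def by (rule someI_ex)
  then obtain f' g' where *: "g' \<noteq> 0" "Fract f g = Fract f' g'"
    "lift (Fract f g) = Fract (map_poly of_rat f') (map_poly of_rat g')" by blast
  then have "f * g' = f' * g" using assms by (simp add: eq_fract)
  then have "map_poly of_rat f * map_poly of_rat g' = map_poly of_rat f' * (map_poly of_rat g :: 'a poly)"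
    by (metis map_poly_of_rat_mult)
  then show ?thesis using * assms by (simp add: eq_fract)
qed

lemma lift_simps [simp]:
  "lift 0 = 0" "lift 1 = 1" "lift (x + y) = lift x + lift y" "lift (x * y) = lift x * lift y"
  "lift (const_fract r) = emb (of_rat r)" "lift (- x) = - lift x" "lift (x - y) = lift x - lift y"
proof -
  have one: "map_poly of_rat 1 = (1 :: 'a poly)" by (simp add: one_pCons)
  show 1: "lift 0 = 0" "lift 1 = 1" "lift (const_fract r) = emb (of_rat r)"
    by (simp_all add: Zero_fract_def One_fract_def lift_Fract one const_fract_def emb_def)
  show 2: "lift (x + y) = lift x + lift y" "lift (x * y) = lift x * lift y" for x y
  proof -
    obtain a b where x: "x = Fract a b" "b \<noteq> 0" by (cases x) auto
    obtain c d where y: "y = Fract c d" "d \<noteq> 0" by (cases y) auto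
    show "lift (x + y) = lift x + lift y" "lift (x * y) = lift x * lift y"
      using x y by (simp_all add: lift_Fract map_poly_of_rat_add map_poly_of_rat_mult)
  qed
  show 3: "lift (- x) = - lift x" for x
    using 2(1)[of x "-x"] 1(1) by (simp add: eq_neg_iff_add_eq_0 add.commute)
  show "lift (x - y) = lift x - lift y" using 2(1)[of x "-y"] 3[of y] by simp
qed

lemma lift_inverse: "lift (inverse x) = inverse (lift x)"
proof (cases "x = 0")
  case False
  then have "lift x * lift (inverse x) = 1" by (simp flip: lift_simps(4))
  then show ?thesis by (metis inverse_unique)
qed simp

lemma lift_power: "lift (x ^ n) = lift x ^ n"
  by (induction n) auto

lemma v_p_mult_pos: "0 \<le> v y \<Longrightarrow> 0 < v (of_nat p * y)"
  by (cases "v y") (auto simp: v_mult one_ereal_def)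

text \<open>Additive functionals from the integers of the large field to the prime field: rather than with a
  basis of the residue field one works with a maximal additive subgroup missing \<open>1\<close>.\<close>

lemma ex_residue_functional:
  "\<exists>H. (\<forall>x\<in>H. \<forall>y\<in>H. x - y \<in> H) \<and> {x. 0 < v x} \<subseteq> H \<and> H \<subseteq> {x. 0 \<le> v x} \<and> 1 \<notin> H \<and>
    (\<forall>x. 0 \<le> v x \<longrightarrow> (\<exists>n::int. x - of_int n \<in> H))"
proof -
  define F where "F = {H. (\<forall>x\<in>H. \<forall>y\<in>H. x - y \<in> H) \<and> {x. 0 < v x} \<subseteq> H \<and> H \<subseteq> {x. 0 \<le> v x} \<and> 1 \<notin> H}"
  have "{x. 0 < v x} \<in> F" unfolding F_def by (auto intro: v_diff_gt less_imp_le)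
  moreover have "\<Union>C \<in> F" if C: "C \<noteq> {}" "subset.chain F C" for C
  proof -
    have CF: "C \<subseteq> F" and tot: "\<And>X Y. X \<in> C \<Longrightarrow> Y \<in> C \<Longrightarrow> X \<subseteq> Y \<or> Y \<subseteq> X"
      using C(2) by (auto simp: subset.chain_def)
    have "x - y \<in> \<Union>C" if xy: "x \<in> \<Union>C" "y \<in> \<Union>C" for x y
    proof -
      obtain X where X: "X \<in> C" "x \<in> X" "y \<in> X" using xy tot by blast
      then have "x - y \<in> X" using CF unfolding F_def by blast
      then show ?thesis using X by blast
    qed
    moreover have "{x. 0 < v x} \<subseteq> \<Union>C" "\<Union>C \<subseteq> {x. 0 \<le> v x}" "1 \<notin> \<Union>C"
      using C(1) CF unfolding F_def by blast+
    ultimately show ?thesis unfolding F_def by blast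
  qed
  ultimately obtain H where H: "H \<in> F" "\<And>X. X \<in> F \<Longrightarrow> H \<subseteq> X \<Longrightarrow> X = H"
    using subset_Zorn_nonempty[of F] by (metis empty_iff)
  then have sub: "\<And>x y. x \<in> H \<Longrightarrow> y \<in> H \<Longrightarrow> x - y \<in> H" and m: "{x. 0 < v x} \<subseteq> H"
    and O: "H \<subseteq> {x. 0 \<le> v x}" and one: "1 \<notin> H" by (auto simp: F_def)
  have zero: "0 \<in> H" using m by auto
  have neg: "- x \<in> H" if "x \<in> H" for x using sub[OF zero that] by simp
  have add: "x + y \<in> H" if "x \<in> H" "y \<in> H" for x y using sub[OF that(1) neg[OF that(2)]] by simp
  have nat: "of_nat n * x \<in> H" if "x \<in> H" for n x
    by (induction n) (use zero add that in \<open>auto simp: algebra_simps\<close>)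
  have int: "of_int n * x \<in> H" if "x \<in> H" for n x
    by (cases n) (use nat[OF that] neg in \<open>auto simp del: of_nat_Suc\<close>)
  have "\<exists>n::int. x - of_int n \<in> H" if x: "0 \<le> v x" for x
  proof (cases "x \<in> H")
    case True
    then show ?thesis by (intro exI[of _ 0]) simp
  next
    case False
    define H' where "H' = {h + of_int k * x |h k. h \<in> H}"
    have H': "h + of_int k * x \<in> H'" if "h \<in> H" for h k unfolding H'_def using that by blast
    have "x \<in> H'" using H'[OF zero, of 1] by simp
    have "H \<subseteq> H'" using H'[of _ 0] by auto
    \<comment> \<open>\<open>H'\<close> is generated by \<open>H\<close> and \<open>x\<close> and is
      strictly larger than \<open>H\<close>, so maximality leaves only this possibility.\<close>
    have "1 \<in> H'"
    proof (rule ccontr)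
      assume "1 \<notin> H'"
      moreover have "\<forall>s\<in>H'. \<forall>t\<in>H'. s - t \<in> H'"
      proof (intro ballI)
        fix s t assume "s \<in> H'" "t \<in> H'"
        then obtain h k h' k' where "s = h + of_int k * x" "t = h' + of_int k' * x" "h \<in> H" "h' \<in> H"
          unfolding H'_def by blast
        then show "s - t \<in> H'" using H'[OF sub, of h h' "k - k'"] by (simp add: algebra_simps)
      qed
      moreover have "H' \<subseteq> {x. 0 \<le> v x}"
        unfolding H'_def using O x v_of_int by (auto intro!: v_add_ge add_nonneg_nonneg simp: v_mult)
      ultimately have "H' = H" using \<open>H \<subseteq> H'\<close> m by (intro H(2)) (auto simp: F_def)
      then show False using \<open>x \<in> H'\<close> False by simp
    qed
    then obtain h k where hk: "1 = h + of_int k * x" "h \<in> H" unfolding H'_def by blast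
    have "\<not> int p dvd k"
    proof
      assume "int p dvd k"
      then obtain j where "k = int p * j" by (elim dvdE)
      then have eq: "of_int k * x = of_nat p * (of_int j * x)" by simp
      have "0 < v (of_int k * x)"
        unfolding eq by (rule v_p_mult_pos) (use x v_of_int in \<open>simp add: v_mult\<close>)
      then have "of_int k * x \<in> H" using m by blast
      then have "h + of_int k * x \<in> H" using add[OF hk(2)] by blast
      then show False using hk(1) one by simp
    qed
    then have "coprime (int p) k" using prime_p by (simp add: prime_imp_coprime)
    \<comment> \<open>Modulo p the integer b inverts k, so multiplying 1 = h + k x by b gives x
      congruent to b modulo \<open>H\<close>.\<close>
    then obtain a b where ab: "a * int p + b * k = 1" by (metis bezout_int coprime_iff_gcd_eq_1 mult.commute)
    have "of_int b * h + of_int b * of_int k * x = of_int b"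
      using arg_cong[OF hk(1), of "\<lambda>t. of_int b * t"] by (simp add: algebra_simps)
    moreover have "of_int (a * int p + b * k) = (of_int 1 :: 'a)" using ab by simp
    then have "of_int b * of_int k = (1 - of_int a * of_nat p :: 'a)" by (simp add: algebra_simps)
    ultimately have "x - of_int b = of_nat p * (of_int a * x) - of_int b * h"
      by (simp add: algebra_simps)
    moreover have "0 < v (of_nat p * (of_int a * x))"
      by (rule v_p_mult_pos) (use x v_of_int in \<open>simp add: v_mult\<close>)
    then have "of_nat p * (of_int a * x) \<in> H" using m by blast
    ultimately have "x - of_int b \<in> H" using sub int[OF hk(2)] by simp
    then show ?thesis by blast
  qed
  then show ?thesis using sub m O one by (intro exI[of _ H]) auto
qed

end

section \<open>Independence of the residue rings of K and Q(X)\<close>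

locale Cp_W = Cp p v + \<omega>: dval \<omega> e
  for p :: nat and v :: "'a::field_char_0 \<Rightarrow> ereal" and \<omega> :: "rat poly fract \<Rightarrow> ereal" and e +
  assumes \<omega>_const: "\<omega> (const_fract r) = v (of_rat r)"
begin

text \<open>Integer representatives of a linear functional from the residue field of K to the prime
  field; integers can be embedded in Q(X). It is non-zero at -1, the coefficient with which 1 enters
  the relation that refutes properness failing.\<close>

definition psi :: "'a \<Rightarrow> int" where
  "psi = (SOME \<psi>. (\<forall>x. 0 < v x \<longrightarrow> int p dvd \<psi> x) \<and> \<not> int p dvd \<psi> (- 1) \<and>
     (\<forall>x y. 0 \<le> v x \<longrightarrow> 0 \<le> v y \<longrightarrow> int p dvd \<psi> (x + y) - \<psi> x - \<psi> y) \<and>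
     (\<forall>x n. 0 \<le> v x \<longrightarrow> int p dvd \<psi> (of_int n * x) - n * \<psi> x))"

lemma psi:
  shows "0 < v x \<Longrightarrow> int p dvd psi x" "\<not> int p dvd psi (- 1)"
    "0 \<le> v x \<Longrightarrow> 0 \<le> v y \<Longrightarrow> int p dvd psi (x + y) - psi x - psi y"
    "0 \<le> v x \<Longrightarrow> int p dvd psi (of_int n * x) - n * psi x"
proof -
  obtain H where H: "\<forall>x\<in>H. \<forall>y\<in>H. x - y \<in> H" and m: "{x. 0 < v x} \<subseteq> H" and one: "1 \<notin> H"
    and ex: "\<And>x. 0 \<le> v x \<Longrightarrow> \<exists>n::int. x - of_int n \<in> H"
    using ex_residue_functional by blast
  have zero: "0 \<in> H" using m by auto
  have sub: "x - y \<in> H" if "x \<in> H" "y \<in> H" for x y using H that by blast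
  have neg: "- x \<in> H" if "x \<in> H" for x using sub[OF zero that] by simp
  have add: "x + y \<in> H" if "x \<in> H" "y \<in> H" for x y using sub[OF that(1) neg[OF that(2)]] by simp
  have nat: "of_nat n * x \<in> H" if "x \<in> H" for n x
    by (induction n) (use zero add that in \<open>auto simp: algebra_simps\<close>)
  have int: "of_int n * x \<in> H" if "x \<in> H" for n x
    by (cases n) (use nat[OF that] neg in \<open>auto simp del: of_nat_Suc\<close>)
  have pH: "of_nat p \<in> H" using m by auto
  \<comment> \<open>The integers in \<open>H\<close> are exactly the multiples of p, so congruence
    modulo \<open>H\<close> of integers is congruence modulo p.\<close>
  have dvd: "of_int n \<in> H \<longleftrightarrow> int p dvd n" for n
  proof
    assume n: "of_int n \<in> H"
    show "int p dvd n"
    proof (rule ccontr)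
      assume "\<not> int p dvd n"
      then have "coprime (int p) n" using prime_p by (simp add: prime_imp_coprime)
      then obtain a b where ab: "a * int p + b * n = 1" by (metis bezout_int coprime_iff_gcd_eq_1 mult.commute)
      have "of_int a * of_nat p + of_int b * of_int n \<in> H" using add int n pH by blast
      moreover have "of_int (a * int p + b * n) = (of_int 1 :: 'a)" using ab by simp
      then have "of_int a * of_nat p + of_int b * of_int n = (1::'a)" by simp
      ultimately show False using one by simp
    qed
  next
    assume "int p dvd n"
    then obtain j where "n = int p * j" by (elim dvdE)
    then have "of_int n = (of_int j * of_nat p :: 'a)" by (simp add: mult.commute)
    then show "of_int n \<in> H" using int pH by simp
  qed
  have "\<exists>\<psi>. \<forall>x. 0 \<le> v x \<longrightarrow> x - of_int (\<psi> x) \<in> H" using ex by metis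
  then obtain \<psi> where \<psi>: "\<And>x. 0 \<le> v x \<Longrightarrow> x - of_int (\<psi> x) \<in> H" by blast
  have cong: "int p dvd \<psi> x - n" if "0 \<le> v x" "x - of_int n \<in> H" for x n
  proof -
    have "x - of_int n - (x - of_int (\<psi> x)) \<in> H" using sub \<psi> that by blast
    then have "of_int (\<psi> x - n) \<in> H" by simp
    then show ?thesis using dvd by blast
  qed
  have "(\<forall>x. 0 < v x \<longrightarrow> int p dvd \<psi> x) \<and> \<not> int p dvd \<psi> (- 1) \<and>
     (\<forall>x y. 0 \<le> v x \<longrightarrow> 0 \<le> v y \<longrightarrow> int p dvd \<psi> (x + y) - \<psi> x - \<psi> y) \<and>
     (\<forall>x n. 0 \<le> v x \<longrightarrow> int p dvd \<psi> (of_int n * x) - n * \<psi> x)"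
  proof (intro conjI allI impI)
    show "int p dvd \<psi> x" if "0 < v x" for x using cong[of x 0] that m by auto
    show "\<not> int p dvd \<psi> (- 1)"
    proof
      assume "int p dvd \<psi> (- 1)"
      then have "of_int (\<psi> (- 1)) \<in> H" using dvd by blast
      then have "- 1 - of_int (\<psi> (- 1)) + of_int (\<psi> (- 1)) \<in> H" using \<psi>[of "- 1"] by (intro add) auto
      then show False using neg[of "- 1"] one by simp
    qed
    show "int p dvd \<psi> (x + y) - \<psi> x - \<psi> y" if "0 \<le> v x" "0 \<le> v y" for x y
    proof -
      have "x - of_int (\<psi> x) + (y - of_int (\<psi> y)) \<in> H" using \<psi> that add by blast
      then have "int p dvd \<psi> (x + y) - (\<psi> x + \<psi> y)" using that
        by (intro cong v_add_ge) (auto simp: algebra_simps)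
      then show ?thesis by (simp add: algebra_simps)
    qed
    show "int p dvd \<psi> (of_int n * x) - n * \<psi> x" if "0 \<le> v x" for x n
    proof (rule cong)
      show "0 \<le> v (of_int n * x)" using that v_of_int by (simp add: v_mult)
      show "of_int n * x - of_int (n * \<psi> x) \<in> H" using int[OF \<psi>[OF that], of n] by (simp add: algebra_simps)
    qed
  qed
  then have "\<exists>\<psi>. (\<forall>x. 0 < v x \<longrightarrow> int p dvd \<psi> x) \<and> \<not> int p dvd \<psi> (- 1) \<and>
     (\<forall>x y. 0 \<le> v x \<longrightarrow> 0 \<le> v y \<longrightarrow> int p dvd \<psi> (x + y) - \<psi> x - \<psi> y) \<and>
     (\<forall>x n. 0 \<le> v x \<longrightarrow> int p dvd \<psi> (of_int n * x) - n * \<psi> x)" by blast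
  then have *: "(\<forall>x. 0 < v x \<longrightarrow> int p dvd psi x) \<and> \<not> int p dvd psi (- 1) \<and>
     (\<forall>x y. 0 \<le> v x \<longrightarrow> 0 \<le> v y \<longrightarrow> int p dvd psi (x + y) - psi x - psi y) \<and>
     (\<forall>x n. 0 \<le> v x \<longrightarrow> int p dvd psi (of_int n * x) - n * psi x)"
    unfolding psi_def by (rule someI_ex)
  show "0 < v x \<Longrightarrow> int p dvd psi x" "\<not> int p dvd psi (- 1)"
    "0 \<le> v x \<Longrightarrow> 0 \<le> v y \<Longrightarrow> int p dvd psi (x + y) - psi x - psi y"
    "0 \<le> v x \<Longrightarrow> int p dvd psi (of_int n * x) - n * psi x"
    using * by blast+
qed

definition Psi :: "'a \<Rightarrow> rat poly fract" where
  "Psi x = const_fract (of_int (psi x))"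

lemma const_fract_simps:
  "const_fract (a + b) = const_fract a + const_fract b" "const_fract (a - b) = const_fract a - const_fract b"
  by (simp_all add: const_fract_def)

lemma \<omega>_of_int_pos: "0 < \<omega> (const_fract (of_int n)) \<longleftrightarrow> int p dvd n"
proof
  assume "int p dvd n"
  then obtain j where "n = int p * j" by (elim dvdE)
  then have "of_rat (of_int n) = (of_nat p * of_int j :: 'a)" by (simp add: of_rat_mult)
  then show "0 < \<omega> (const_fract (of_int n))"
    unfolding \<omega>_const using v_p_mult_pos v_of_int by metis
next
  assume pos: "0 < \<omega> (const_fract (of_int n))"
  show "int p dvd n"
  proof (rule ccontr)
    assume n: "\<not> int p dvd n"
    then have "n \<noteq> 0" by auto
    then have "v (of_int n) = 0" using v_rat[of n 1] n
      by (simp add: not_dvd_imp_multiplicity_0 zero_ereal_def)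
    then show False using pos by (simp add: \<omega>_const)
  qed
qed

lemma \<omega>_of_int_ge0: "0 \<le> \<omega> (const_fract (of_int n))"
  by (simp add: \<omega>_const v_of_int)

lemma Psi_add: "0 \<le> v x \<Longrightarrow> 0 \<le> v y \<Longrightarrow> 0 < \<omega> (Psi (x + y) - Psi x - Psi y)"
  using psi(3) unfolding Psi_def const_fract_simps(2)[symmetric] of_int_diff[symmetric] \<omega>_of_int_pos .

text \<open>Linearity over the integers extends to Z_(p): clear the denominator b, which is a unit
  of the valuation because p does not divide it.\<close>

lemma Psi_smult:
  assumes q: "0 \<le> v (of_rat q)" and x: "0 \<le> v x"
  shows "0 < \<omega> (Psi (of_rat q * x) - const_fract q * Psi x)"
proof -
  have "q \<in> Z_loc p" using q by (simp add: v_of_rat_ge0_iff)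
  then obtain a b :: int where ab: "b > 0" "\<not> int p dvd b" "q = of_int a / of_int b" by (auto simp: Z_loc_def)
  have qx: "0 \<le> v (of_rat q * x)" using q x by (simp add: v_mult)
  have eq: "of_int b * (of_rat q * x) = of_int a * x" using ab by (simp add: of_rat_divide)
  have "int p dvd (psi (of_int a * x) - a * psi x) - (psi (of_int b * (of_rat q * x)) - b * psi (of_rat q * x))"
    using psi(4)[OF x] psi(4)[OF qx] by (rule dvd_diff)
  then have "int p dvd b * psi (of_rat q * x) - a * psi x" unfolding eq by simp
  then have "0 < \<omega> (const_fract (of_int (b * psi (of_rat q * x) - a * psi x)))" by (simp only: \<omega>_of_int_pos)
  also have "const_fract (of_int (b * psi (of_rat q * x) - a * psi x)) =
      const_fract (of_int b) * (Psi (of_rat q * x) - const_fract q * Psi x)"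
  proof -
    have "(of_int a :: rat) = of_int b * q" using ab by simp
    then show ?thesis by (simp add: Psi_def const_fract_simps const_fract_mult right_diff_distrib mult.assoc)
  qed
  finally have "0 < \<omega> (const_fract (of_int b)) + \<omega> (Psi (of_rat q * x) - const_fract q * Psi x)"
    by (simp only: \<omega>.v_mult)
  moreover have "\<omega> (const_fract (of_int b)) = 0" using \<omega>_of_int_ge0[of b] \<omega>_of_int_pos[of b] ab by (simp add: less_le)
  ultimately show ?thesis by simp
qed

lemma Psi_zero: "0 < \<omega> (Psi 0)"
  unfolding Psi_def \<omega>_of_int_pos by (rule psi(1)) simp

lemma Psi_sum:
  assumes "finite S" "\<And>s. s \<in> S \<Longrightarrow> 0 \<le> v (f s)"
  shows "0 < \<omega> (Psi (sum f S) - (\<Sum>s\<in>S. Psi (f s)))"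
  using assms
proof (induction S rule: finite_induct)
  case (insert s S)
  have "0 < \<omega> (Psi (f s + sum f S) - Psi (f s) - Psi (sum f S))"
    using insert by (intro Psi_add v_sum_ge) auto
  moreover have "0 < \<omega> (Psi (sum f S) - (\<Sum>s\<in>S. Psi (f s)))" using insert by auto
  ultimately have "0 < \<omega> ((Psi (f s + sum f S) - Psi (f s) - Psi (sum f S)) + (Psi (sum f S) - (\<Sum>s\<in>S. Psi (f s))))"
    by (rule \<omega>.v_add_gt)
  then show ?case using insert by (simp add: algebra_simps)
qed (simp add: Psi_zero)

text \<open>Linear disjointness of K and Q(X) over Q: after clearing a common denominator, compare
  the coefficients of one power X^i that occurs in a numerator.\<close>

lemma rational_relation:
  assumes S: "finite S" and sum: "(\<Sum>s\<in>S. emb (c s) * lift (y s)) = 0" and t: "t \<in> S" "y t \<noteq> 0"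
  shows "\<exists>q :: 'i \<Rightarrow> rat. (\<exists>s\<in>S. q s \<noteq> 0) \<and> (\<Sum>s\<in>S. c s * of_rat (q s)) = 0"
proof -
  obtain d where d: "d \<noteq> 0" "\<forall>s\<in>S. \<exists>f. y s = Fract f d" using fract_common_denominator[OF S] by blast
  then obtain f where f: "\<And>s. s \<in> S \<Longrightarrow> y s = Fract (f s) d" by metis
  have "f t \<noteq> 0" using f[OF t(1)] t(2) d(1) by (auto simp: Zero_fract_def eq_fract)
  then obtain i where i: "coeff (f t) i \<noteq> 0" by (meson leading_coeff_0_iff)
  let ?D = "Fract (map_poly of_rat d) 1 :: 'a poly fract"
  have trm: "emb (c s) * lift (y s) * ?D = Fract (smult (c s) (map_poly of_rat (f s))) 1" if "s \<in> S" for s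
    using f[OF that] d(1) by (simp add: lift_Fract emb_def eq_fract)
  have add: "(\<Sum>s\<in>S. Fract (g s) 1) = Fract (sum g S) 1" for g :: "'i \<Rightarrow> 'a poly"
    using S by (induction S rule: finite_induct) (auto simp: Zero_fract_def)
  have "0 = (\<Sum>s\<in>S. emb (c s) * lift (y s)) * ?D" using sum by simp
  also have "\<dots> = Fract (\<Sum>s\<in>S. smult (c s) (map_poly of_rat (f s))) 1"
    unfolding sum_distrib_right add[symmetric] using trm by (intro sum.cong) auto
  finally have "(\<Sum>s\<in>S. smult (c s) (map_poly of_rat (f s) :: 'a poly)) = 0"
    by (simp add: Zero_fract_def eq_fract)
  then have "coeff (\<Sum>s\<in>S. smult (c s) (map_poly of_rat (f s) :: 'a poly)) i = 0" by simp
  then have "(\<Sum>s\<in>S. c s * of_rat (coeff (f s) i)) = 0" by (simp add: coeff_sum coeff_map_poly)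
  then show ?thesis using i t by (intro exI[of _ "\<lambda>s. coeff (f s) i"]) auto
qed

text \<open>This is the tensor product statement: a relation between elements of the two rings persists in the
  tensor product of the residue rings. Eliminate one summand at a time with a rational relation.\<close>

theorem residue_relation:
  fixes S :: "'i set" and c :: "'i \<Rightarrow> 'a"
  assumes "finite S" "\<And>s. s \<in> S \<Longrightarrow> 0 \<le> v (c s)" "\<And>s. s \<in> S \<Longrightarrow> 0 \<le> \<omega> (y s)"
    "(\<Sum>s\<in>S. emb (c s) * lift (y s)) = 0"
  shows "0 < \<omega> (\<Sum>s\<in>S. Psi (c s) * y s)"
  using assms
proof (induction "card S" arbitrary: S y rule: less_induct)
  case (less S y)
  note S = less.prems(1) and c = less.prems(2) and y = less.prems(3) and zero = less.prems(4)
  show ?case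
  proof (cases "\<forall>s\<in>S. y s = 0")
    case False
    then obtain q :: "'i \<Rightarrow> rat" where q: "\<exists>s\<in>S. q s \<noteq> 0" "(\<Sum>s\<in>S. c s * of_rat (q s)) = 0"
      using rational_relation[OF S zero] by blast
    \<comment> \<open>Solving for the summand whose rational coefficient has the least value makes
      the ratios r s integral.\<close>
    define m where "m = Min ((\<lambda>s. v (of_rat (q s))) ` S)"
    have "m \<in> (\<lambda>s. v (of_rat (q s))) ` S" unfolding m_def by (rule Min_in) (use S q in auto)
    then obtain j where j: "j \<in> S" "v (of_rat (q j)) = m" by auto
    have m_le: "m \<le> v (of_rat (q s))" if "s \<in> S" for s unfolding m_def by (rule Min_le) (use S that in auto)
    have "m \<noteq> \<infinity>" using q(1) m_le v_infD by (metis ereal_infty_less_eq(1) of_rat_eq_0_iff)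
    then have qj: "q j \<noteq> 0" using j by auto
    then obtain x where x: "m = ereal x" using j v_realE[of "of_rat (q j)"] by auto
    define r where "r s = - q s / q j" for s
    have r: "0 \<le> v (of_rat (r s))" if "s \<in> S" for s
      using m_le[OF that] j qj x by (cases "v (of_rat (q s))") (auto simp: r_def of_rat_divide v_divide of_rat_minus)
    define S' where "S' = S - {j}"
    have S': "finite S'" "card S' < card S" unfolding S'_def using S card_Diff1_less[OF S j(1)] by auto
    note split = sum.remove[OF S j(1), folded S'_def]
    have cj: "c j = (\<Sum>s\<in>S'. of_rat (r s) * c s)"
    proof -
      have "c j * of_rat (q j) = - (\<Sum>s\<in>S'. c s * of_rat (q s))" using q(2) unfolding split by (simp add: eq_neg_iff_add_eq_0)
      then have "c j = - (\<Sum>s\<in>S'. c s * of_rat (q s)) / of_rat (q j)" using qj by (simp add: field_simps)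
      also have "\<dots> = (\<Sum>s\<in>S'. of_rat (r s) * c s)"
        by (simp add: r_def of_rat_divide of_rat_minus sum_divide_distrib sum_negf mult.commute)
      finally show ?thesis .
    qed
    \<comment> \<open>Substituting \<open>cj\<close> and collecting terms moves y j into the other
      summands, so the relation persists with one summand fewer.\<close>
    define y' where "y' s = y s + const_fract (r s) * y j" for s
    have "0 < \<omega> (\<Sum>s\<in>S'. Psi (c s) * y' s)"
    proof (rule less.hyps[OF S'(2,1)])
      show "0 \<le> v (c s)" if "s \<in> S'" for s using c that by (auto simp: S'_def)
      show "0 \<le> \<omega> (y' s)" if "s \<in> S'" for s
        unfolding y'_def using y[of s] y[OF j(1)] r[of s] that
        by (intro \<omega>.v_add_ge) (auto simp: S'_def \<omega>.v_mult \<omega>_const)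
      have "(\<Sum>s\<in>S'. emb (c s) * lift (y' s)) =
          (\<Sum>s\<in>S'. emb (c s) * lift (y s)) + emb (\<Sum>s\<in>S'. of_rat (r s) * c s) * lift (y j)"
        by (simp add: y'_def distrib_left sum.distrib sum_distrib_left sum_distrib_right emb_sum mult_ac)
      then show "(\<Sum>s\<in>S'. emb (c s) * lift (y' s)) = 0" using zero unfolding split cj[symmetric] by (simp add: add.commute)
    qed
    \<comment> \<open>\<open>Psi\<close> is linear only modulo elements of positive value; this is
      the error made by the elimination.\<close>
    moreover have "0 < \<omega> ((Psi (c j) - (\<Sum>s\<in>S'. const_fract (r s) * Psi (c s))) * y j)"
    proof -
      have "0 < \<omega> (Psi (c j) - (\<Sum>s\<in>S'. Psi (of_rat (r s) * c s)))"
        unfolding cj using S' r c by (intro Psi_sum) (auto simp: v_mult S'_def)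
      moreover have "0 < \<omega> (\<Sum>s\<in>S'. Psi (of_rat (r s) * c s) - const_fract (r s) * Psi (c s))"
        using r c by (intro \<omega>.v_sum_gt Psi_smult) (auto simp: S'_def)
      ultimately have "0 < \<omega> ((Psi (c j) - (\<Sum>s\<in>S'. Psi (of_rat (r s) * c s))) +
          (\<Sum>s\<in>S'. Psi (of_rat (r s) * c s) - const_fract (r s) * Psi (c s)))" by (rule \<omega>.v_add_gt)
      then have "0 < \<omega> (Psi (c j) - (\<Sum>s\<in>S'. const_fract (r s) * Psi (c s)))"
        by (simp add: sum_subtractf)
      then show ?thesis using y[OF j(1)] by (simp add: \<omega>.v_mult add_pos_nonneg)
    qed
    ultimately have "0 < \<omega> ((\<Sum>s\<in>S'. Psi (c s) * y' s) + (Psi (c j) - (\<Sum>s\<in>S'. const_fract (r s) * Psi (c s))) * y j)"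
      by (rule \<omega>.v_add_gt)
    also have "(\<Sum>s\<in>S'. Psi (c s) * y' s) + (Psi (c j) - (\<Sum>s\<in>S'. const_fract (r s) * Psi (c s))) * y j =
        (\<Sum>s\<in>S. Psi (c s) * y s)"
      by (simp add: split y'_def distrib_left sum.distrib sum_distrib_left right_diff_distrib mult_ac)
    finally show ?thesis .
  qed simp
qed

end

section \<open>From a valuation ring of K(X) to a real-valued valuation\<close>

inductive_set additive_closure :: "'b::comm_ring_1 set \<Rightarrow> 'b set" for T where
  zero: "0 \<in> additive_closure T"
| plus: "a \<in> additive_closure T \<Longrightarrow> t \<in> T \<Longrightarrow> a + t \<in> additive_closure T"

lemma additive_closure_base: "t \<in> T \<Longrightarrow> t \<in> additive_closure T"
  using additive_closure.plus[OF additive_closure.zero] by fastforce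

lemma additive_closure_mono: "a \<in> additive_closure T \<Longrightarrow> T \<subseteq> T' \<Longrightarrow> a \<in> additive_closure T'"
  by (induction rule: additive_closure.induct) (auto intro: additive_closure.intros)

lemma additive_closure_add:
  assumes "a \<in> additive_closure T" "b \<in> additive_closure T"
  shows "a + b \<in> additive_closure T"
  using assms(2,1)
proof (induction rule: additive_closure.induct)
  case (plus b t)
  have "a + b + t \<in> additive_closure T"
    by (rule additive_closure.plus) (use plus in auto)
  then show ?case by (simp add: add.assoc)
qed simp

lemma additive_closure_uminus:
  assumes "a \<in> additive_closure T" "\<And>t. t \<in> T \<Longrightarrow> - t \<in> T"
  shows "- a \<in> additive_closure T"
  using assms(1)
proof (induction rule: additive_closure.induct)
  case (plus a t)
  then have "- a + - t \<in> additive_closure T" using assms(2) by (intro additive_closure.plus) auto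
  then show ?case by simp
qed (simp add: additive_closure.zero)

lemma additive_closure_mult:
  assumes a: "a \<in> additive_closure T" and b: "b \<in> additive_closure T'"
    and T: "\<And>s t. s \<in> T \<Longrightarrow> t \<in> T' \<Longrightarrow> s * t \<in> T''"
  shows "a * b \<in> additive_closure T''"
  using a
proof (induction rule: additive_closure.induct)
  case (plus a s)
  have "s * b \<in> additive_closure T''"
    using b
  proof (induction rule: additive_closure.induct)
    case (plus b t)
    then show ?case using T[OF \<open>s \<in> T\<close>] by (auto simp: distrib_left intro: additive_closure.plus)
  qed (simp add: additive_closure.zero)
  then show ?case using plus by (simp add: distrib_right additive_closure_add)
qed (simp add: additive_closure.zero)

locale Cp_V = Cp p v for p :: nat and v :: "'a::field_char_0 \<Rightarrow> ereal" +
  fixes V :: "'a poly fract set"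
  assumes subring: "subring_of V"
    and total: "x \<in> V \<or> inverse x \<in> V"
    and emb_V: "emb c \<in> V \<longleftrightarrow> 0 \<le> v c"
begin

text \<open>\<open>V\<close> may have rank greater than one. Comparing z with the scalars of K keeps
  only the part of its valuation visible from K, possibly with values \<infinity> at non-zero z or
  -\<infinity>.\<close>

definition uV :: "'a poly fract \<Rightarrow> ereal" where
  "uV z = (SUP c\<in>{c. c \<noteq> 0 \<and> z / emb c \<in> V}. v c)"

lemmas V = subring_ofD[OF subring]

lemma uV_ge: "c \<noteq> 0 \<Longrightarrow> z / emb c \<in> V \<Longrightarrow> v c \<le> uV z"
  unfolding uV_def by (rule SUP_upper) simp

lemma divide_emb_mono:
  assumes "z / emb d \<in> V" "c \<noteq> 0" "d \<noteq> 0" "v c \<le> v d"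
  shows "z / emb c \<in> V"
proof -
  obtain r where "v c = ereal r" using assms(2) by (rule v_realE)
  then have "0 \<le> v (d / c)" using assms by (cases "v d") (auto simp: v_divide)
  then have "z / emb d * emb (d / c) \<in> V" using assms(1) emb_V by (intro V(5)) auto
  then show ?thesis using assms by (simp add: emb_divide)
qed

lemma uV_le: "c \<noteq> 0 \<Longrightarrow> z / emb c \<notin> V \<Longrightarrow> uV z \<le> v c"
  unfolding uV_def
proof (rule SUP_least)
  fix d assume "c \<noteq> 0" "z / emb c \<notin> V" "d \<in> {d. d \<noteq> 0 \<and> z / emb d \<in> V}"
  then show "v d \<le> v c" using divide_emb_mono[of z d c] linear[of "v c" "v d"] by auto
qed

lemma ex_v_between_ereal:
  assumes "x < (y::ereal)"
  shows "\<exists>c. c \<noteq> 0 \<and> x < v c \<and> v c < y"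
proof -
  obtain a where a: "x < ereal a" "ereal a < y" using ereal_dense2[OF assms] by blast
  obtain b where b: "ereal a < ereal b" "ereal b < y" using ereal_dense2[OF a(2)] by blast
  then obtain c where "c \<noteq> 0" "ereal a < v c" "v c < ereal b" using ex_v_between[of a b] by auto
  then show ?thesis using a b by (intro exI[of _ c]) auto
qed

lemma notin_mult: "x \<notin> V \<Longrightarrow> y \<notin> V \<Longrightarrow> x * y \<notin> V"
proof
  assume x: "x \<notin> V" and y: "y \<notin> V" and xy: "x * y \<in> V"
  have "x \<noteq> 0" using x V(1) by auto
  have "inverse x * (x * y) \<in> V" by (rule V(5)[OF _ xy]) (use total[of x] x in auto)
  then show False using y \<open>x \<noteq> 0\<close> by (simp add: mult.assoc[symmetric])
qed

lemma power_in_V: "0 < n \<Longrightarrow> x ^ n \<in> V \<Longrightarrow> x \<in> V"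
proof (induction n)
  case (Suc n)
  then show ?case using notin_mult[of x "x ^ n"] by (cases "n = 0") auto
qed simp

lemma uV_add: "min (uV x) (uV y) \<le> uV (x + y)"
proof (rule ccontr)
  assume "\<not> ?thesis"
  then have "uV (x + y) < min (uV x) (uV y)" by (simp only: not_le)
  then obtain c where c: "c \<noteq> 0" "uV (x + y) < v c" "v c < min (uV x) (uV y)"
    using ex_v_between_ereal by blast
  have "v c < uV x" "v c < uV y" using c(3) by auto
  then have "x / emb c \<in> V" "y / emb c \<in> V"
    using uV_le[OF c(1), of x] uV_le[OF c(1), of y] leD by blast+
  then have "(x + y) / emb c \<in> V" using V(3) by (simp add: add_divide_distrib)
  then show False using uV_ge[OF c(1)] c(2) by (auto simp: not_le[symmetric])
qed

text \<open>The hypotheses exclude the ill-defined sum of \<infinity> and -\<infinity>. Members of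
  \<open>V\<close> multiply to members and, \<open>V\<close> being a valuation ring, non-members to
  non-members; each fact gives one inequality.\<close>

lemma uV_mult:
  assumes "uV x \<noteq> -\<infinity>" "uV y \<noteq> -\<infinity>"
  shows "uV (x * y) = uV x + uV y"
proof (rule antisym)
  have mono: "v c + v d \<le> uV (x * y)" if "c \<noteq> 0" "d \<noteq> 0" "v c < uV x" "v d < uV y" for c d
  proof -
    have "x / emb c \<in> V" "y / emb d \<in> V"
      using that uV_le[of c x] uV_le[of d y] by (auto simp: not_le[symmetric])
    then have "x / emb c * (y / emb d) \<in> V" using V(5) by blast
    then have "x * y / emb (c * d) \<in> V" by simp
    then show ?thesis using uV_ge[of "c * d" "x * y"] that by (simp add: v_mult)
  qed
  show "uV x + uV y \<le> uV (x * y)"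
  proof (rule ccontr)
    assume "\<not> ?thesis"
    then obtain t where t: "uV (x * y) < ereal t" "ereal t < uV x + uV y" using ereal_dense2 by (auto simp: not_le)
    have "\<exists>a b. ereal a < uV x \<and> ereal b < uV y \<and> t \<le> a + b"
    proof (cases "uV x"; cases "uV y")
      fix r s assume rs: "uV x = ereal r" "uV y = ereal s"
      then show ?thesis using t by (intro exI[of _ "r - (r + s - t) / 2"] exI[of _ "s - (r + s - t) / 2"]) (auto simp: field_simps)
    next
      fix r assume rs: "uV x = ereal r" "uV y = \<infinity>"
      then show ?thesis by (intro exI[of _ "r - 1"] exI[of _ "t - r + 1"]) auto
    next
      fix r assume rs: "uV x = \<infinity>" "uV y = ereal r"
      then show ?thesis by (intro exI[of _ "t - r + 1"] exI[of _ "r - 1"]) auto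
    next
      assume rs: "uV x = \<infinity>" "uV y = \<infinity>"
      then show ?thesis by (intro exI[of _ t] exI[of _ 0]) auto
    qed (use assms in auto)
    then obtain a b where ab: "ereal a < uV x" "ereal b < uV y" "t \<le> a + b" by blast
    obtain c d where cd: "c \<noteq> 0" "ereal a < v c" "v c < uV x" "d \<noteq> 0" "ereal b < v d" "v d < uV y"
      using ex_v_between_ereal[OF ab(1)] ex_v_between_ereal[OF ab(2)] by blast
    have "ereal a + ereal b \<le> v c + v d" using cd by (intro add_mono) auto
    also have "\<dots> \<le> uV (x * y)" using cd by (intro mono) auto
    finally show False using t(1) ab(3) by (metis dual_order.trans ereal_less_eq(3) leD plus_ereal.simps(1))
  qed
  show "uV (x * y) \<le> uV x + uV y"
  proof (cases "uV x = \<infinity> \<or> uV y = \<infinity>")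
    case False
    then obtain r s where rs: "uV x = ereal r" "uV y = ereal s" using assms by (cases "uV x"; cases "uV y") auto
    show ?thesis
    proof (rule ccontr)
      assume "\<not> ?thesis"
      then obtain t where t: "uV x + uV y < ereal t" "ereal t < uV (x * y)" using ereal_dense2 by (auto simp: not_le)
      \<comment> \<open>Half of the gap is available for a scalar slightly above each of the two
        values.\<close>
      define \<epsilon> where "\<epsilon> = (t - r - s) / 2"
      have \<epsilon>: "\<epsilon> > 0" using t rs by (simp add: \<epsilon>_def)
      obtain c where c: "c \<noteq> 0" "ereal r < v c" "v c < ereal (r + \<epsilon>)" using ex_v_between[of r "r + \<epsilon>"] \<epsilon> by auto
      obtain d where d: "d \<noteq> 0" "ereal s < v d" "v d < ereal (s + \<epsilon>)" using ex_v_between[of s "s + \<epsilon>"] \<epsilon> by auto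
      have "x / emb c \<notin> V" "y / emb d \<notin> V" using uV_ge[of c x] uV_ge[of d y] c d rs by (auto simp: not_le[symmetric])
      then have "x / emb c * (y / emb d) \<notin> V" by (rule notin_mult)
      then have "uV (x * y) \<le> v (c * d)" using c d by (intro uV_le) auto
      also have "\<dots> \<le> ereal (r + \<epsilon>) + ereal (s + \<epsilon>)" unfolding v_mult using c d by (intro add_mono) auto
      also have "\<dots> = ereal t" by (simp add: \<epsilon>_def field_simps)
      finally show False using t(2) by simp
    qed
  qed (use assms in auto)
qed

lemma uV_unit:
  assumes "c \<noteq> 0" "z / emb c \<in> V" "emb c / z \<in> V" "z \<noteq> 0"
  shows "uV z = v c"
proof (rule antisym)
  show "v c \<le> uV z" using assms by (intro uV_ge)
  show "uV z \<le> v c"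
    unfolding uV_def
  proof (rule SUP_least)
    fix d assume "d \<in> {d. d \<noteq> 0 \<and> z / emb d \<in> V}"
    then have d: "d \<noteq> 0" "z / emb d \<in> V" by auto
    have "z / emb d * (emb c / z) \<in> V" using assms d by (intro V(5))
    then have "emb (c / d) \<in> V" using assms(4) by (simp add: emb_divide)
    then have "0 \<le> v c - v d" using emb_V d by (simp add: v_divide)
    moreover obtain r where "v d = ereal r" using d(1) by (rule v_realE)
    ultimately show "v d \<le> v c" by (cases "v c") auto
  qed
qed

lemma uV_emb: "uV (emb c) = v c"
proof (cases "c = 0")
  case True
  have "ereal M \<le> uV 0" for M
  proof -
    obtain d where "d \<noteq> 0" "ereal M < v d" using ex_v_between[of M "M + 1"] by auto
    then show ?thesis using uV_ge[of d 0] V(1) by (auto intro: order_trans less_imp_le)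
  qed
  then have "uV 0 = \<infinity>" by (rule ereal_top)
  then show ?thesis using True by simp
qed (use V(2) in \<open>auto intro: uV_unit\<close>)

end

context Cp_W
begin

text \<open>\<open>T0\<close> and \<open>T1\<close> additively generate the compositum of the two
  valuation rings and the ideal spanned by their maximal ideals. \<open>residue_relation\<close>
  keeps 1 out of that ideal, and a valuation ring above the pair meets K and Q(X) as
  required.\<close>

lemma ex_compatible_valuation_ring:
  "\<exists>V. Cp_V p v V \<and> (\<forall>y. lift y \<in> V \<longleftrightarrow> 0 \<le> \<omega> y)"
proof -
  define T0 where "T0 = {emb c * lift y |c y. 0 \<le> v c \<and> 0 \<le> \<omega> y}"
  define T1 where "T1 = {emb c * lift y |c y. 0 \<le> v c \<and> 0 \<le> \<omega> y \<and> (0 < v c \<or> 0 < \<omega> y)}"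
  have memT0: "emb c * lift y \<in> T0" if "0 \<le> v c" "0 \<le> \<omega> y" for c y using that unfolding T0_def by blast
  have memT1: "emb c * lift y \<in> T1" if "0 \<le> v c" "0 \<le> \<omega> y" "0 < v c \<or> 0 < \<omega> y" for c y
    using that unfolding T1_def by blast
  have mult: "s * t \<in> T0" if "s \<in> T0" "t \<in> T0" for s t
  proof -
    obtain c y c' y' where "s = emb c * lift y" "t = emb c' * lift y'" "0 \<le> v c" "0 \<le> \<omega> y" "0 \<le> v c'" "0 \<le> \<omega> y'"
      using \<open>s \<in> T0\<close> \<open>t \<in> T0\<close> unfolding T0_def by blast
    then show ?thesis using memT0[of "c * c'" "y * y'"] by (simp add: v_mult \<omega>.v_mult mult_ac)
  qed
  have mult1: "s * t \<in> T1" if "s \<in> T0" "t \<in> T1" for s t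
  proof -
    obtain c y c' y' where "s = emb c * lift y" "t = emb c' * lift y'" "0 \<le> v c" "0 \<le> \<omega> y" "0 \<le> v c'" "0 \<le> \<omega> y'"
      "0 < v c' \<or> 0 < \<omega> y'"
      using \<open>s \<in> T0\<close> \<open>t \<in> T1\<close> unfolding T0_def T1_def by blast
    then show ?thesis using memT1[of "c * c'" "y * y'"] by (auto simp: v_mult \<omega>.v_mult mult_ac add_nonneg_pos add_pos_nonneg)
  qed
  have neg: "- t \<in> T0" if t: "t \<in> T0" for t
  proof -
    obtain c y where "t = emb c * lift y" "0 \<le> v c" "0 \<le> \<omega> y" using t unfolding T0_def by blast
    then show ?thesis using memT0[of "- c" y] by simp
  qed
  let ?A = "additive_closure T0" and ?I = "additive_closure T1"
  have "subring_of ?A"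
    unfolding subring_of_def
  proof (intro conjI ballI)
    show "0 \<in> ?A" by (rule additive_closure.zero)
    show "1 \<in> ?A" using memT0[of 1 1] by (simp add: additive_closure_base)
    fix x y assume xy: "x \<in> ?A" "y \<in> ?A"
    show "x + y \<in> ?A" using xy by (rule additive_closure_add)
    show "x - y \<in> ?A" using additive_closure_add[OF xy(1) additive_closure_uminus[OF xy(2) neg]] by simp
    show "x * y \<in> ?A" using xy mult by (rule additive_closure_mult)
  qed
  moreover have "ideal_of ?A ?I"
    unfolding ideal_of_def
  proof (intro conjI ballI)
    have "T1 \<subseteq> T0" unfolding T0_def T1_def by blast
    then show "?I \<subseteq> ?A" using additive_closure_mono by blast
    show "0 \<in> ?I" by (rule additive_closure.zero)
    show "x + y \<in> ?I" if "x \<in> ?I" "y \<in> ?I" for x y using that by (rule additive_closure_add)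
    show "x * y \<in> ?I" if "x \<in> ?A" "y \<in> ?I" for x y using that mult1 by (rule additive_closure_mult)
  qed
  moreover have "1 \<notin> ?I"
  proof
    have repr: "\<exists>(n::nat) c y. (\<forall>s. 0 \<le> v (c s) \<and> 0 \<le> \<omega> (y s) \<and> (0 < v (c s) \<or> 0 < \<omega> (y s))) \<and>
        a = (\<Sum>s<n. emb (c s) * lift (y s))" if "a \<in> ?I" for a
      using that
    proof (induction rule: additive_closure.induct)
      case zero
      show ?case by (intro exI[of _ 0] exI[of _ "\<lambda>_. 0"]) auto
    next
      case (plus a t)
      then obtain n :: nat and c y where *: "\<forall>s. 0 \<le> v (c s) \<and> 0 \<le> \<omega> (y s) \<and> (0 < v (c s) \<or> 0 < \<omega> (y s))"
        "a = (\<Sum>s<n. emb (c s) * lift (y s))" by blast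
      obtain d z where dz: "t = emb d * lift z" "0 \<le> v d" "0 \<le> \<omega> z" "0 < v d \<or> 0 < \<omega> z"
        using plus.hyps unfolding T1_def by blast
      have "(\<Sum>s<n. emb ((c(n := d)) s) * lift ((y(n := z)) s)) = a" unfolding *(2) by (intro sum.cong) auto
      then have "a + t = (\<Sum>s<Suc n. emb ((c(n := d)) s) * lift ((y(n := z)) s))" using dz by simp
      then show ?case using * dz by (intro exI[of _ "Suc n"] exI[of _ "c(n := d)"] exI[of _ "y(n := z)"]) auto
    qed
    assume "1 \<in> ?I"
    then obtain n :: nat and c y where *: "\<And>s. 0 \<le> v (c s) \<and> 0 \<le> \<omega> (y s) \<and> (0 < v (c s) \<or> 0 < \<omega> (y s))"
        "1 = (\<Sum>s<n. emb (c s) * lift (y s))" using repr by blast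
    \<comment> \<open>The representation of 1 becomes a relation with the extra summand -1. After
      applying \<open>Psi\<close> all other summands have positive value, so
      \<open>Psi (- 1)\<close> would too.\<close>
    define c' where "c' = c(n := - 1)"
    define y' where "y' = y(n := 1)"
    have "(\<Sum>s<n. emb (c' s) * lift (y' s)) = 1" unfolding *(2) by (intro sum.cong) (auto simp: c'_def y'_def)
    then have "(\<Sum>s<Suc n. emb (c' s) * lift (y' s)) = 0" by (simp add: c'_def y'_def)
    then have "0 < \<omega> (\<Sum>s<Suc n. Psi (c' s) * y' s)"
      using * by (intro residue_relation) (auto simp: c'_def y'_def)
    moreover have "0 < \<omega> (\<Sum>s<n. Psi (c' s) * y' s)"
    proof (rule \<omega>.v_sum_gt)
      fix s assume s: "s \<in> {..<n}"
      have "0 \<le> \<omega> (Psi (c s))" unfolding Psi_def by (rule \<omega>_of_int_ge0)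
      moreover have "0 < \<omega> (Psi (c s))" if "0 < v (c s)" unfolding Psi_def \<omega>_of_int_pos using that by (rule psi(1))
      ultimately show "0 < \<omega> (Psi (c' s) * y' s)" using *(1)[of s] s
        by (auto simp: c'_def y'_def \<omega>.v_mult add_nonneg_pos add_pos_nonneg)
    qed simp
    ultimately have "0 < \<omega> ((\<Sum>s<Suc n. Psi (c' s) * y' s) - (\<Sum>s<n. Psi (c' s) * y' s))" by (rule \<omega>.v_diff_gt)
    then have "0 < \<omega> (Psi (- 1))" by (simp add: c'_def y'_def)
    then show False unfolding Psi_def \<omega>_of_int_pos using psi(2) by simp
  qed
  ultimately obtain V where V: "subring_of V" "?A \<subseteq> V" "\<And>x. x \<in> V \<or> inverse x \<in> V" "\<And>x. x \<in> ?I \<Longrightarrow> x \<noteq> 0 \<Longrightarrow> inverse x \<notin> V"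
    using ex_valuation_ring_above by metis
  have emb_V: "emb c \<in> V \<longleftrightarrow> 0 \<le> v c" for c
  proof (cases "0 \<le> v c")
    case True
    then show ?thesis using memT0[of c 1] V(2) additive_closure_base by auto
  next
    case False
    then have "c \<noteq> 0" by auto
    then have "0 < v (inverse c)" using False by (cases "v c") (auto simp: v_inverse)
    then have "emb (inverse c) \<in> ?I" using memT1[of "inverse c" 1] by (auto intro: additive_closure_base)
    then have "inverse (emb (inverse c)) \<notin> V" using V(4) \<open>c \<noteq> 0\<close> by auto
    then show ?thesis using False by (simp add: emb_inverse)
  qed
  moreover have "lift y \<in> V \<longleftrightarrow> 0 \<le> \<omega> y" for y
  proof (cases "0 \<le> \<omega> y")
    case True
    then show ?thesis using memT0[of 1 y] V(2) additive_closure_base by auto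
  next
    case False
    then have "y \<noteq> 0" by auto
    then have "0 < \<omega> (inverse y)" using False by (cases "\<omega> y") (auto simp: \<omega>.v_inverse)
    then have "lift (inverse y) \<in> ?I" using memT1[of 1 "inverse y"] by (auto intro: additive_closure_base)
    moreover have "lift (inverse y) \<noteq> 0"
    proof
      assume "lift (inverse y) = 0"
      then have "lift (y * inverse y) = 0" by simp
      then show False using \<open>y \<noteq> 0\<close> by simp
    qed
    ultimately have "inverse (lift (inverse y)) \<notin> V" using V(4) by auto
    then show ?thesis using False by (simp add: lift_inverse)
  qed
  moreover have "Cp_V p v V" by unfold_locales (use V(1,3) emb_V in auto)
  ultimately show ?thesis by blast
qed

text \<open>For y in Q(X) choose a scalar c of the same value. Then (lift y / c)^e is a product of
  units coming from W and from O_K, so lift y / c is a unit of V and \<open>uV\<close> agrees with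
  \<omega>.\<close>

lemma ex_extension:
  "\<exists>u::'a poly \<Rightarrow> ereal. pval u \<and> (\<forall>c. u [:c:] = v c) \<and> (\<forall>f. u (map_poly of_rat f) = \<omega> (Fract f 1))"
proof -
  obtain V where CpV: "Cp_V p v V" and lift_V: "\<And>y. lift y \<in> V \<longleftrightarrow> 0 \<le> \<omega> y"
    using ex_compatible_valuation_ring by blast
  interpret Cp_V p v V by (rule CpV)
  have uV_lift: "uV (lift y) = \<omega> y" for y
  proof (cases "y = 0")
    case True
    then show ?thesis using uV_emb[of 0] by simp
  next
    case False
    have ly: "lift y \<noteq> 0"
    proof
      assume "lift y = 0"
      then have "lift (y * inverse y) = 0" by simp
      then show False using False by simp
    qed
    obtain k :: int where k: "\<omega> y = ereal (of_int k / real e)" using \<omega>.discrete[OF False] by blast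
    obtain c where c: "c \<noteq> 0" "v c = ereal (of_int k / real e)" using ex_v_rational[OF \<omega>.e_pos] by blast
    obtain d r where d: "d \<noteq> 0" "v d = ereal (of_int k)" "d = of_rat r" using ex_v_of_int by blast
    have r0: "r \<noteq> 0" using d by auto
    have e: "real e \<noteq> 0" "0 < e" using \<omega>.e_pos by auto
    have \<omega>0: "\<omega> (y ^ e / const_fract r) = 0" using k d r0 e by (simp add: \<omega>.v_divide \<omega>.v_power \<omega>_const)
    have nz: "y ^ e / const_fract r \<noteq> 0" "d / c ^ e \<noteq> 0" using False r0 c d by auto
    have 1: "lift (y ^ e / const_fract r) \<in> V" "lift (inverse (y ^ e / const_fract r)) \<in> V"
      unfolding lift_V \<omega>.v_inverse[OF nz(1)] \<omega>0 by simp_all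
    have v0: "v (d / c ^ e) = 0" using c d e by (simp add: v_divide v_power)
    have 2: "emb (d / c ^ e) \<in> V" "emb (inverse (d / c ^ e)) \<in> V"
      unfolding emb_V v_inverse[OF nz(2)] v0 by simp_all
    have "lift (y ^ e / const_fract r) * emb (d / c ^ e) \<in> V" using 1 2 V(5) by blast
    also have "lift (y ^ e / const_fract r) * emb (d / c ^ e) = (lift y / emb c) ^ e"
      using d r0 c by (simp add: divide_inverse lift_inverse emb_inverse lift_power emb_power power_mult_distrib power_inverse)
    finally have "lift y / emb c \<in> V" using power_in_V e by blast
    moreover have "lift (inverse (y ^ e / const_fract r)) * emb (inverse (d / c ^ e)) \<in> V" using 1 2 V(5) by blast
    moreover have "lift (inverse (y ^ e / const_fract r)) * emb (inverse (d / c ^ e)) = (emb c / lift y) ^ e"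
      using d r0 c by (simp add: divide_inverse lift_inverse emb_inverse lift_power emb_power power_mult_distrib power_inverse)
    ultimately have "emb c / lift y \<in> V" using power_in_V e by metis
    then show ?thesis using uV_unit[OF c(1) \<open>lift y / emb c \<in> V\<close> _ ly] c k by simp
  qed
  define u where "u f = uV (Fract f 1)" for f :: "'a poly"
  have const: "u [:c:] = v c" for c using uV_emb[of c] by (simp add: u_def emb_def)
  \<comment> \<open>X comes from Q(X), where the value is known; Horner's scheme then keeps all
    polynomials away from -\<infinity>.\<close>
  have X: "u [:0, 1:] \<noteq> -\<infinity>"
  proof -
    have "lift (Fract [:0, 1:] 1) = Fract [:0, 1:] 1" by (simp add: lift_Fract map_poly_pCons one_pCons)
    then show ?thesis using uV_lift[of "Fract [:0, 1:] 1"] by (simp add: u_def)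
  qed
  have add: "min (u f) (u g) \<le> u (f + g)" for f g using uV_add[of "Fract f 1" "Fract g 1"] by (simp add: u_def)
  have mult': "u (f * g) = u f + u g" if "u f \<noteq> -\<infinity>" "u g \<noteq> -\<infinity>" for f g
    using uV_mult[of "Fract f 1" "Fract g 1"] that by (simp add: u_def)
  have MInf: "u f \<noteq> -\<infinity>" for f
  proof (induction f)
    case 0
    show ?case using const[of 0] by simp
  next
    case (pCons a f)
    have "u ([:0, 1:] * f) = u [:0, 1:] + u f" using X pCons.IH by (rule mult')
    then have "u ([:0, 1:] * f) \<noteq> -\<infinity>" using X pCons.IH by (cases "u [:0, 1:]"; cases "u f") auto
    moreover have "min (u [:a:]) (u ([:0, 1:] * f)) \<le> u (pCons a f)" using add[of "[:a:]" "[:0, 1:] * f"] by simp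
    ultimately show ?case using const[of a] by (auto simp: min_def split: if_splits)
  qed
  have "pval u"
    using const[of 0] const[of 1] MInf mult' add by unfold_locales (auto simp: one_pCons)
  moreover have "u (map_poly of_rat f) = \<omega> (Fract f 1)" for f
    using uV_lift[of "Fract f 1"] by (simp add: u_def lift_Fract one_pCons)
  ultimately show ?thesis using const by blast
qed

end

section \<open>Roots of unity in residue classes\<close>

context pval
begin

text \<open>The mixed binomial coefficients are divisible by p, and every mixed term contains a
  factor t.\<close>

lemma frobenius_terms:
  assumes p: "prime p" "1 \<le> v (of_nat p)" and y: "0 \<le> v y" and t: "0 \<le> v t"
  shows "1 + v t \<le> v ((y + t) ^ p - y ^ p - t ^ p)"
proof -
  have p2: "p \<ge> 2" using p(1) by (rule prime_ge_2_nat)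
  have nonneg: "0 \<le> v (x ^ n)" if "0 \<le> v x" for x n
    using that by (simp add: v_power)
  have "(y + t) ^ p = (\<Sum>k\<le>p. of_nat (p choose k) * y ^ k * t ^ (p - k))" by (rule binomial_ring)
  also have "{..p} = insert 0 (insert p {1..<p})" using p2 by auto
  also have "(\<Sum>k\<in>\<dots>. of_nat (p choose k) * y ^ k * t ^ (p - k)) =
      t ^ p + (y ^ p + (\<Sum>k=1..<p. of_nat (p choose k) * y ^ k * t ^ (p - k)))"
    using p2 by (subst sum.insert; simp)+
  finally have eq: "(y + t) ^ p - y ^ p - t ^ p = (\<Sum>k=1..<p. of_nat (p choose k) * y ^ k * t ^ (p - k))" by simp
  show ?thesis
    unfolding eq
  proof (rule v_sum_ge)
    fix k assume k: "k \<in> {1..<p}"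
    then have "p dvd (p choose k)" using p(1) by (intro dvd_choose_prime) auto
    then obtain q where "p choose k = p * q" by (elim dvdE)
    then have 1: "1 \<le> v (of_nat (p choose k))" using add_mono[OF p(2) v_of_nat[of q]] by (simp add: v_mult)
    obtain j where j: "p - k = Suc j" using k by (cases "p - k") auto
    have 2: "v t \<le> v (t ^ (p - k))" using add_mono[OF order_refl[of "v t"] nonneg[OF t, of j]] by (simp add: j v_mult)
    show "1 + v t \<le> v (of_nat (p choose k) * y ^ k * t ^ (p - k))"
      using add_mono[OF add_mono[OF 1 nonneg[OF y, of k]] 2] by (simp add: v_mult)
  qed
qed

text \<open>Each p-th power gains at least s: a difference of value at least S \<ge> s acquires
  value at least min (1 + S) (p S), and this is at least S + s because s \<le> 1 and p \<ge>
  2.\<close>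

lemma frobenius_contracts:
  assumes p: "prime p" "1 \<le> v (of_nat p)" and x: "0 \<le> v x" and y: "0 \<le> v y"
    and s: "0 < s" "s \<le> 1" "ereal s \<le> v (x - y)"
  shows "ereal (s * real (Suc n)) \<le> v (x ^ (p ^ n) - y ^ (p ^ n))"
proof (induction n)
  case (Suc n)
  define z where "z = y ^ (p ^ n)"
  define t where "t = x ^ (p ^ n) - y ^ (p ^ n)"
  define S where "S = s * real (Suc n)"
  have t: "ereal S \<le> v t" using Suc by (simp add: t_def S_def)
  have S: "s \<le> S" "0 \<le> S" using s by (auto simp: S_def distrib_left)
  have z: "0 \<le> v z" using y by (simp add: z_def v_power)
  have t0: "0 \<le> v t" using t S by (meson ereal_less_eq(5) order_trans)
  have p2: "p \<ge> 2" using p(1) by (rule prime_ge_2_nat)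
  have "ereal 1 + ereal S \<le> 1 + v t" unfolding one_ereal_def using t by (rule add_left_mono)
  also have "\<dots> \<le> v ((z + t) ^ p - z ^ p - t ^ p)" using p z t0 by (rule frobenius_terms)
  finally have 1: "ereal (1 + S) \<le> v ((z + t) ^ p - z ^ p - t ^ p)" by simp
  have "ereal (real p) * ereal S \<le> v (t ^ p)"
    unfolding v_power using t by (rule ereal_mult_left_mono) simp
  then have 2: "ereal (real p * S) \<le> v (t ^ p)" by simp
  have "S + s \<le> 1 + S" using s by simp
  then have 3: "ereal (S + s) \<le> v ((z + t) ^ p - z ^ p - t ^ p)" using 1 by (meson ereal_less_eq(3) order_trans)
  have "2 * S \<le> real p * S" using p2 S by (intro mult_right_mono) auto
  then have "S + s \<le> real p * S" using S by simp
  then have 4: "ereal (S + s) \<le> v (t ^ p)" using 2 by (meson ereal_less_eq(3) order_trans)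
  have "ereal (S + s) \<le> v ((z + t) ^ p - z ^ p - t ^ p + t ^ p)" using 3 4 by (rule v_add_ge)
  moreover have "(z + t) ^ p - z ^ p - t ^ p + t ^ p = x ^ (p ^ Suc n) - y ^ (p ^ Suc n)"
    by (simp add: z_def t_def power_mult mult.commute[of p])
  moreover have "S + s = s * real (Suc (Suc n))" by (simp add: S_def algebra_simps)
  ultimately show ?case by (simp only:)
qed (use s in simp)

text \<open>Modulo elements of positive value x^p - y^p is (x - y)^p, and a power of positive value
  has a base of positive value.\<close>

lemma frobenius_injective:
  assumes p: "prime p" "1 \<le> v (of_nat p)" and x: "0 \<le> v x" and y: "0 \<le> v y"
    and pos: "0 < v (x ^ (p ^ n) - y ^ (p ^ n))"
  shows "0 < v (x - y)"
  using pos
proof (induction n)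
  case (Suc n)
  define z where "z = y ^ (p ^ n)"
  define t where "t = x ^ (p ^ n) - y ^ (p ^ n)"
  have z: "0 \<le> v z" using y by (simp add: z_def v_power)
  have t: "0 \<le> v t" unfolding t_def using x y by (intro v_diff_ge) (auto simp: v_power)
  have "1 \<le> 1 + v t" using add_left_mono[OF t, of 1] by simp
  also have "\<dots> \<le> v ((z + t) ^ p - z ^ p - t ^ p)" using p z t by (rule frobenius_terms)
  finally have "0 < v ((z + t) ^ p - z ^ p - t ^ p)" by (rule less_le_trans[rotated]) simp
  moreover have "0 < v ((z + t) ^ p - z ^ p)"
    using Suc.prems by (simp add: z_def t_def power_mult mult.commute[of p])
  ultimately have "0 < v ((z + t) ^ p - z ^ p - ((z + t) ^ p - z ^ p - t ^ p))" by (rule v_diff_gt[rotated])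
  then have "0 < ereal (real p) * v t" by (simp add: v_power)
  moreover have "v t \<noteq> 0"
  proof
    assume "v t = 0"
    then show False using \<open>0 < ereal (real p) * v t\<close> by simp
  qed
  ultimately have "0 < v t" using t by (simp only: less_le) simp
  then show ?case using Suc.IH by (simp add: t_def)
qed simp

end

context Cp
begin

lemma residue_int:
  assumes "0 \<le> v (of_rat r)"
  shows "\<exists>b::int. 0 < v (of_rat r - of_int b)"
proof -
  obtain a b :: int where ab: "b > 0" "\<not> int p dvd b" "r = of_int a / of_int b"
    using assms by (auto simp: v_of_rat_ge0_iff Z_loc_def)
  then have "coprime (int p) b" using prime_p by (simp add: prime_imp_coprime)
  then obtain s t where st: "s * int p + t * b = 1" by (metis bezout_int coprime_iff_gcd_eq_1 mult.commute)
  have b0: "v (of_int b) = 0" using v_rat[of b 1] ab by (simp add: not_dvd_imp_multiplicity_0 zero_ereal_def)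
  have "of_int (s * int p + t * b) = (of_int 1 :: 'a)" using st by simp
  then have eq: "1 - of_int t * of_int b = (of_nat p * of_int s :: 'a)" by (simp add: algebra_simps)
  have "of_rat r - of_int (a * t) = (of_nat p * (of_int s * of_int a)) / (of_int b :: 'a)"
  proof -
    have "of_rat r - of_int (a * t) = of_int a * (1 - of_int t * of_int b) / (of_int b :: 'a)"
    proof -
      have "of_rat r = (of_int a / of_int b :: 'a)" by (simp add: ab(3) of_rat_divide)
      then show ?thesis using ab(1) by (simp add: field_simps)
    qed
    then show ?thesis unfolding eq by (simp add: mult_ac)
  qed
  moreover have "0 < v (of_nat p * (of_int s * of_int a))"
    by (rule v_p_mult_pos) (simp add: v_mult v_of_int)
  ultimately have "0 < v (of_rat r - of_int (a * t))" using b0 ab by (simp add: v_divide)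
  then show ?thesis by blast
qed

text \<open>Divide an equation for c by its last coefficient of least value, with index t. The later
  coefficients then have positive value, so the reduced equation is monic of degree t.\<close>

lemma algebraic_residue_relation:
  assumes c: "algebraic c" "v c = 0"
  shows "\<exists>t b. 0 < (t::nat) \<and> 0 < v (c ^ t - (\<Sum>i<t. of_int (b i) * c ^ i))"
proof -
  obtain f :: "rat poly" where f: "f \<noteq> 0" "poly (map_poly of_rat f) c = 0"
    using c algebraic_iff_rat_poly by blast
  let ?a = "\<lambda>i. of_rat (coeff f i) :: 'a"
  have sum: "(\<Sum>i\<le>degree f. ?a i * c ^ i) = 0"
    using f(2) by (simp add: poly_altdef coeff_map_poly degree_map_poly)
  define m where "m = Min ((\<lambda>i. v (?a i)) ` {..degree f})"
  have "m \<in> (\<lambda>i. v (?a i)) ` {..degree f}" unfolding m_def by (rule Min_in) auto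
  then have ex: "{i. i \<le> degree f \<and> v (?a i) = m} \<noteq> {}" by auto
  define t where "t = Max {i. i \<le> degree f \<and> v (?a i) = m}"
  have "t \<in> {i. i \<le> degree f \<and> v (?a i) = m}" unfolding t_def by (rule Max_in) (use ex in auto)
  then have t: "t \<le> degree f" "v (?a t) = m" by auto
  have m_le: "m \<le> v (?a i)" for i
  proof (cases "i \<le> degree f")
    case True
    then show ?thesis unfolding m_def by (intro Min_le) auto
  qed (simp add: coeff_eq_0)
  have m_less: "m < v (?a i)" if "t < i" "i \<le> degree f" for i
  proof (rule ccontr)
    assume "\<not> ?thesis"
    then have "v (?a i) = m" using m_le[of i] by (simp add: less_le)
    then have "i \<le> t" unfolding t_def using that by (intro Max_ge) auto
    then show False using that by simp
  qed
  have "v (?a (degree f)) \<noteq> \<infinity>" using f by simp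
  then have at: "?a t \<noteq> 0" using m_le[of "degree f"] t by (metis ereal_infty_less_eq(1) v_inf_iff)
  then obtain x where x: "m = ereal x" using t v_realE by metis
  have quot: "v (?a i / ?a t) = v (?a i) - m" for i using at t by (simp add: v_divide)
  have ge: "0 \<le> v (?a i / ?a t)" for i unfolding quot using m_le[of i] x by (cases "v (?a i)") auto
  have gt: "0 < v (?a i / ?a t)" if "t < i" "i \<le> degree f" for i
    unfolding quot using m_less[OF that] x by (cases "v (?a i)") auto
  have "\<exists>b::int. 0 < v (- (?a i / ?a t) - of_int b)" for i
    using residue_int[of "- (coeff f i / coeff f t)"] ge[of i] by (simp add: of_rat_minus of_rat_divide)
  then obtain b :: "nat \<Rightarrow> int" where b: "\<And>i. 0 < v (- (?a i / ?a t) - of_int (b i))" by metis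
  have pow: "v (c ^ i) = 0" for i using c by (simp add: v_power)
  have "(\<Sum>i\<le>degree f. (?a i / ?a t) * c ^ i) = (\<Sum>i\<le>degree f. ?a i * c ^ i) / ?a t"
    by (simp add: sum_divide_distrib)
  also have "\<dots> = 0" using sum by simp
  finally have "0 = (\<Sum>i\<le>degree f. (?a i / ?a t) * c ^ i)" by simp
  also have "{..degree f} = insert t ({..<t} \<union> {t<..degree f})" using t by auto
  also have "(\<Sum>i\<in>\<dots>. (?a i / ?a t) * c ^ i) =
      c ^ t + ((\<Sum>i<t. (?a i / ?a t) * c ^ i) + (\<Sum>i\<in>{t<..degree f}. (?a i / ?a t) * c ^ i))"
    using at by (subst sum.insert; simp; subst sum.union_disjoint; auto)
  finally have ct: "c ^ t - (\<Sum>i<t. of_int (b i) * c ^ i) =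
      (\<Sum>i<t. (- (?a i / ?a t) - of_int (b i)) * c ^ i) - (\<Sum>i\<in>{t<..degree f}. (?a i / ?a t) * c ^ i)"
    by (simp add: left_diff_distrib sum_subtractf sum_negf eq_neg_iff_add_eq_0 algebra_simps)
  have "0 < v (c ^ t - (\<Sum>i<t. of_int (b i) * c ^ i))"
    unfolding ct using b gt
    by (intro v_diff_gt v_sum_gt) (simp_all add: v_mult pow del: times_divide_eq_left)
  \<comment> \<open>For t = 0 the difference would be 1, whose value is not positive.\<close>
  moreover have "0 < t"
  proof (rule ccontr)
    assume "\<not> 0 < t"
    then show False using calculation by simp
  qed
  ultimately show ?thesis by blast
qed

text \<open>The residue of c generates a finite ring over the prime field, so two of its Frobenius
  iterates coincide; injectivity of Frobenius cancels the smaller exponent.\<close>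

lemma residue_periodic:
  assumes c: "algebraic c" "v c = 0"
  shows "\<exists>j>0. 0 < v (c ^ (p ^ j) - c)"
proof -
  obtain t b where t: "0 < (t::nat)" and ct: "0 < v (c ^ t - (\<Sum>i<t. of_int (b i) * c ^ i))"
    using algebraic_residue_relation[OF assms] by blast
  have pow: "v (c ^ i) = 0" for i using c by (simp add: v_power)
  have ex: "\<exists>d::nat \<Rightarrow> int. 0 < v (c ^ k - (\<Sum>i<t. of_int (d i) * c ^ i))" for k
  proof (induction k)
    case 0
    have "(\<Sum>i<t. of_int (if i = 0 then 1 else 0) * c ^ i) = (1::'a)"
      using t by (simp add: if_distrib[of of_int] if_distrib[of "\<lambda>x. x * _"] cong: if_cong)
    then show ?case by (intro exI[of _ "\<lambda>i. if i = 0 then 1 else 0"]) simp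
  next
    case (Suc k)
    then obtain d :: "nat \<Rightarrow> int" where d: "0 < v (c ^ k - (\<Sum>i<t. of_int (d i) * c ^ i))" by blast
    obtain m where m: "t = Suc m" using t by (cases t) auto
    define d' where "d' i = (if i = 0 then 0 else d (i - 1)) + d m * b i" for i
    have "(\<Sum>i<t. of_int (if i = 0 then 0 else d (i - 1)) * c ^ i) = (\<Sum>i<m. of_int (d i) * c ^ Suc i)"
      unfolding m sum.lessThan_Suc_shift by simp
    then have "(\<Sum>i<t. of_int (d' i) * c ^ i) =
        (\<Sum>i<m. of_int (d i) * c ^ Suc i) + of_int (d m) * (\<Sum>i<t. of_int (b i) * c ^ i)"
      by (simp add: d'_def distrib_right sum.distrib sum_distrib_left mult.assoc)
    moreover have "c * (\<Sum>i<t. of_int (d i) * c ^ i) = (\<Sum>i<m. of_int (d i) * c ^ Suc i) + of_int (d m) * c ^ t"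
      by (simp add: m sum_distrib_left distrib_left mult_ac)
    ultimately have eq: "c ^ Suc k - (\<Sum>i<t. of_int (d' i) * c ^ i) =
        c * (c ^ k - (\<Sum>i<t. of_int (d i) * c ^ i)) + of_int (d m) * (c ^ t - (\<Sum>i<t. of_int (b i) * c ^ i))"
      by (simp add: algebra_simps)
    have "0 < v (c ^ Suc k - (\<Sum>i<t. of_int (d' i) * c ^ i))"
      unfolding eq using d ct c v_of_int[of "d m"] by (intro v_add_gt) (auto simp: v_mult add_nonneg_pos)
    then show ?case by blast
  qed
  obtain d where d: "\<And>k. 0 < v (c ^ k - (\<Sum>i<t. of_int (d k i) * c ^ i))" using ex by metis
  \<comment> \<open>Coefficient vectors modulo p; \<open>restrict\<close> makes them members of a
    finite product set, to which the pigeonhole principle applies.\<close>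
  define g where "g k = restrict (\<lambda>i. d (p ^ k) i mod int p) {..<t}" for k
  have "range g \<subseteq> {..<t} \<rightarrow>\<^sub>E {0..<int p}"
    by (auto simp: g_def PiE_iff extensional_def split: if_splits)
  then have "finite (range g)" by (rule finite_subset) (auto intro: finite_PiE)
  then have "\<not> inj g" using finite_imageD infinite_UNIV_nat by blast
  then obtain k l where kl: "k < l" "g k = g l" by (metis injI linorder_neqE_nat)
  have "0 < v (of_int (d (p ^ l) i) - of_int (d (p ^ k) i))" if "i < t" for i
  proof -
    have "d (p ^ l) i mod int p = d (p ^ k) i mod int p"
      using fun_cong[OF kl(2), of i] that by (simp add: g_def)
    then have "int p dvd d (p ^ l) i - d (p ^ k) i" by (simp add: mod_eq_dvd_iff)
    then obtain j where j: "d (p ^ l) i - d (p ^ k) i = int p * j" by (elim dvdE)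
    have "of_int (d (p ^ l) i) - of_int (d (p ^ k) i) = (of_nat p * of_int j :: 'a)"
      using arg_cong[OF j, of "of_int :: int \<Rightarrow> 'a"] by simp
    then show ?thesis using v_p_mult_pos v_of_int by metis
  qed
  then have "0 < v (\<Sum>i<t. (of_int (d (p ^ l) i) - of_int (d (p ^ k) i)) * c ^ i)"
    by (intro v_sum_gt) (auto simp: v_mult pow)
  then have "0 < v (c ^ (p ^ l) - (\<Sum>i<t. of_int (d (p ^ l) i) * c ^ i) - (c ^ (p ^ k) - (\<Sum>i<t. of_int (d (p ^ k) i) * c ^ i)) +
      (\<Sum>i<t. (of_int (d (p ^ l) i) - of_int (d (p ^ k) i)) * c ^ i))"
    by (rule v_add_gt[OF v_diff_gt[OF d d]])
  then have "0 < v (c ^ (p ^ l) - c ^ (p ^ k))" by (simp add: left_diff_distrib sum_subtractf)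
  also have "c ^ (p ^ l) = (c ^ (p ^ (l - k))) ^ (p ^ k)"
    using kl(1) by (simp flip: power_mult power_add)
  finally have pos: "0 < v ((c ^ (p ^ (l - k))) ^ (p ^ k) - c ^ (p ^ k))" .
  have "0 < v (c ^ (p ^ (l - k)) - c)"
    by (rule frobenius_injective[OF prime_p _ _ _ pos]) (simp_all add: pow c)
  then show ?thesis using kl(1) zero_less_diff by blast
qed

text \<open>Since K is algebraically closed, f(c) is a unit times the product of the c - r over the
  roots; one factor must have positive value.\<close>

lemma ex_close_root:
  assumes "v (lead_coeff f) = 0" "0 < v (poly f c)"
  shows "\<exists>\<zeta>. poly f \<zeta> = 0 \<and> 0 < v (c - \<zeta>)"
  using assms
proof (induction f rule: linear_factor_induct)
  case (linear r f)
  have lc: "lead_coeff ([:- r, 1:] * f) = lead_coeff f" by (simp only: lead_coeff_mult) simp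
  show ?case
  proof (cases "0 < v (c - r)")
    case True
    then show ?thesis by (intro exI[of _ r]) simp
  next
    case False
    have eval: "poly ([:- r, 1:] * f) c = (c - r) * poly f c" by (simp add: algebra_simps)
    have "0 < v (c - r) + v (poly f c)" using linear.prems(2) unfolding eval v_mult .
    then have "0 < v (poly f c)" using False by (cases "v (c - r)"; cases "v (poly f c)") auto
    then obtain \<zeta> where "poly f \<zeta> = 0" "0 < v (c - \<zeta>)" using linear.IH linear.prems(1) lc by auto
    then show ?thesis by (intro exI[of _ \<zeta>]) simp
  qed
qed auto

text \<open>The residue of c, taken from an algebraic approximation, is fixed by a power of
  Frobenius; a nearby root of X^(p^j) - X is a Teichmueller representative.\<close>

lemma ex_teichmueller:
  assumes "v c = 0"
  shows "\<exists>\<zeta>. \<exists>j>0. \<zeta> ^ (p ^ j) = \<zeta> \<and> 0 < v (c - \<zeta>) \<and> 0 \<le> v \<zeta>"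
proof -
  obtain a where a: "algebraic a" "ereal 1 \<le> v (c - a)" using algebraic_dense by blast
  have ca: "0 < v (c - a)" using a(2) by (rule less_le_trans[rotated]) simp
  have "v a = 0" using v_eq_if_close[of c a] ca assms v_diff_commute[of a c] by simp
  then obtain j where j: "j > 0" "0 < v (a ^ (p ^ j) - a)" using residue_periodic[OF a(1)] by blast
  define f :: "'a poly" where "f = monom 1 (p ^ j) + [:0, -1:]"
  have "p ^ 1 \<le> p ^ j" using j by (intro power_increasing) (auto simp: Suc_leI)
  then have pj: "1 < p ^ j" using prime_gt_1_nat[OF prime_p] by simp
  then have "degree f = p ^ j" unfolding f_def by (subst degree_add_eq_left) (auto simp: degree_monom_eq)
  moreover have "coeff [:0, -1 :: 'a:] (p ^ j) = 0" by (rule coeff_eq_0) (use pj in simp)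
  ultimately have "lead_coeff f = 1" by (simp add: f_def)
  then obtain \<zeta> where \<zeta>: "poly f \<zeta> = 0" "0 < v (a - \<zeta>)"
    using ex_close_root[of f a] j by (auto simp: f_def poly_monom)
  have "0 < v (c - a + (a - \<zeta>))" using ca \<zeta>(2) by (rule v_add_gt)
  moreover have "0 \<le> v (a - (a - \<zeta>))" by (rule v_diff_ge) (use \<open>v a = 0\<close> \<zeta>(2) in auto)
  moreover have "\<zeta> ^ (p ^ j) = \<zeta>" using \<zeta>(1) by (simp add: f_def poly_monom)
  moreover have "c - a + (a - \<zeta>) = c - \<zeta>" "a - (a - \<zeta>) = \<zeta>" by simp_all
  ultimately have "\<zeta> ^ (p ^ j) = \<zeta> \<and> 0 < v (c - \<zeta>) \<and> 0 \<le> v \<zeta>" by (simp only:)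
  then show ?thesis using j(1) by blast
qed

end

section \<open>Every discrete valuation ring arises\<close>

locale Cp_ext = Cp_W p v \<omega> e + u: pval u
  for p :: nat and v :: "'a::field_char_0 \<Rightarrow> ereal" and \<omega> e and u :: "'a poly \<Rightarrow> ereal" +
  assumes u_const: "u [:c:] = v c"
    and u_rat: "u (map_poly of_rat f) = \<omega> (Fract f 1)"
begin

text \<open>X is regarded as a point outside K, and \<open>D r\<close> measures its distance from
  r.\<close>

definition D :: "'a \<Rightarrow> ereal" where
  "D r = u [:- r, 1:]"

lemma D_ge: "min (D s) (v (r - s)) \<le> D r"
  using u.v_add[of "[:- s, 1:]" "[:s - r:]"] v_diff_commute[of s r] by (simp add: D_def u_const)

lemma v_ge_D: "min (D r) (D s) \<le> v (r - s)"
  using u.v_diff[of "[:- s, 1:]" "[:- r, 1:]"] by (simp add: D_def u_const min.commute)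

lemma D_eq_at_maximum:
  assumes max: "\<And>r. D r \<le> D \<alpha>"
  shows "D r = min (D \<alpha>) (v (\<alpha> - r))"
proof (rule antisym)
  show "D r \<le> min (D \<alpha>) (v (\<alpha> - r))"
    using max[of r] v_ge_D[of \<alpha> r] by (simp add: min_def split: if_splits)
  show "min (D \<alpha>) (v (\<alpha> - r)) \<le> D r" using D_ge[of \<alpha> r] v_diff_commute[of r] by simp
qed

lemma \<omega>_Fract: "g \<noteq> 0 \<Longrightarrow> \<omega> (Fract f g) = \<omega> (Fract f 1) - \<omega> (Fract g 1)"
proof -
  assume g: "g \<noteq> 0"
  then have "Fract g 1 \<noteq> 0" by (simp add: Zero_fract_def eq_fract)
  moreover have "Fract f g = Fract f 1 / Fract g 1" by simp
  ultimately show ?thesis by (metis \<omega>.v_divide)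
qed

lemma \<omega>_poly_finite: "f \<noteq> 0 \<Longrightarrow> \<omega> (Fract f 1) \<noteq> \<infinity>"
  by (simp add: Zero_fract_def eq_fract)

lemma valuation_ring_eq_Zring:
  assumes "\<And>f. vpoly v \<alpha> \<delta> f = \<omega> (Fract f 1)" "\<delta> = None \<Longrightarrow> \<not> algebraic \<alpha>"
  shows "{x. 0 \<le> \<omega> x} = Zring v \<alpha> \<delta>"
proof -
  interpret dom: domval "vpoly v \<alpha> \<delta>" using assms(2) by (rule domval_vpoly)
  have "fract_val (vpoly v \<alpha> \<delta>) x = \<omega> x" for x
  proof (cases x)
    case (Fract f g)
    then show ?thesis by (simp add: dom.fract_val_Fract \<omega>_Fract[of g f] assms(1))
  qed
  then show ?thesis using Zring_eq[OF dom.domval_axioms] by simp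
qed

text \<open>Here u is evaluation at \<alpha>, and \<alpha> is transcendental because \<omega> is
  finite on non-zero polynomials. Approximating polynomials over Q_p by rational ones gives e as a
  bound for the ramification index.\<close>

lemma maximum_infinite:
  assumes max: "D \<alpha> = \<infinity>"
  shows "\<alpha> \<in> Cp_br v \<and> admissible v \<alpha> None \<and> {x. 0 \<le> \<omega> x} = Zring v \<alpha> None"
proof -
  have Dv: "D r = vK v \<alpha> None [:- r, 1:]" for r
    using D_eq_at_maximum[of \<alpha> r] max by (simp add: vK_linear ext_val_def)
  have "u f = vK v \<alpha> None f" for f
    by (rule poly_valuation_eq) (simp_all add: u.v_mult pval.v_mult[OF pval_vK] u_const Dv[unfolded D_def])
  from this[of "map_poly of_rat _"] have eq: "vpoly v \<alpha> None f = \<omega> (Fract f 1)" for f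
    by (simp add: vpoly_eq_vK flip: u_rat)
  have trans: "\<not> algebraic \<alpha>"
  proof
    assume "algebraic \<alpha>"
    then obtain f :: "rat poly" where f: "f \<noteq> 0" "poly (map_poly of_rat f) \<alpha> = 0"
      using algebraic_iff_rat_poly by blast
    then have "\<omega> (Fract f 1) = \<infinity>" using eq[of f] by (simp add: vpoly_def)
    then show False using \<omega>_poly_finite f(1) by blast
  qed
  have disc: "\<exists>k::int. v (poly P \<alpha>) = ereal (of_int k / real e)"
    if P: "\<And>i. coeff P i \<in> Qp_in v" and nz: "poly P \<alpha> \<noteq> 0" for P
  proof -
    obtain r where r: "v (poly P \<alpha>) = ereal r" using nz by (rule v_realE)
    obtain f where f: "ereal (r + 1) \<le> vK v \<alpha> None (P - map_poly of_rat f)"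
      using approximate_by_rational_poly[OF pval_vK vK_const pval_vK vK_const P] by blast
    have "ereal r < ereal (r + 1)" by simp
    also have "\<dots> \<le> v (poly (map_poly of_rat f) \<alpha> - poly P \<alpha>)"
      using f v_diff_commute[of "poly P \<alpha>"] by (simp add: vK_def)
    finally have "v (poly P \<alpha>) < v (poly (map_poly of_rat f) \<alpha> - poly P \<alpha>)" using r by simp
    then have vf: "v (poly (map_poly of_rat f) \<alpha>) = ereal r" using v_eq_if_close r by metis
    then have "f \<noteq> 0" by auto
    then have "Fract f 1 \<noteq> 0" by (simp add: Zero_fract_def eq_fract)
    then obtain k :: int where "\<omega> (Fract f 1) = ereal (of_int k / real e)" using \<omega>.discrete by blast
    then show ?thesis using eq[of f] vf r by (auto simp: vpoly_def)
  qed
  have "\<alpha> \<in> Cp_br v"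
    unfolding Cp_br_def
  proof (intro CollectI exI[of _ e] conjI ballI impI)
    show "e > 0" by (rule \<omega>.e_pos)
    fix y assume y: "y \<in> Qp_adj v \<alpha>" "y \<noteq> 0"
    then obtain P Q where PQ: "\<And>i. coeff P i \<in> Qp_in v" "\<And>i. coeff Q i \<in> Qp_in v" "poly Q \<alpha> \<noteq> 0" "y = poly P \<alpha> / poly Q \<alpha>"
      unfolding Qp_adj_def by blast
    then have "poly P \<alpha> \<noteq> 0" using y by auto
    then obtain k l :: int where "v (poly P \<alpha>) = ereal (of_int k / real e)" "v (poly Q \<alpha>) = ereal (of_int l / real e)"
      using disc PQ by meson
    then show "\<exists>k::int. ereal (real e) * v y = ereal (of_int k)"
      using PQ(3) \<omega>.e_pos by (intro exI[of _ "k - l"]) (simp add: PQ(4) v_divide right_diff_distrib)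
  qed
  then show ?thesis using trans valuation_ring_eq_Zring[OF eq] by (simp add: admissible_def)
qed

text \<open>The centre may be moved to an algebraic \<beta> in the ball. To see that d is rational,
  evaluate at a rational polynomial vanishing at \<beta>: its value is rational and has the form q +
  m d with m > 0, where m counts the factors X - r with D r = d.\<close>

lemma maximum_finite:
  assumes max: "\<And>r. D r \<le> D \<alpha>" and fin: "D \<alpha> = ereal d"
  shows "\<exists>\<alpha> \<delta>. \<alpha> \<in> Cp_br v \<and> admissible v \<alpha> \<delta> \<and> {x. 0 \<le> \<omega> x} = Zring v \<alpha> \<delta>"
proof -
  obtain \<beta> where \<beta>: "algebraic \<beta>" "ereal d \<le> v (\<alpha> - \<beta>)" using algebraic_dense by blast
  have D\<beta>: "D \<beta> = ereal d" using D_eq_at_maximum[OF max, of \<beta>] \<beta>(2) fin by (simp add: min_def)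
  then have D: "D r = min (ereal d) (v (\<beta> - r))" for r using D_eq_at_maximum[of \<beta> r] max fin by simp
  obtain f :: "rat poly" where f: "f \<noteq> 0" "poly (map_poly of_rat f) \<beta> = 0"
    using \<beta>(1) algebraic_iff_rat_poly by blast
  have rat: "\<exists>q::rat. v c = ereal (of_rat q)" if c: "c \<noteq> 0" for c
  proof -
    obtain k :: int and b :: nat where "v c = ereal (of_int k / real b)" using v_rational[OF c] by blast
    then show ?thesis by (intro exI[of _ "of_int k / of_nat b"]) (simp add: of_rat_divide)
  qed
  have "g \<noteq> 0 \<longrightarrow> (\<exists>(m::nat) (q::rat). u g = ereal (of_rat q + real m * d) \<and> (poly g \<beta> = 0 \<longrightarrow> 0 < m))" for g
  proof (induction g rule: linear_factor_induct)
    case (const c)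
    show ?case
    proof
      assume "[:c:] \<noteq> 0"
      then obtain q :: rat where "v c = ereal (of_rat q)" using rat by auto
      then show "\<exists>(m::nat) (q::rat). u [:c:] = ereal (of_rat q + real m * d) \<and> (poly [:c:] \<beta> = 0 \<longrightarrow> 0 < m)"
        using \<open>[:c:] \<noteq> 0\<close> by (intro exI[of _ 0] exI[of _ q]) (auto simp: u_const)
    qed
  next
    case (linear r g)
    then obtain m :: nat and q :: rat where mq: "u g = ereal (of_rat q + real m * d)" "poly g \<beta> = 0 \<longrightarrow> 0 < m" by blast
    have ug: "u ([:- r, 1:] * g) = D r + u g" by (simp only: u.v_mult D_def)
    have ev: "poly ([:- r, 1:] * g) \<beta> = (\<beta> - r) * poly g \<beta>" by (simp add: algebra_simps)
    show ?case
    proof (cases "D r = ereal d")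
      case True
      then have "u ([:- r, 1:] * g) = ereal (of_rat q + real (Suc m) * d)" using ug mq by (simp add: algebra_simps)
      then show ?thesis by blast
    next
      case False
      then have less: "D r = v (\<beta> - r)" "\<beta> - r \<noteq> 0" using D[of r] by (auto simp: min_def split: if_splits)
      then obtain q' :: rat where "D r = ereal (of_rat q')" using rat[of "\<beta> - r"] by auto
      then have "u ([:- r, 1:] * g) = ereal (of_rat (q' + q) + real m * d)" using ug mq by (simp add: of_rat_add)
      then show ?thesis using mq(2) less(2) unfolding ev by (metis mult_eq_0_iff)
    qed
  qed
  then obtain m :: nat and q :: rat where mq: "\<omega> (Fract f 1) = ereal (of_rat q + real m * d)" "0 < m"
    using f u_rat[of f] by (metis map_poly_of_rat_eq_0_iff)
  have "Fract f 1 \<noteq> 0" using f by (simp add: Zero_fract_def eq_fract)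
  then obtain k :: int where "\<omega> (Fract f 1) = ereal (of_int k / real e)" using \<omega>.discrete by blast
  then have "of_rat q + real m * d = of_int k / real e" using mq by simp
  then have "d = (of_int k / real e - of_rat q) / real m" using mq(2) by (simp add: field_simps)
  also have "\<dots> = of_rat ((of_int k / of_nat e - q) / of_nat m)" by (simp add: of_rat_divide of_rat_diff)
  finally obtain d' :: rat where d': "d = of_rat d'" by blast
  have Dv: "D r = vK v \<beta> (Some d') [:- r, 1:]" for r using D[of r] by (simp add: vK_linear ext_val_def d')
  have "u g = vK v \<beta> (Some d') g" for g
    by (rule poly_valuation_eq) (simp_all add: u.v_mult pval.v_mult[OF pval_vK] u_const Dv[unfolded D_def])
  from this[of "map_poly of_rat _"] have "vpoly v \<beta> (Some d') g = \<omega> (Fract g 1)" for g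
    by (simp add: vpoly_eq_vK flip: u_rat)
  then have "{x. 0 \<le> \<omega> x} = Zring v \<beta> (Some d')" by (rule valuation_ring_eq_Zring) simp
  moreover have "alg_over (Qp_in v) \<beta>"
    unfolding alg_over_def using f by (intro exI[of _ "map_poly of_rat f"]) (auto simp: coeff_map_poly of_rat_in_Qp)
  ultimately show ?thesis using alg_over_Qp_in_Cp_br by (auto simp: admissible_def intro!: exI[of _ \<beta>] exI[of _ "Some d'"])
qed

lemma unbounded_imp_attained:
  assumes "\<And>M::real. \<exists>r. ereal M \<le> D r"
  shows "\<exists>\<alpha>. D \<alpha> = \<infinity>"
proof -
  have "\<forall>n::nat. \<exists>r. ereal (real n) \<le> D r" using assms by blast
  then obtain r where r: "\<And>n::nat. ereal (real n) \<le> D (r n)" by metis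
  have "cauchy r"
    unfolding cauchy_def
  proof
    fix M :: real
    obtain N :: nat where N: "M \<le> real N" using real_arch_simple by blast
    have large: "ereal M \<le> D (r n)" if "n \<ge> N" for n
    proof -
      have "ereal M \<le> ereal (real n)" using N that by simp
      then show ?thesis using r[of n] by (rule order_trans)
    qed
    have "ereal M \<le> v (r m - r n)" if "m \<ge> N" "n \<ge> N" for m n
      using large[OF that(1)] large[OF that(2)] v_ge_D[of "r m" "r n"] by (meson min.boundedI order_trans)
    then show "\<exists>N. \<forall>m\<ge>N. \<forall>n\<ge>N. ereal M \<le> v (r m - r n)" by blast
  qed
  then obtain \<alpha> where \<alpha>: "converges r \<alpha>" using cauchy_converges by blast
  have "ereal M \<le> D \<alpha>" for M
  proof -
    obtain N where N: "\<forall>n\<ge>N. ereal M \<le> v (r n - \<alpha>)" using \<alpha> unfolding converges_def by blast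
    obtain N' :: nat where N': "M \<le> real N'" using real_arch_simple by blast
    define n where "n = max N N'"
    have "ereal M \<le> ereal (real n)" using N' by (simp add: n_def)
    then have "ereal M \<le> D (r n)" using r[of n] by (rule order_trans)
    moreover have "ereal M \<le> v (\<alpha> - r n)" using N v_diff_commute[of \<alpha>] by (simp add: n_def)
    ultimately show ?thesis using D_ge[of "r n" \<alpha>] by (meson min.boundedI order_trans)
  qed
  then show ?thesis using ereal_top by blast
qed

end

text \<open>The remaining case, a bounded supremum that is not attained, is excluded as follows. Such a valuation is
  immediate over the large field. Hence the closure \<open>C\<close> of the rational function field contains
  Teichmueller representatives of all its residues, and every element of \<open>C\<close> is approximated modulo any
  power of \<open>p\<close> by combinations of \<open>e\<close> powers of a uniformizer. So the powers of \<open>X\<close> up to exponent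
  \<open>e\<close> satisfy approximate linear relations of arbitrary precision, and a polynomial of bounded degree would
  have arbitrarily large value.\<close>

locale Cp_type4 = Cp_ext p v \<omega> e u
  for p :: nat and v :: "'a::field_char_0 \<Rightarrow> ereal" and \<omega> e u +
  fixes B :: real
  assumes not_attained: "\<exists>s. D r < D s" and bounded: "D r \<le> ereal B"
begin

lemma D_not_MInf: "D r \<noteq> -\<infinity>"
  by (simp add: D_def)

lemma D_finite: "\<exists>x. D r = ereal x"
  using bounded[of r] D_not_MInf[of r] by (cases "D r") auto

lemma u_finite: "f \<noteq> 0 \<Longrightarrow> u f \<noteq> \<infinity>"
proof (induction f rule: linear_factor_induct)
  case (linear r f)
  have "u ([:- r, 1:] * f) = D r + u f" by (simp only: u.v_mult D_def)
  then show ?case using linear D_finite[of r] by (cases "u f") auto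
qed (simp add: u_const)

sublocale domval u
  by unfold_locales (use u_finite in blast)

abbreviation U :: "'a poly fract \<Rightarrow> ereal" where
  "U \<equiv> fract_val u"

sublocale U: fval U
  by (rule fval_fract_val)

lemma U_poly: "U (Fract f 1) = u f"
  by (simp add: fract_val_Fract)

lemma U_emb [simp]: "U (emb c) = v c"
  by (simp add: emb_def U_poly u_const)

lemma U_lift [simp]: "U (lift z) = \<omega> z"
proof (cases z)
  case (Fract f g)
  then show ?thesis by (simp add: lift_Fract fract_val_Fract u_rat \<omega>_Fract[of g f])
qed

text \<open>For a product, (X - t) f - (r - t) f(r) = (X - t) (f - f(r)) + (X - r) f(r). Both terms
  have larger value once r is closer to X than t and than the bound s for \<open>f\<close>.\<close>

lemma immediate_poly:
  "f \<noteq> 0 \<Longrightarrow> \<exists>s. \<forall>r. D s < D r \<longrightarrow> u f < u (f - [:poly f r:])"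
proof (induction f rule: linear_factor_induct)
  case (const c)
  then show ?case by (auto simp: u_const)
next
  case (linear t f)
  then obtain s where s: "\<And>r. D s < D r \<Longrightarrow> u f < u (f - [:poly f r:])" by blast
  define s' where "s' = (if D s \<le> D t then t else s)"
  have s': "D s \<le> D s'" "D t \<le> D s'" by (auto simp: s'_def)
  have "u ([:- t, 1:] * f) < u ([:- t, 1:] * f - [:poly ([:- t, 1:] * f) r:])" if r: "D s' < D r" for r
  proof -
    have 1: "u f < u (f - [:poly f r:])" using s s'(1) r by (meson le_less_trans)
    have "D t < D r" using s'(2) r by (meson le_less_trans)
    then have 2: "D t < u ([:- t, 1:] - [:r - t:])" by (simp add: D_def)
    obtain x y where xy: "D t = ereal x" "u f = ereal y" using D_finite u_finite linear.hyps u.v_not_MInf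
      by (metis ereal_cases)
    have fr: "u [:poly f r:] = ereal y" using u.v_eq_if_close[of f "[:poly f r:]"] 1 u.v_diff_commute xy(2) by simp
    have eq: "[:- t, 1:] * f - [:poly ([:- t, 1:] * f) r:] =
        [:- t, 1:] * (f - [:poly f r:]) + ([:- t, 1:] - [:r - t:]) * [:poly f r:]"
      by (simp add: algebra_simps)
    have "ereal (x + y) < u ([:- t, 1:] * (f - [:poly f r:]))"
      using 1 xy unfolding u.v_mult D_def[symmetric] by (cases "u (f - [:poly f r:])") auto
    moreover have "ereal (x + y) < u (([:- t, 1:] - [:r - t:]) * [:poly f r:])"
      using 2 xy fr unfolding u.v_mult by (cases "u ([:- t, 1:] - [:r - t:])") auto
    ultimately have "ereal (x + y) < u ([:- t, 1:] * f - [:poly ([:- t, 1:] * f) r:])"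
      unfolding eq by (rule u.v_add_gt)
    moreover have "u ([:- t, 1:] * f) = ereal (x + y)" using xy by (simp only: u.v_mult D_def[symmetric]) simp
    ultimately show ?thesis by (simp only:)
  qed
  then show ?case by blast
qed

text \<open>Since D is not attained, \<open>immediate_poly\<close> supplies constants c and d for
  numerator and denominator. The error of c / d is controlled by d (f - c) - c (g - d).\<close>

lemma immediate:
  assumes "z \<noteq> 0"
  shows "\<exists>c. U z < U (z - emb c)"
proof -
  obtain f g where z: "z = Fract f g" "g \<noteq> 0" by (cases z) auto
  then have "f \<noteq> 0" using assms by (auto simp: Zero_fract_def eq_fract)
  have near: "\<exists>c. u h < u (h - [:c:]) \<and> v c = u h \<and> c \<noteq> 0" if nz: "h \<noteq> 0" for h
  proof -
    obtain s where s: "\<And>r. D s < D r \<Longrightarrow> u h < u (h - [:poly h r:])" using immediate_poly[OF nz] by blast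
    obtain r where "D s < D r" using not_attained by blast
    then have 1: "u h < u (h - [:poly h r:])" by (rule s)
    then have "u [:poly h r:] = u h" using u.v_eq_if_close[of h "[:poly h r:]"] u.v_diff_commute[of h] by simp
    then show ?thesis using 1 u_finite[OF nz] by (intro exI[of _ "poly h r"]) (auto simp: u_const)
  qed
  obtain c where c: "u f < u (f - [:c:])" "v c = u f" using near \<open>f \<noteq> 0\<close> by blast
  obtain d where d: "u g < u (g - [:d:])" "v d = u g" "d \<noteq> 0" using near z(2) by blast
  obtain x y where xy: "u f = ereal x" "u g = ereal y" using w_realE \<open>f \<noteq> 0\<close> z(2) by meson
  have "z - emb (c / d) = Fract (smult d f - smult c g) (smult d g)"
    using z d(3) by (simp add: emb_divide) (simp add: emb_def eq_fract algebra_simps)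
  moreover have eq: "smult d f - smult c g = [:d:] * (f - [:c:]) - [:c:] * (g - [:d:])" by (simp add: algebra_simps)
  have "ereal (x + y) < u ([:d:] * (f - [:c:]))"
    using c d xy unfolding u.v_mult u_const by (cases "u (f - [:c:])") auto
  moreover have "ereal (x + y) < u ([:c:] * (g - [:d:]))"
    using c d xy unfolding u.v_mult u_const by (cases "u (g - [:d:])") auto
  ultimately have "ereal (x + y) < u (smult d f - smult c g)" unfolding eq by (intro u.v_diff_gt)
  moreover have "smult d g \<noteq> 0" using d z by simp
  moreover have "u (smult d g) = ereal (y + y)"
    using u.v_mult[of "[:d:]" g] d xy by (simp add: u_const)
  ultimately have "ereal (x - y) < U (z - emb (c / d))"
    using \<open>z - emb (c / d) = _\<close> by (cases "u (smult d f - smult c g)") (auto simp: fract_val_Fract)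
  moreover have "U z = ereal (x - y)" using z xy by (simp add: fract_val_Fract)
  ultimately show ?thesis by (intro exI[of _ "c / d"]) simp
qed

section \<open>Expansions in a uniformizer over the closure of Q(X)\<close>

definition C :: "'a poly fract set" where
  "C = {z. \<forall>M::real. \<exists>h. ereal M \<le> U (z - lift h)}"

lemma C_D: "z \<in> C \<Longrightarrow> \<exists>h. ereal M \<le> U (z - lift h)"
  by (simp add: C_def)

lemma lift_in_C: "lift h \<in> C"
  unfolding C_def by (auto intro: exI[of _ h])

lemma C_diff:
  assumes "x \<in> C" "y \<in> C"
  shows "x - y \<in> C"
  unfolding C_def
proof (intro CollectI allI)
  fix M :: real
  obtain h k where "ereal M \<le> U (x - lift h)" "ereal M \<le> U (y - lift k)" using C_D assms by meson
  then have "ereal M \<le> U (x - lift h - (y - lift k))" by (rule U.v_diff_ge)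
  then show "\<exists>h. ereal M \<le> U (x - y - lift h)" by (intro exI[of _ "h - k"]) (simp add: algebra_simps)
qed

lemma C_add: "x \<in> C \<Longrightarrow> y \<in> C \<Longrightarrow> x + y \<in> C"
  using C_diff[of x "0 - y"] C_diff[of 0 y] lift_in_C[of 0] by simp

lemma C_sum: "(\<And>i. i \<in> S \<Longrightarrow> f i \<in> C) \<Longrightarrow> sum f S \<in> C"
  by (induction S rule: infinite_finite_induct) (use lift_in_C[of 0] C_add in auto)

lemma C_mult_lift:
  assumes "x \<in> C"
  shows "x * lift g \<in> C"
proof (cases "g = 0")
  case True
  then show ?thesis using lift_in_C[of 0] by simp
next
  case False
  then obtain r where r: "\<omega> g = ereal r" by (rule \<omega>.v_realE)
  show ?thesis unfolding C_def
  proof (intro CollectI allI)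
    fix M :: real
    obtain h where h: "ereal (M - r) \<le> U (x - lift h)" using C_D assms by blast
    have "x * lift g - lift (h * g) = (x - lift h) * lift g" by (simp add: algebra_simps)
    then have "U (x * lift g - lift (h * g)) = U (x - lift h) + ereal r" by (simp only: U.v_mult U_lift r)
    then show "\<exists>h. ereal M \<le> U (x * lift g - lift h)"
      using h by (intro exI[of _ "h * g"]) (cases "U (x - lift h)", auto)
  qed
qed

lemma C_value:
  assumes "x \<in> C" "x \<noteq> 0"
  shows "\<exists>h. h \<noteq> 0 \<and> U x = \<omega> h"
proof -
  obtain r where r: "U x = ereal r" using assms(2) by (rule U.v_realE)
  obtain h where h: "ereal (r + 1) \<le> U (x - lift h)" using C_D assms(1) by blast
  have "ereal r < ereal (r + 1)" by simp
  then have "U x < U (lift h - x)" using h r U.v_diff_commute less_le_trans by metis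
  then have "U (lift h) = U x" by (rule U.v_eq_if_close)
  then have "\<omega> h = U x" by simp
  moreover from this have "h \<noteq> 0" using r by auto
  ultimately show ?thesis by metis
qed

text \<open>Elements of C have the same values as elements of Q(X), so a least positive value k / e
  exists; 1 \<le> e g is just k \<ge> 1.\<close>

lemma ex_uniformizer:
  "\<exists>\<pi> g. \<pi> \<noteq> 0 \<and> \<omega> \<pi> = ereal g \<and> 0 < g \<and> 1 \<le> real e * g \<and> (\<forall>z\<in>C. 0 < U z \<longrightarrow> ereal g \<le> U z)"
proof -
  define P where "P k \<longleftrightarrow> 0 < k \<and> (\<exists>y. y \<noteq> 0 \<and> \<omega> y = ereal (real k / real e))" for k :: nat
  have "\<omega> (const_fract (of_nat p)) = ereal (real e / real e)"
    using \<omega>.e_pos by (simp add: \<omega>_const one_ereal_def)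
  then have "P e" unfolding P_def using \<omega>.e_pos by (auto intro!: exI[of _ "const_fract (of_nat p)"])
  define k where "k = (LEAST k. P k)"
  have k: "P k" unfolding k_def using \<open>P e\<close> by (rule LeastI)
  then obtain \<pi> where \<pi>: "\<pi> \<noteq> 0" "\<omega> \<pi> = ereal (real k / real e)" "0 < k" unfolding P_def by blast
  have "ereal (real k / real e) \<le> U z" if z: "z \<in> C" "0 < U z" for z
  proof (cases "z = 0")
    case False
    then obtain h where h: "h \<noteq> 0" "U z = \<omega> h" using C_value z by blast
    then obtain l :: int where l: "\<omega> h = ereal (of_int l / real e)" using \<omega>.discrete by blast
    then have "0 < l" using z(2) h \<omega>.e_pos by (simp add: zero_less_divide_iff)
    then have "P (nat l)" unfolding P_def using h l by auto
    then have "k \<le> nat l" unfolding k_def by (rule Least_le)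
    then have "real k \<le> of_int l" using \<open>0 < l\<close> by linarith
    then show ?thesis using h l by (simp add: divide_right_mono)
  qed simp
  moreover have "0 < real k / real e" "1 \<le> real e * (real k / real e)" using \<pi>(3) \<omega>.e_pos by auto
  ultimately show ?thesis using \<pi> by blast
qed

text \<open>By immediacy the residue of z is that of a scalar, hence of a Teichmueller element
  \<zeta> fixed by the p^j-th power map. If \<open>lift h\<close> is congruent to \<zeta>, its p^(j
  n)-th powers are again lifts and tend to \<zeta>.\<close>

lemma residue_in_C:
  assumes z: "z \<in> C" "0 \<le> U z"
  shows "\<exists>\<zeta>. emb \<zeta> \<in> C \<and> 0 \<le> v \<zeta> \<and> 0 < U (z - emb \<zeta>)"
proof (cases "0 < U z")
  case True
  then show ?thesis using lift_in_C[of 0] by (intro exI[of _ 0]) simp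
next
  case False
  then have Uz: "U z = 0" using z(2) by (simp add: less_le)
  then have "z \<noteq> 0" by auto
  then obtain c where c: "U z < U (z - emb c)" using immediate by blast
  then have "U (emb c) = U z" using U.v_eq_if_close[of z "emb c"] U.v_diff_commute[of z] by simp
  then have "v c = 0" using Uz by simp
  then obtain \<zeta> j where \<zeta>: "j > 0" "\<zeta> ^ (p ^ j) = \<zeta>" "0 < v (c - \<zeta>)" "0 \<le> v \<zeta>" using ex_teichmueller by blast
  have "0 < U (emb c - emb \<zeta>)" using \<zeta>(3) by (simp flip: emb_simps(6))
  then have z\<zeta>: "0 < U (z - emb c + (emb c - emb \<zeta>))" using c Uz by (intro U.v_add_gt) auto
  obtain h where h: "ereal 1 \<le> U (z - lift h)" using C_D z(1) by blast
  then have "0 < U (z - lift h)" by (rule less_le_trans[rotated]) simp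
  moreover have "0 < U (z - emb \<zeta>)" using z\<zeta> by simp
  ultimately have "0 < U (z - emb \<zeta> - (z - lift h))" by (intro U.v_diff_gt[of 0 "z - emb \<zeta>" "z - lift h"])
  then have hz: "0 < U (lift h - emb \<zeta>)" by simp
  obtain s where s: "0 < s" "s \<le> 1" "ereal s \<le> U (lift h - emb \<zeta>)"
  proof (cases "U (lift h - emb \<zeta>)")
    case (real r)
    then show ?thesis using hz by (intro that[of "min 1 r"]) (auto simp: min_def)
  next
    case PInf
    then show ?thesis by (intro that[of 1]) auto
  qed (use hz in auto)
  have "0 \<le> U (z - (z - lift h))" by (rule U.v_diff_ge) (use z(2) \<open>0 < U (z - lift h)\<close> in auto)
  then have Uh: "0 \<le> U (lift h)" by simp
  have fixed: "\<zeta> ^ (p ^ (j * n)) = \<zeta>" for n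
  proof (induction n)
    case (Suc n)
    have "\<zeta> ^ (p ^ (j * Suc n)) = (\<zeta> ^ (p ^ j)) ^ (p ^ (j * n))"
      by (simp add: power_add flip: power_mult)
    then show ?case using Suc \<zeta>(2) by simp
  qed simp
  have Up: "1 \<le> U (of_nat p)"
  proof -
    have "of_nat p = emb (of_nat p)"
    proof -
      have "emb (of_nat n) = of_nat n" for n by (induction n) auto
      then show ?thesis by simp
    qed
    then show ?thesis by simp
  qed
  have "emb \<zeta> \<in> C"
    unfolding C_def
  proof (intro CollectI allI)
    fix M :: real
    obtain n :: nat where n: "M < real n * s" using reals_Archimedean3[OF s(1)] by blast
    have "ereal (s * real (Suc (j * n))) \<le> U (lift h ^ (p ^ (j * n)) - emb \<zeta> ^ (p ^ (j * n)))"
      by (rule U.frobenius_contracts[OF prime_p Up Uh _ s]) (simp add: \<zeta>)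
    also have "emb \<zeta> ^ (p ^ (j * n)) = emb \<zeta>" using fixed[of n] by (simp flip: emb_power)
    finally have 1: "ereal (s * real (Suc (j * n))) \<le> U (emb \<zeta> - lift (h ^ (p ^ (j * n))))"
      by (simp only: lift_power U.v_diff_commute)
    have "n \<le> j * n" using \<zeta>(1) by simp
    then have "real n \<le> real (Suc (j * n))" by (simp only: of_nat_le_iff)
    then have "real n * s \<le> s * real (Suc (j * n))" using s(1) by (simp add: mult.commute mult_left_mono)
    then have "ereal M \<le> ereal (s * real (Suc (j * n)))" using n by simp
    then show "\<exists>h. ereal M \<le> U (emb \<zeta> - lift h)" using 1 order_trans by blast
  qed
  then show ?thesis using \<zeta>(4) z\<zeta> by (intro exI[of _ \<zeta>]) simp
qed

text \<open>One digit per step: divide the remainder by \<pi>^m and take a representative of its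
  residue.\<close>

lemma expansion_step:
  assumes \<pi>: "\<pi> \<noteq> 0" "\<omega> \<pi> = ereal g" and g: "\<And>z. z \<in> C \<Longrightarrow> 0 < U z \<Longrightarrow> ereal g \<le> U z"
    and z: "z \<in> C" "0 \<le> U z"
  shows "\<exists>c. (\<forall>i. emb (c i) \<in> C \<and> 0 \<le> v (c i)) \<and> ereal (real m * g) \<le> U (z - (\<Sum>i<m. emb (c i) * lift (\<pi> ^ i)))"
proof (induction m)
  case 0
  show ?case using z lift_in_C[of 0] by (intro exI[of _ "\<lambda>_. 0"]) (simp add: zero_ereal_def[symmetric])
next
  case (Suc m)
  then obtain c where c: "\<forall>i. emb (c i) \<in> C \<and> 0 \<le> v (c i)"
    "ereal (real m * g) \<le> U (z - (\<Sum>i<m. emb (c i) * lift (\<pi> ^ i)))" by blast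
  define R where "R = z - (\<Sum>i<m. emb (c i) * lift (\<pi> ^ i))"
  have RC: "R \<in> C" unfolding R_def using z(1) c(1) by (intro C_diff C_sum C_mult_lift) auto
  define S where "S = R * lift (inverse (\<pi> ^ m))"
  have \<pi>m: "\<omega> (\<pi> ^ m) = ereal (real m * g)" by (simp add: \<omega>.v_power \<pi>)
  have nz: "\<pi> ^ m \<noteq> 0" using \<pi> by simp
  have US: "U S = U R - ereal (real m * g)"
    unfolding S_def U.v_mult U_lift \<omega>.v_inverse[OF nz] \<pi>m by (simp add: minus_ereal_def)
  have "S \<in> C" unfolding S_def using RC by (rule C_mult_lift)
  moreover have "0 \<le> U S" unfolding US using c(2) by (cases "U R") (auto simp: R_def[symmetric])
  ultimately obtain \<zeta> where \<zeta>: "emb \<zeta> \<in> C" "0 \<le> v \<zeta>" "0 < U (S - emb \<zeta>)" using residue_in_C by blast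
  have gS: "ereal g \<le> U (S - emb \<zeta>)" using \<open>S \<in> C\<close> \<zeta> by (intro g C_diff)
  have SR: "S * lift (\<pi> ^ m) = R"
  proof -
    have "lift (inverse (\<pi> ^ m)) * lift (\<pi> ^ m) = lift (inverse (\<pi> ^ m) * \<pi> ^ m)" by (simp only: lift_simps)
    also have "\<dots> = 1" using nz by simp
    finally show ?thesis by (simp only: S_def mult.assoc mult_1_right)
  qed
  define c' where "c' = c(m := \<zeta>)"
  have "(\<Sum>i<m. emb (c' i) * lift (\<pi> ^ i)) = (\<Sum>i<m. emb (c i) * lift (\<pi> ^ i))"
    by (intro sum.cong) (auto simp: c'_def)
  then have "z - (\<Sum>i<Suc m. emb (c' i) * lift (\<pi> ^ i)) = R - emb \<zeta> * lift (\<pi> ^ m)"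
    by (simp add: R_def c'_def)
  also have "\<dots> = (S - emb \<zeta>) * lift (\<pi> ^ m)" by (simp only: left_diff_distrib SR)
  finally have "U (z - (\<Sum>i<Suc m. emb (c' i) * lift (\<pi> ^ i))) = U (S - emb \<zeta>) + ereal (real m * g)"
    by (simp only: U.v_mult U_lift \<pi>m)
  then have "ereal (real (Suc m) * g) \<le> U (z - (\<Sum>i<Suc m. emb (c' i) * lift (\<pi> ^ i)))"
    using gS by (cases "U (S - emb \<zeta>)") (auto simp: algebra_simps)
  then show ?case using c(1) \<zeta> by (intro exI[of _ c']) (auto simp: c'_def)
qed

text \<open>After e digits the precision has grown by e g \<ge> 1 = v(p). The remainder is divided
  by p^N, a scalar, and its next e digits are absorbed into the old coefficients; so the number of
  terms stays e at every precision.\<close>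

lemma expansion:
  assumes \<pi>: "\<pi> \<noteq> 0" "\<omega> \<pi> = ereal g" "1 \<le> real e * g" and g: "\<And>z. z \<in> C \<Longrightarrow> 0 < U z \<Longrightarrow> ereal g \<le> U z"
    and z: "z \<in> C" "0 \<le> U z"
  shows "\<exists>c. (\<forall>i. emb (c i) \<in> C \<and> 0 \<le> v (c i)) \<and> ereal (real N) \<le> U (z - (\<Sum>i<e. emb (c i) * lift (\<pi> ^ i)))"
proof (induction N)
  case 0
  show ?case using z lift_in_C[of 0] by (intro exI[of _ "\<lambda>_. 0"]) (simp add: zero_ereal_def[symmetric])
next
  case (Suc N)
  then obtain c where c: "\<forall>i. emb (c i) \<in> C \<and> 0 \<le> v (c i)"
    "ereal (real N) \<le> U (z - (\<Sum>i<e. emb (c i) * lift (\<pi> ^ i)))" by blast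
  define R where "R = z - (\<Sum>i<e. emb (c i) * lift (\<pi> ^ i))"
  have RC: "R \<in> C" unfolding R_def using z(1) c(1) by (intro C_diff C_sum C_mult_lift) auto
  define q where "q = const_fract (of_nat p ^ N)"
  have q: "\<omega> q = ereal (real N)" "lift q = emb (of_nat p ^ N)" by (simp_all add: q_def \<omega>_const of_rat_power)
  then have q0: "q \<noteq> 0" by auto
  define S where "S = R * lift (inverse q)"
  have US: "U S = U R - ereal (real N)"
    unfolding S_def U.v_mult U_lift \<omega>.v_inverse[OF q0] q(1) by (simp add: minus_ereal_def)
  have SC: "S \<in> C" unfolding S_def using RC by (rule C_mult_lift)
  moreover have "0 \<le> U S" unfolding US using c(2) by (cases "U R") (auto simp: R_def[symmetric])
  ultimately obtain d where d: "\<forall>i. emb (d i) \<in> C \<and> 0 \<le> v (d i)"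
    "ereal (real e * g) \<le> U (S - (\<Sum>i<e. emb (d i) * lift (\<pi> ^ i)))"
    using expansion_step[OF \<pi>(1,2) g] by blast
  have SR: "S * lift q = R"
  proof -
    have "lift (inverse q) * lift q = lift (inverse q * q)" by (simp only: lift_simps)
    also have "\<dots> = 1" using q0 by simp
    finally show ?thesis by (simp only: S_def mult.assoc mult_1_right)
  qed
  define c' where "c' i = c i + d i * of_nat p ^ N" for i
  have "z - (\<Sum>i<e. emb (c' i) * lift (\<pi> ^ i)) = R - (\<Sum>i<e. emb (d i) * lift (\<pi> ^ i)) * lift q"
    unfolding q(2) R_def by (simp add: c'_def algebra_simps sum.distrib sum_distrib_left)
  also have "\<dots> = (S - (\<Sum>i<e. emb (d i) * lift (\<pi> ^ i))) * lift q" by (simp only: left_diff_distrib SR)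
  finally have "U (z - (\<Sum>i<e. emb (c' i) * lift (\<pi> ^ i))) = U (S - (\<Sum>i<e. emb (d i) * lift (\<pi> ^ i))) + ereal (real N)"
    by (simp only: U.v_mult U_lift q(1))
  moreover have "ereal 1 \<le> U (S - (\<Sum>i<e. emb (d i) * lift (\<pi> ^ i)))" using d(2) \<pi>(3) by (meson ereal_less_eq(3) order_trans)
  ultimately have "ereal (real (Suc N)) \<le> U (z - (\<Sum>i<e. emb (c' i) * lift (\<pi> ^ i)))"
    by (cases "U (S - (\<Sum>i<e. emb (d i) * lift (\<pi> ^ i)))") auto
  moreover have "emb (c' i) \<in> C \<and> 0 \<le> v (c' i)" for i
  proof
    have "emb (d i) * lift q \<in> C" using d(1) by (intro C_mult_lift) auto
    then show "emb (c' i) \<in> C" using c(1) by (simp add: c'_def q(2) C_add)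
    show "0 \<le> v (c' i)" using c(1) d(1) unfolding c'_def by (intro v_add_ge) (auto simp: v_mult)
  qed
  ultimately show ?case by blast
qed

text \<open>Boundedness of D makes u(X - r) exceed the Gauss value by at most a constant, uniformly
  in r; multiplicativity then costs that constant once per degree.\<close>

lemma u_le_gauss:
  "\<exists>K\<ge>0. \<forall>f. f \<noteq> 0 \<longrightarrow> u f \<le> gauss v 0 f + ereal (real (degree f) * K)"
proof -
  obtain B0 where B0: "D 0 = ereal B0" using D_finite by blast
  \<comment> \<open>If v r < min B0 0, then D r = v r. Otherwise the Gauss value of X - r is at
    least min B0 0, and K covers the gap from there to B.\<close>
  define K where "K = \<bar>B\<bar> + \<bar>B0\<bar>"
  have lin: "D r \<le> min 0 (v r) + ereal K" for r
  proof (cases "v r < min (ereal B0) 0")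
    case True
    have "D r = v r"
      using u.v_add_eq[of "[:- r:]" "[:0, 1:]"] True B0 by (simp add: D_def u_const)
    then show ?thesis using True by (cases "v r") (auto simp: min_def K_def split: if_splits)
  next
    case False
    then have "ereal (min B0 0) \<le> v r" by (auto simp: min_def not_less zero_ereal_def split: if_splits)
    then have "ereal (min B0 0) \<le> min 0 (v r)" by (auto simp: zero_ereal_def)
    then have "ereal (min B0 0) + ereal K \<le> min 0 (v r) + ereal K" by (rule add_right_mono)
    moreover have "B \<le> min B0 0 + K" by (auto simp: K_def min_def)
    then have "ereal B \<le> ereal (min B0 0) + ereal K" by (metis ereal_less_eq(3) plus_ereal.simps(1))
    ultimately show ?thesis using bounded[of r] by (meson order_trans)
  qed
  have "f \<noteq> 0 \<longrightarrow> u f \<le> gauss v 0 f + ereal (real (degree f) * K)" for f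
  proof (induction f rule: linear_factor_induct)
    case (const c)
    show ?case by (simp add: u_const gauss_const zero_ereal_def[symmetric])
  next
    case (linear r f)
    have "degree ([:- r, 1:] * f) = degree [:- r, 1:] + degree f" using linear.hyps by (intro degree_mult_eq) auto
    then have deg: "real (degree ([:- r, 1:] * f)) * K = K + real (degree f) * K" by (simp add: distrib_right)
    have "u ([:- r, 1:] * f) = D r + u f" by (simp only: u.v_mult D_def)
    also have "\<dots> \<le> (min 0 (v r) + ereal K) + (gauss v 0 f + ereal (real (degree f) * K))"
      using lin linear by (intro add_mono) auto
    also have "\<dots> = (min 0 (v r) + gauss v 0 f) + ereal (K + real (degree f) * K)"
      unfolding plus_ereal.simps(1)[symmetric] by (simp only: ac_simps)
    also have "min 0 (v r) + gauss v 0 f = gauss v 0 ([:- r, 1:] * f)"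
      unfolding gauss_mult gauss_linear by (simp add: zero_ereal_def)
    finally show ?case unfolding deg by simp
  qed
  then show ?thesis by (intro exI[of _ K]) (simp add: K_def)
qed

lemma contradiction: False
proof -
  obtain \<pi> g where \<pi>: "\<pi> \<noteq> 0" "\<omega> \<pi> = ereal g" "1 \<le> real e * g" and g: "\<And>z. z \<in> C \<Longrightarrow> 0 < U z \<Longrightarrow> ereal g \<le> U z"
    using ex_uniformizer by blast
  obtain K where K: "0 \<le> K" "\<And>f. f \<noteq> 0 \<Longrightarrow> u f \<le> gauss v 0 f + ereal (real (degree f) * K)" using u_le_gauss by blast
  obtain B0 where B0: "D 0 = ereal B0" using D_finite by blast
  \<comment> \<open>X itself may have negative value; p^s X does not, as \<open>expansion\<close>
    requires.\<close>
  obtain s :: nat where s: "- B0 \<le> real s" using real_arch_simple by blast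
  define Y where "Y = (const_fract (of_nat p ^ s) * Fract [:0, 1:] 1 :: rat poly fract)"
  have liftX: "lift (Fract [:0, 1:] 1) = Fract [:0, 1:] 1" by (simp add: lift_Fract map_poly_pCons one_pCons)
  have Y: "lift Y = emb (of_nat p ^ s) * Fract [:0, 1:] 1" by (simp add: Y_def liftX of_rat_power)
  have "U (Fract [:0, 1:] 1) = ereal B0" using B0 by (simp add: U_poly D_def)
  then have "U (lift Y) = ereal (real s + B0)" unfolding Y U.v_mult U_emb by simp
  then have "0 \<le> U (lift Y)" using s by simp
  then have Yj: "0 \<le> U (lift (Y ^ j))" for j unfolding lift_power U.v_power by simp
  have Ypow: "lift (Y ^ j) = Fract (monom (of_nat p ^ (s * j)) j) 1" for j
  proof (induction j)
    case (Suc j)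
    then show ?case
      by (simp add: Y emb_def monom_Suc monom_altdef smult_pCons power_add mult_ac)
  next
    case 0
    have "1 = Fract (monom 1 0 :: 'a poly) 1" by (simp add: One_fract_def monom_0 one_pCons)
    then show ?case by simp
  qed
  \<comment> \<open>The left side is the upper bound that \<open>u_le_gauss\<close> will give for
    the polynomial F below.\<close>
  obtain N :: nat where N: "real (s * e) + real e * K < real N" using reals_Archimedean2 by blast
  have "\<exists>c. ereal (real N) \<le> U (lift (Y ^ j) - (\<Sum>i<e. emb (c i) * lift (\<pi> ^ i)))" for j
    using expansion[OF \<pi> g lift_in_C Yj] by blast
  then obtain M where M: "\<And>j. ereal (real N) \<le> U (lift (Y ^ j) - (\<Sum>i<e. emb (M j i) * lift (\<pi> ^ i)))" by metis
  have "subfield (UNIV :: 'a set)" by (simp add: subfield_def)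
  \<comment> \<open>There are e + 1 powers of Y but only e powers of \<pi>, so some combination over
    K cancels all main terms.\<close>
  then have "\<exists>l. (\<forall>j. l j \<in> UNIV) \<and> (\<exists>j\<in>{..e}. l j \<noteq> 0) \<and> (\<forall>i\<in>{..<e}. (\<Sum>j\<in>{..e}. l j * M j i) = 0)"
    by (intro linear_dependence) auto
  then obtain l where l: "\<exists>j\<le>e. l j \<noteq> 0" "\<And>i. i < e \<Longrightarrow> (\<Sum>j\<le>e. l j * M j i) = 0" by auto
  define m where "m = Min ((\<lambda>j. v (l j)) ` {..e})"
  have "m \<in> (\<lambda>j. v (l j)) ` {..e}" unfolding m_def by (rule Min_in) auto
  then obtain j0 where j0: "j0 \<le> e" "v (l j0) = m" by auto
  have m_le: "m \<le> v (l j)" if "j \<le> e" for j unfolding m_def using that by (intro Min_le) auto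
  have "l j0 \<noteq> 0"
  proof
    assume "l j0 = 0"
    then have "v (l j) = \<infinity>" if "j \<le> e" for j using m_le[OF that] j0 by simp
    then show False using l(1) by auto
  qed
  then obtain x where x: "m = ereal x" using j0 v_realE by metis
  \<comment> \<open>Dividing by a coefficient of least value makes all of them integral and one
    equal to 1. Integrality preserves the precision N, and the coefficient 1 bounds the Gauss value
    of F.\<close>
  define a where "a j = l j / l j0" for j
  have a: "0 \<le> v (a j)" if "j \<le> e" for j
    using m_le[OF that] x j0 \<open>l j0 \<noteq> 0\<close> by (cases "v (l j)") (auto simp: a_def v_divide)
  have a0: "a j0 = 1" using \<open>l j0 \<noteq> 0\<close> by (simp add: a_def)
  have rel: "(\<Sum>j\<le>e. a j * M j i) = 0" if "i < e" for i
  proof -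
    have "(\<Sum>j\<le>e. a j * M j i) = (\<Sum>j\<le>e. l j * M j i) / l j0" by (simp add: a_def sum_divide_distrib)
    then show ?thesis using l(2)[OF that] by simp
  qed
  define F where "F = (\<Sum>j\<le>e. monom (a j * of_nat p ^ (s * j)) j)"
  have coF: "coeff F j0 = of_nat p ^ (s * j0)" using j0 a0 by (simp add: F_def coeff_sum)
  then have F0: "F \<noteq> 0" by auto
  have degF: "degree F \<le> e" unfolding F_def by (intro degree_sum_le) (auto intro: order_trans[OF degree_monom_le])
  have "(\<Sum>j\<le>e. emb (a j) * lift (Y ^ j)) = Fract F 1"
  proof -
    have add: "(\<Sum>j\<in>S. Fract (h j) 1) = Fract (sum h S) 1" for h :: "nat \<Rightarrow> 'a poly" and S
      by (induction S rule: infinite_finite_induct) (auto simp: Zero_fract_def)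
    have "emb (a j) * lift (Y ^ j) = Fract (monom (a j * of_nat p ^ (s * j)) j) 1" for j
      by (simp add: Ypow emb_def smult_monom)
    then show ?thesis unfolding F_def by (simp add: add)
  qed
  moreover have "(\<Sum>j\<le>e. emb (a j) * (lift (Y ^ j) - (\<Sum>i<e. emb (M j i) * lift (\<pi> ^ i)))) = (\<Sum>j\<le>e. emb (a j) * lift (Y ^ j))"
  proof -
    have "(\<Sum>j\<le>e. emb (a j) * (\<Sum>i<e. emb (M j i) * lift (\<pi> ^ i))) = (\<Sum>j\<le>e. \<Sum>i<e. emb (a j * M j i) * lift (\<pi> ^ i))"
      by (simp add: sum_distrib_left mult.assoc)
    also have "\<dots> = (\<Sum>i<e. emb (\<Sum>j\<le>e. a j * M j i) * lift (\<pi> ^ i))"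
      by (subst sum.swap) (simp only: emb_sum sum_distrib_right)
    also have "\<dots> = 0" using rel by simp
    finally show ?thesis by (simp add: right_diff_distrib sum_subtractf)
  qed
  moreover have "ereal (real N) \<le> U (\<Sum>j\<le>e. emb (a j) * (lift (Y ^ j) - (\<Sum>i<e. emb (M j i) * lift (\<pi> ^ i))))"
  proof (rule U.v_sum_ge)
    fix j assume "j \<in> {..e}"
    then have "0 + ereal (real N) \<le> v (a j) + U (lift (Y ^ j) - (\<Sum>i<e. emb (M j i) * lift (\<pi> ^ i)))"
      using a M by (intro add_mono) auto
    then show "ereal (real N) \<le> U (emb (a j) * (lift (Y ^ j) - (\<Sum>i<e. emb (M j i) * lift (\<pi> ^ i))))"
      unfolding U.v_mult U_emb by simp
  qed
  ultimately have "ereal (real N) \<le> u F" by (simp only: U_poly)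
  also have "\<dots> \<le> gauss v 0 F + ereal (real (degree F) * K)" using F0 by (rule K(2))
  also have "\<dots> \<le> ereal (real (s * e)) + ereal (real e * K)"
  proof (rule add_mono)
    have "gauss v 0 F \<le> ereal (real (s * j0))" using gauss_le[of 0 F j0] by (simp add: coF)
    also have "\<dots> \<le> ereal (real (s * e))" using j0 by (simp add: mult_left_mono)
    finally show "gauss v 0 F \<le> ereal (real (s * e))" .
    show "ereal (real (degree F) * K) \<le> ereal (real e * K)" using degF K(1) by (simp add: mult_right_mono)
  qed
  finally show False using N by simp
qed

end

context Cp
begin

theorem W_p_is_Zring:
  assumes "W \<in> W_p p"
  shows "\<exists>\<alpha> \<delta>. \<alpha> \<in> Cp_br v \<and> admissible v \<alpha> \<delta> \<and> W = Zring v \<alpha> \<delta>"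
proof -
  obtain \<omega> e where \<omega>: "dval \<omega> e" "W = {x. 0 \<le> \<omega> x}" "\<And>r. \<omega> (const_fract r) = v (of_rat r)"
    using W_p_imp_dval[OF assms] by blast
  interpret w: dval \<omega> e by (rule \<omega>)
  interpret Cp_W p v \<omega> e by unfold_locales (rule \<omega>(3))
  obtain u where u: "pval u" "\<And>c. u [:c:] = v c" "\<And>f. u (map_poly of_rat f) = \<omega> (Fract f 1)"
    using ex_extension by blast
  interpret u: pval u by (rule u)
  interpret Cp_ext p v \<omega> e u by unfold_locales (rule u(2), rule u(3))
  show ?thesis
  proof (cases "\<exists>\<alpha>. \<forall>r. D r \<le> D \<alpha>")
    case True
    then obtain \<alpha> where max: "\<And>r. D r \<le> D \<alpha>" by blast
    show ?thesis
    proof (cases "D \<alpha>")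
      case (real d)
      then show ?thesis using maximum_finite[OF max] \<omega>(2) by simp
    next
      case PInf
      then show ?thesis using maximum_infinite \<omega>(2) by blast
    next
      case MInf
      then show ?thesis by (simp add: D_def)
    qed
  next
    case False
    then have strict: "\<exists>s. D r < D s" for r by (meson not_le)
    show ?thesis
    proof (cases "\<forall>M::real. \<exists>r. ereal M \<le> D r")
      case True
      then obtain \<alpha> where "D \<alpha> = \<infinity>" using unbounded_imp_attained by blast
      then show ?thesis using maximum_infinite \<omega>(2) by blast
    next
      case False
      then obtain B :: real where B: "\<And>r. D r \<le> ereal B" by (meson linear)
      interpret Cp_type4 p v \<omega> e u B by unfold_locales (rule strict, rule B)
      show ?thesis using contradiction by blast
    qed
  qed
qed

end

text \<open>In the middle clause the direction from balls to rings says that the map is well defined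
  on orbits, the converse that it is injective. The first clause places the rings in the target, the
  last is surjectivity.\<close>

theorem mainTheorem7:
  fixes p :: nat and v :: "'a::field_char_0 \<Rightarrow> ereal"
  assumes "prime p" and "is_Cp p v"
  shows "(\<forall>\<alpha> \<delta>. \<alpha> \<in> Cp_br v \<and> admissible v \<alpha> \<delta> \<longrightarrow> Zring v \<alpha> \<delta> \<in> W_p p)
    \<and> (\<forall>\<alpha> \<delta> \<beta> \<epsilon>. \<alpha> \<in> Cp_br v \<and> admissible v \<alpha> \<delta> \<and> \<beta> \<in> Cp_br v \<and> admissible v \<beta> \<epsilon> \<longrightarrow>
         ((\<exists>\<sigma>\<in>Gal_p v. ball_p v \<beta> \<epsilon> = ball_p v (\<sigma> \<alpha>) \<delta>) \<longleftrightarrow> Zring v \<alpha> \<delta> = Zring v \<beta> \<epsilon>))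
    \<and> (\<forall>W\<in>W_p p. \<exists>\<alpha> \<delta>. \<alpha> \<in> Cp_br v \<and> admissible v \<alpha> \<delta> \<and> W = Zring v \<alpha> \<delta>)"
proof -
  interpret Cp p v by (rule Cp.intro[OF assms])
  show ?thesis using Zring_is_DVR Zring_eq_iff W_p_is_Zring by blast
qed

end
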